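(* Let $n\ge 3$ be odd. A configuration $(\sigma,\tau_s,\tau_{c_i},\rho_{c_i},\rho_{e_{i,j}},x,y_i,z)\in\mathcal{S}_{\text{conf}}$ of the $n\times n\times n$ Rubik's Cube is valid if it satisfies: (1) $\operatorname{sgn}(\sigma)=\operatorname{sgn}(\tau_s)=\operatorname{sgn}(\rho_{c_i})$ for every center corner orbit $i$; (2) $\operatorname{sgn}(\rho_{e_{i,j}})=\operatorname{sgn}(\sigma)\operatorname{sgn}(\tau_i)\operatorname{sgn}(\tau_j)$ for every center edge orbit $(i,j)$, where $\tau_k$ denotes $\tau_{c_k}$ and $\operatorname{sgn}(\tau_{(n+1)/2})$ is interpreted as $1$; (3) $\sum_{k=1}^8 x_k=0$ in $\mathbb{Z}_3$; (4) $\sum_{k=1}^{12} z_k=0$ in $\mathbb{Z}_2$; (5) $y_i=0$ for every coupled edge orbit $i$.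
   Context: Cube and moves: the $n\times n\times n$ Rubik's Cube has faces U, D, F, B, R, L, each an $n\times n$ grid of facelets carrying stickers; in the solved state each face is monochromatic with six distinct colors. For $1\le k\le\lfloor n/2\rfloor$, $F_k,B_k,R_k,L_k,U_k,D_k$ denote clockwise (seen from the named face) $90^\circ$ rotations of the $k$-th slice counted from the named face. A configuration is valid if it is obtained from the solved state by a sequence of these moves. Cubie types ($n$ odd): 8 corners (3 stickers); along each of the 12 edges lie edge cubies at positions $2,\dots,n-1$; the one at position $(n+1)/2$ is a single edge; for $2\le i\le (n-1)/2$ the 24 edge cubies at positions $i$ and $n+1-i$ form coupled edge orbit $i$. On each face index facelets $(r,c)$, $1\le r,c\le n$; for $2\le i\le (n-1)/2$ the center corner orbit $i$ is the 24 facelets with $r,c\in\{i,n+1-i\}$; for $2\le i\le (n-1)/2$, $2\le j\le (n+1)/2$, $j\ne i$, the center edge orbit $(i,j)$ is the 24 facelets occupying on each face the positions $(i,j),(j,n+1-i),(n+1-i,n+1-j),(n+1-j,i)$. $\mathcal{S}_{\text{conf}}$ is the set of arrangements obtained from the solved cube by disassembling and reassembling cubies, each cubie placed in a position of its own orbit (corners among corner positions, single edges among single-edge positions, coupled edges of orbit $i$ within orbit $i$, centers of an orbit within that orbit), corners in any of 3 rotations and edges in either of 2 orientations. Such an arrangement is the tuple: $\sigma\in S_8$ (corner permutation), $\tau_s\in S_{12}$ (single edges), $\tau_{c_i}\in S_{24}$ (coupled edges of orbit $i$), $\rho_{c_i}\in S_{24}$ (center corners of orbit $i$), $\rho_{e_{i,j}}\in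 S_{24}$ (center edges of orbit $(i,j)$), $x\in\mathbb{Z}_3^8$, $y_i\in\mathbb{Z}_2^{24}$, $z\in\mathbb{Z}_2^{12}$ (orientations of corners, coupled edges of orbit $i$, single edges); the solved state has identity permutations and zero orientations. Orientations: a corner has exactly one sticker of the color of the (solved) white or yellow face, a designated pair of opposite faces; its orientation is $0$ if that sticker lies on the white or yellow face, $1$/$2$ if rotated one/two steps clockwise from that. For single edges, one of the two facelets of each single-edge position is a fixed reference facelet (chosen so that the solved state has orientation 0); $z_k=0$ iff the sticker of the cubie at position $k$ that lay on a reference facelet in the solved state lies on a reference facelet. For coupled edges, a coupled-edge facelet on face $X$ along the edge shared with face $Y$ is left-handed if, viewing $X$ from outside with that edge at the top, it lies left of the edge's midpoint; $y_{i,k}=0$ iff the sticker of the cubie at position $k$ of orbit $i$ that lay on a left-handed facelet in the solved state lies on a left-handed facelet. *)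

theory Defs
  imports "HOL-Combinatorics.Permutations" "HOL-Combinatorics.Orbits" "HOL-Number_Theory.Cong"
begin

text \<open>
  Geometry. The cube is centred at the origin, with axes pointing to the faces R, U, F, and
  cubies have side 2. The \<open>k\<close>-th layer in an axis direction (counted from the negative end)
  then has coordinate \<open>2k - n - 1\<close>, and the outermost layers have coordinates \<open>\<plusminus>(n - 1)\<close>.
  A facelet is a pair of the position of its cubie and the outward normal of its face; a sticker
  is named by the facelet on which it lies in the solved state.
\<close>

type_synonym vec = "int \<times> int \<times> int"
type_synonym facelet = "vec \<times> vec"

fun dot :: "vec \<Rightarrow> vec \<Rightarrow> int" where
  "dot (a, b, c) (a', b', c') = a * a' + b * b' + c * c'"

fun cross :: "vec \<Rightarrow> vec \<Rightarrow> vec" where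
  "cross (a, b, c) (a', b', c') = (b * c' - c * b', c * a' - a * c', a * b' - b * a')"

datatype face = Up | Down | Front | Back | Right | Left

fun normal :: "face \<Rightarrow> vec" where
  "normal Right = (1, 0, 0)"
| "normal Left  = (- 1, 0, 0)"
| "normal Up    = (0, 1, 0)"
| "normal Down  = (0, - 1, 0)"
| "normal Front = (0, 0, 1)"
| "normal Back  = (0, 0, - 1)"

fun opposite :: "face \<Rightarrow> face" where
  "opposite Right = Left"
| "opposite Left  = Right"
| "opposite Up    = Down"
| "opposite Down  = Up"
| "opposite Front = Back"
| "opposite Back  = Front"

definition coord :: "nat \<Rightarrow> nat \<Rightarrow> int" where
  "coord n k = 2 * int k - int n - 1"

text \<open>
  Position of row \<open>r\<close>, column \<open>c\<close> of a face seen from outside, with row 1 at the top and column 1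
  at the left. The faces F, R, B, L are viewed with U at the top, the face U with B at the top,
  and the face D with F at the top.
\<close>

fun facelet_pos :: "nat \<Rightarrow> face \<Rightarrow> nat \<Rightarrow> nat \<Rightarrow> vec" where
  "facelet_pos n Front r c = (coord n c, - coord n r, int n - 1)"
| "facelet_pos n Back r c  = (- coord n c, - coord n r, - (int n - 1))"
| "facelet_pos n Right r c = (int n - 1, - coord n r, - coord n c)"
| "facelet_pos n Left r c  = (- (int n - 1), - coord n r, coord n c)"
| "facelet_pos n Up r c    = (coord n c, int n - 1, coord n r)"
| "facelet_pos n Down r c  = (coord n c, - (int n - 1), - coord n r)"

definition facelet_at :: "nat \<Rightarrow> face \<Rightarrow> nat \<Rightarrow> nat \<Rightarrow> facelet" where
  "facelet_at n X r c = (facelet_pos n X r c, normal X)"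

definition facelets :: "nat \<Rightarrow> facelet set" where
  "facelets n = {facelet_at n X r c | X r c. r \<in> {1..n} \<and> c \<in> {1..n}}"


text \<open>
  The rotation by 90 degrees about the unit vector \<open>d\<close>, clockwise when seen from its tip,
  is \<open>v \<mapsto> (v \<bullet> d) d + v \<times> d\<close>.
\<close>

fun rot_cw :: "vec \<Rightarrow> vec \<Rightarrow> vec" where
  "rot_cw (d1, d2, d3) v =
     (let t = dot v (d1, d2, d3); (w1, w2, w3) = cross v (d1, d2, d3)
      in (t * d1 + w1, t * d2 + w2, t * d3 + w3))"

text \<open>The \<open>k\<close>-th slice counted from face \<open>X\<close> consists of the positions \<open>p\<close> with
  \<open>p \<bullet> normal X = n + 1 - 2k\<close>.\<close>

definition move :: "nat \<Rightarrow> face \<Rightarrow> nat \<Rightarrow> facelet \<Rightarrow> facelet" where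
  "move n X k s =
     (if s \<in> facelets n \<and> dot (fst s) (normal X) = int n + 1 - 2 * int k
      then (rot_cw (normal X) (fst s), rot_cw (normal X) (snd s)) else s)"

text \<open>
  An arrangement is a function \<open>g\<close> that sends every sticker to the facelet on which it now lies
  (and is the identity off the cube); the solved cube is \<open>id\<close>. All stickers are distinguished,
  including those of equal colour on the centre facelets.
\<close>

inductive valid :: "nat \<Rightarrow> (facelet \<Rightarrow> facelet) \<Rightarrow> bool" for n where
  solved: "valid n id"
| turn: "valid n g \<Longrightarrow> 1 \<le> k \<Longrightarrow> k \<le> n div 2 \<Longrightarrow> valid n (move n X k \<circ> g)"


definition corners :: "nat \<Rightarrow> vec set" where
  "corners n = {(a, b, c). \<bar>a\<bar> = int n - 1 \<and> \<bar>b\<bar> = int n - 1 \<and> \<bar>c\<bar> = int n - 1}"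

definition edges_at :: "nat \<Rightarrow> nat \<Rightarrow> vec set" where
  "edges_at n k =
     {(a, b, c). \<bar>a\<bar> = int n - 1 \<and> \<bar>b\<bar> = int n - 1 \<and> c = coord n k} \<union>
     {(a, b, c). \<bar>a\<bar> = int n - 1 \<and> b = coord n k \<and> \<bar>c\<bar> = int n - 1} \<union>
     {(a, b, c). a = coord n k \<and> \<bar>b\<bar> = int n - 1 \<and> \<bar>c\<bar> = int n - 1}"

definition single_edges :: "nat \<Rightarrow> vec set" where
  "single_edges n = edges_at n ((n + 1) div 2)"

definition coupled_edges :: "nat \<Rightarrow> nat \<Rightarrow> vec set" where
  "coupled_edges n i = edges_at n i \<union> edges_at n (n + 1 - i)"

definition center_corners :: "nat \<Rightarrow> nat \<Rightarrow> facelet set" where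
  "center_corners n i =
     {facelet_at n X r c | X r c. r \<in> {i, n + 1 - i} \<and> c \<in> {i, n + 1 - i}}"

definition center_edges :: "nat \<Rightarrow> nat \<Rightarrow> nat \<Rightarrow> facelet set" where
  "center_edges n i j =
     {facelet_at n X r c | X r c.
        (r, c) \<in> {(i, j), (j, n + 1 - i), (n + 1 - i, n + 1 - j), (n + 1 - j, i)}}"

definition pair_orbits :: "nat \<Rightarrow> nat set" where
  "pair_orbits n = {2..(n - 1) div 2}"

definition center_edge_orbits :: "nat \<Rightarrow> (nat \<times> nat) set" where
  "center_edge_orbits n =
     {(i, j). i \<in> {2..(n - 1) div 2} \<and> j \<in> {2..(n + 1) div 2} \<and> j \<noteq> i}"


text \<open>
  \<open>cw_step s t\<close>: the facelets \<open>s\<close>, \<open>t\<close> belong to the same corner, and \<open>t\<close> is one step clockwise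
  from \<open>s\<close> when that corner is seen from outside.
\<close>

definition cw_step :: "facelet \<Rightarrow> facelet \<Rightarrow> bool" where
  "cw_step s t \<longleftrightarrow> fst s = fst t \<and> dot (cross (snd t) (snd s)) (fst s) > 0"

text \<open>
  Reassembled cubes: stickers of one cubie stay together, every cubie stays in its orbit, corners
  are rotated but not reflected, and the six face midpoints, which belong to no orbit, are fixed.
\<close>

definition S_conf :: "nat \<Rightarrow> (facelet \<Rightarrow> facelet) set" where
  "S_conf n = {g. g permutes facelets n \<and>
     (\<forall>s\<in>facelets n. \<forall>t\<in>facelets n. fst s = fst t \<longrightarrow> fst (g s) = fst (g t)) \<and>
     (\<forall>s\<in>facelets n. fst s \<in> corners n \<longrightarrow> fst (g s) \<in> corners n) \<and>
     (\<forall>s\<in>facelets n. \<forall>t\<in>facelets n. fst s \<in> corners n \<and> cw_step s t \<longrightarrow> cw_step (g s) (g t)) \<and>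
     (\<forall>s\<in>facelets n. fst s \<in> single_edges n \<longrightarrow> fst (g s) \<in> single_edges n) \<and>
     (\<forall>i\<in>pair_orbits n. \<forall>s\<in>facelets n.
        fst s \<in> coupled_edges n i \<longrightarrow> fst (g s) \<in> coupled_edges n i) \<and>
     (\<forall>i\<in>pair_orbits n. \<forall>s\<in>center_corners n i. g s \<in> center_corners n i) \<and>
     (\<forall>(i, j)\<in>center_edge_orbits n. \<forall>s\<in>center_edges n i j. g s \<in> center_edges n i j) \<and>
     (\<forall>X. g (facelet_at n X ((n + 1) div 2) ((n + 1) div 2)) =
          facelet_at n X ((n + 1) div 2) ((n + 1) div 2))}"


definition cubie_dest :: "nat \<Rightarrow> (facelet \<Rightarrow> facelet) \<Rightarrow> vec \<Rightarrow> vec" where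
  "cubie_dest n g p = (THE q. \<exists>s\<in>facelets n. fst s = p \<and> fst (g s) = q)"

text \<open>The facelets of corners on the white face \<open>W\<close> and the opposite (yellow) face.\<close>

definition white_yellow :: "nat \<Rightarrow> face \<Rightarrow> facelet set" where
  "white_yellow n W =
     {s \<in> facelets n. fst s \<in> corners n \<and> snd s \<in> {normal W, normal (opposite W)}}"

definition corner_orient :: "nat \<Rightarrow> face \<Rightarrow> (facelet \<Rightarrow> facelet) \<Rightarrow> vec \<Rightarrow> nat" where
  "corner_orient n W g p =
     (if \<exists>s\<in>white_yellow n W. fst (g s) = p \<and> g s \<in> white_yellow n W then 0
      else if \<exists>s\<in>white_yellow n W. \<exists>t\<in>white_yellow n W. fst (g s) = p \<and> cw_step t (g s) then 1
      else 2)"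

text \<open>Orientation of the edge cubie now at position \<open>p\<close>, where \<open>A\<close> contains exactly one of the
  two facelets of each position of the orbit.\<close>

definition edge_orient :: "facelet set \<Rightarrow> (facelet \<Rightarrow> facelet) \<Rightarrow> vec \<Rightarrow> nat" where
  "edge_orient A g p = (if \<exists>s\<in>A. fst (g s) = p \<and> g s \<in> A then 0 else 1)"

definition reference_facelets :: "nat \<Rightarrow> facelet set \<Rightarrow> bool" where
  "reference_facelets n Ref \<longleftrightarrow>
     Ref \<subseteq> {s \<in> facelets n. fst s \<in> single_edges n} \<and>
     (\<forall>p\<in>single_edges n. \<exists>!s. s \<in> Ref \<and> fst s = p)"

text \<open>
  For a facelet at position \<open>p\<close> on a face with normal \<open>d\<close>, next to the face with normal \<open>e\<close>:
  seen from outside with \<open>e\<close> pointing up, the direction to the right is \<open>e \<times> d\<close>.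
\<close>

definition left_handed :: "nat \<Rightarrow> nat \<Rightarrow> facelet set" where
  "left_handed n i =
     {(p, d). (p, d) \<in> facelets n \<and> p \<in> coupled_edges n i \<and>
        (\<exists>e. e \<noteq> d \<and> (p, e) \<in> facelets n \<and> dot p (cross e d) < 0)}"

text \<open>
  The tuple \<open>(\<sigma>, \<tau>\<^sub>s, \<tau>\<^sub>c, \<rho>\<^sub>c, \<rho>\<^sub>e, x, y, z)\<close> of an arrangement. The permutations act on the
  positions of the respective orbit rather than on a numbering of them, and the orientations are
  indexed by these positions, with values in \<open>{0, 1, 2}\<close> and \<open>{0, 1}\<close>.
\<close>

definition conf_tuple :: "nat \<Rightarrow> face \<Rightarrow> facelet set \<Rightarrow> (facelet \<Rightarrow> facelet) \<Rightarrow>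
    (vec \<Rightarrow> vec) \<times> (vec \<Rightarrow> vec) \<times> (nat \<Rightarrow> vec \<Rightarrow> vec) \<times>
    (nat \<Rightarrow> facelet \<Rightarrow> facelet) \<times> (nat \<Rightarrow> nat \<Rightarrow> facelet \<Rightarrow> facelet) \<times>
    (vec \<Rightarrow> nat) \<times> (nat \<Rightarrow> vec \<Rightarrow> nat) \<times> (vec \<Rightarrow> nat)" where
  "conf_tuple n W Ref g =
     (perm_restrict (cubie_dest n g) (corners n),
      perm_restrict (cubie_dest n g) (single_edges n),
      \<lambda>i. perm_restrict (cubie_dest n g) (coupled_edges n i),
      \<lambda>i. perm_restrict g (center_corners n i),
      \<lambda>i j. perm_restrict g (center_edges n i j),
      corner_orient n W g,
      \<lambda>i. edge_orient (left_handed n i) g,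
      edge_orient Ref g)"

end

theory Submission
  imports Defs
begin

text \<open>
  The cubies of each orbit form blocks of facelets. If two arrangements have supports that meet in
  a single cubie, their commutator is a three-cycle of cubies; suitable commutators of conjugated
  slice turns give one three-cycle \<open>(a b x)\<close> in every orbit. Conjugating it with slices that
  avoid \<open>a\<close> and \<open>b\<close> moves \<open>x\<close> to every other facelet of the orbit, and then all
  three-cycles, and hence all even permutations with total twist zero, are valid. The middle
  slices may be used as well: they are not valid, but they normalize the group of valid
  arrangements. It remains to make all signs trivial, and under the given sign conditions turns of
  the slices parallel to the upper face suffice for this.
\<close>

section \<open>Wreath products generated by three-cycles\<close>

text \<open>The sign conditions come from a count of four-cycles. A turn of the upper layer is one
  four-cycle on the corners, on the single edges and on every centre orbit, and two on every coupled
  orbit. A turn of the inner layer at \<open>height k\<close> is one four-cycle on coupled orbit k,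
  and one on centre orbit (i, j) for each of i and j that equals k; on all other orbits it does
  nothing. Hence all these turns satisfy the sign conditions, and so do their products. Once the
  upper layer has corrected the corner sign and each inner layer its own coupled sign, the
  conditions force every remaining sign to be 1. Orbit i of the centre corners is handled as the
  case j = i of the centre edges, where the two coupled signs cancel.

  One argument serves corners, edges and centres because they differ only in \<pi>, its order d, and
  T. Orientation is controlled by letting all maps commute with \<pi>; the total twist is then the
  usual homomorphism from a wreath product to the integers mod d.\<close>

text \<open>
  \<open>\<Omega>\<close> is the set of facelets of an orbit, \<open>blk\<close> assigns to a facelet its cubie, \<open>\<pi>\<close> passes to the
  next facelet of the same cubie, and \<open>lab\<close> measures orientations. Arrangements have to preserve
  \<open>T\<close>, which is the set of left-handed facelets for coupled edges and \<open>\<Omega>\<close> for all other orbits.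
\<close>

locale block_orbit =
  fixes \<Omega> T :: "'a set" and \<pi> :: "'a \<Rightarrow> 'a" and blk :: "'a \<Rightarrow> 'b" and lab :: "'a \<Rightarrow> int" and d :: nat
  assumes finite_Omega: "finite \<Omega>"
    and d_pos: "0 < d"
    and pi_closed: "s \<in> \<Omega> \<Longrightarrow> \<pi> s \<in> \<Omega>"
    and pi_order: "s \<in> \<Omega> \<Longrightarrow> (\<pi> ^^ d) s = s"
    and blk_eq_iff: "s \<in> \<Omega> \<Longrightarrow> t \<in> \<Omega> \<Longrightarrow> blk s = blk t \<longleftrightarrow> (\<exists>j. t = (\<pi> ^^ j) s)"
    and lab_pi: "s \<in> \<Omega> \<Longrightarrow> [lab (\<pi> s) = lab s + 1] (mod int d)"
    and T_subset: "T \<subseteq> \<Omega>"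
    and T_meets: "s \<in> \<Omega> \<Longrightarrow> \<exists>t\<in>T. blk t = blk s"
    and T_homogeneous: "s \<in> T \<Longrightarrow> t \<in> T \<Longrightarrow> (\<pi> ^^ j) s \<in> T \<Longrightarrow> (\<pi> ^^ j) t \<in> T"
begin

lemma T_Omega: "s \<in> T \<Longrightarrow> s \<in> \<Omega>"
  using T_subset by blast

lemma pi_pow_closed: "s \<in> \<Omega> \<Longrightarrow> (\<pi> ^^ j) s \<in> \<Omega>"
  by (induction j) (auto intro: pi_closed)

lemma blk_pi_pow [simp]: "s \<in> \<Omega> \<Longrightarrow> blk ((\<pi> ^^ j) s) = blk s"
  using blk_eq_iff pi_pow_closed by metis

lemma blk_eqE:
  assumes "blk s = blk t" "s \<in> \<Omega>" "t \<in> \<Omega>"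
  obtains j where "t = (\<pi> ^^ j) s"
  using assms blk_eq_iff by blast

lemma lab_pi_pow: "s \<in> \<Omega> \<Longrightarrow> [lab ((\<pi> ^^ j) s) = lab s + int j] (mod int d)"
proof (induction j)
  case (Suc j)
  have "[lab (\<pi> ((\<pi> ^^ j) s)) = lab ((\<pi> ^^ j) s) + 1] (mod int d)"
    using Suc.prems lab_pi pi_pow_closed by blast
  also have "[lab ((\<pi> ^^ j) s) + 1 = lab s + int j + 1] (mod int d)"
    using Suc by (intro cong_add) auto
  finally show ?case by (simp add: algebra_simps)
qed simp

lemma pi_pow_mult: "s \<in> \<Omega> \<Longrightarrow> (\<pi> ^^ (d * k)) s = s"
proof (induction k)
  case (Suc k)
  have "(\<pi> ^^ (d * Suc k)) s = (\<pi> ^^ d) ((\<pi> ^^ (d * k)) s)"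
    by (simp add: funpow_add)
  then show ?case using Suc pi_order by simp
qed simp

text \<open>A j-fold step adds j to the label, so equal labels force d to divide j, and d steps
  close up. This lets a label difference congruent to 0 be read as a cubie that is not
  rotated.\<close>

lemma pi_pow_eqI:
  assumes "s \<in> \<Omega>" "[lab ((\<pi> ^^ j) s) = lab s] (mod int d)"
  shows "(\<pi> ^^ j) s = s"
proof -
  have "[lab s + int j = lab s + 0] (mod int d)"
    using assms lab_pi_pow[OF assms(1), of j] by (metis add.right_neutral cong_sym cong_trans)
  then have "[int j = 0] (mod int d)"
    by (simp add: cong_add_lcancel_0)
  then have "d dvd j"
    by (simp add: cong_0_iff)
  then show ?thesis using pi_pow_mult assms(1) by (auto elim!: dvdE)
qed

text \<open>Iteration has natural exponents only. Going back j steps is therefore written as going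
  forward (d - 1) * j steps, which is the same because d steps close up.\<close>

lemma pi_pow_inverse:
  obtains j' where "\<And>s. s \<in> \<Omega> \<Longrightarrow> (\<pi> ^^ j') ((\<pi> ^^ j) s) = s"
    "\<And>s. s \<in> \<Omega> \<Longrightarrow> (\<pi> ^^ j) ((\<pi> ^^ j') s) = s"
proof -
  have e: "(d - 1) * j + j = d * j" "j + (d - 1) * j = d * j"
    using d_pos by (cases d; simp)+
  show ?thesis
    by (rule that[of "(d - 1) * j"])
      (use pi_pow_mult in \<open>simp_all add: funpow_add[THEN fun_cong, unfolded comp_def, symmetric] e[unfolded One_nat_def]\<close>)
qed

text \<open>Blocks are the cycles of \<pi>, so commuting with \<pi> says that cubies move rigidly:
  up to the condition on T these are the elements of a wreath product. The inclusions are equalities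
  because \<Omega> is finite and the map is injective on it. Nothing is asked outside \<Omega>, so
  one slice turn can be compatible with every orbit at once.\<close>

definition compat :: "('a \<Rightarrow> 'a) \<Rightarrow> bool" where
  "compat f \<longleftrightarrow> f ` \<Omega> \<subseteq> \<Omega> \<and> inj_on f \<Omega> \<and> (\<forall>s\<in>\<Omega>. f (\<pi> s) = \<pi> (f s)) \<and> f ` T \<subseteq> T"

definition rep :: "'b \<Rightarrow> 'a" where
  "rep p = (SOME s. s \<in> \<Omega> \<and> blk s = p)"

text \<open>The identity off the positions of the orbit makes this a permutation of the whole type,
  as \<open>sign\<close> requires.\<close>

definition bact :: "('a \<Rightarrow> 'a) \<Rightarrow> 'b \<Rightarrow> 'b" where
  "bact f p = (if p \<in> blk ` \<Omega> then blk (f (rep p)) else p)"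

definition osign :: "('a \<Rightarrow> 'a) \<Rightarrow> int" where
  "osign f = sign (bact f)"

text \<open>Every summand is reduced on its own, so that other representatives give the same integer
  and not just a congruent one (\<open>twist_transversal\<close>).\<close>

definition twist :: "('a \<Rightarrow> 'a) \<Rightarrow> int" where
  "twist f = (\<Sum>p\<in>blk ` \<Omega>. (lab (f (rep p)) - lab (rep p)) mod int d)"

definition transversal :: "'a set \<Rightarrow> bool" where
  "transversal A \<longleftrightarrow> A \<subseteq> \<Omega> \<and> bij_betw blk A (blk ` \<Omega>)"

lemma compatD:
  assumes "compat f" "s \<in> \<Omega>"
  shows "f s \<in> \<Omega>" "f (\<pi> s) = \<pi> (f s)" "f ((\<pi> ^^ j) s) = (\<pi> ^^ j) (f s)"
proof -
  show *: "f s \<in> \<Omega>" "f (\<pi> s) = \<pi> (f s)" using assms by (auto simp: compat_def)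
  show "f ((\<pi> ^^ j) s) = (\<pi> ^^ j) (f s)"
    using assms by (induction j) (simp_all add: compat_def pi_pow_closed)
qed

lemma compat_T: "compat f \<Longrightarrow> s \<in> T \<Longrightarrow> f s \<in> T"
  by (auto simp: compat_def)

lemma compat_inj: "compat f \<Longrightarrow> s \<in> \<Omega> \<Longrightarrow> t \<in> \<Omega> \<Longrightarrow> f s = f t \<Longrightarrow> s = t"
  by (auto simp: compat_def inj_on_def)

lemma compat_image: "compat f \<Longrightarrow> f ` \<Omega> = \<Omega>"
  using endo_inj_surj[OF finite_Omega] by (auto simp: compat_def)

lemma compat_comp: "compat f \<Longrightarrow> compat g \<Longrightarrow> compat (f \<circ> g)"
  unfolding compat_def image_subset_iff inj_on_def comp_apply by metis

lemma rep: "p \<in> blk ` \<Omega> \<Longrightarrow> rep p \<in> \<Omega> \<and> blk (rep p) = p"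
  unfolding rep_def by (rule someI_ex) auto

lemma compat_blk_eq:
  assumes "compat f" "s \<in> \<Omega>" "t \<in> \<Omega>" "blk s = blk t"
  shows "blk (f s) = blk (f t)"
  using assms by (metis blk_eqE blk_pi_pow compatD(1,3))

lemma bact_blk:
  assumes "compat f" "s \<in> \<Omega>"
  shows "bact f (blk s) = blk (f s)"
  using rep[of "blk s"] compat_blk_eq[OF assms(1), of "rep (blk s)" s] assms(2)
  by (simp add: bact_def)

lemma bact_permutes:
  assumes "compat f"
  shows "bact f permutes blk ` \<Omega>"
proof (rule bij_imp_permutes)
  have im: "bact f ` blk ` \<Omega> = blk ` \<Omega>"
  proof -
    have "bact f ` blk ` \<Omega> = blk ` f ` \<Omega>"
      using bact_blk[OF assms] by (simp add: image_image)
    then show ?thesis using compat_image[OF assms] by simp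
  qed
  then show "bij_betw (bact f) (blk ` \<Omega>) (blk ` \<Omega>)"
    using finite_Omega by (simp add: bij_betw_def eq_card_imp_inj_on)
qed (simp add: bact_def)

lemma bact_comp:
  assumes "compat f" "compat g"
  shows "bact (f \<circ> g) = bact f \<circ> bact g"
proof
  fix p
  show "bact (f \<circ> g) p = (bact f \<circ> bact g) p"
  proof (cases "p \<in> blk ` \<Omega>")
    case True
    then obtain s where "s \<in> \<Omega>" "p = blk s" by blast
    then show ?thesis
      using assms compatD(1) compat_comp[OF assms] by (simp add: bact_blk)
  qed (simp add: bact_def)
qed

lemma osign_comp:
  assumes "compat f" "compat g"
  shows "osign (f \<circ> g) = osign f * osign g"
  unfolding osign_def bact_comp[OF assms]
  by (rule sign_compose)
    (use bact_permutes assms finite_Omega in \<open>auto simp: permutation_permutes intro!: exI[of _ "blk ` \<Omega>"]\<close>)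

lemma osign_square: "osign f * osign f = 1"
  unfolding osign_def by (simp add: sign_def)

text \<open>This congruence and the next two serve to replace an arrangement by its restriction to a
  single orbit.\<close>

lemma osign_cong: "(\<And>s. s \<in> \<Omega> \<Longrightarrow> f s = g s) \<Longrightarrow> osign f = osign g"
  unfolding osign_def by (rule arg_cong[of _ _ sign]) (auto simp: bact_def fun_eq_iff rep)

lemma twist_cong: "(\<And>s. s \<in> \<Omega> \<Longrightarrow> f s = g s) \<Longrightarrow> twist f = twist g"
  unfolding twist_def by (rule sum.cong) (auto simp: rep)

lemma compat_cong: "(\<And>s. s \<in> \<Omega> \<Longrightarrow> f s = g s) \<Longrightarrow> compat f \<longleftrightarrow> compat g"
proof -
  assume *: "\<And>s. s \<in> \<Omega> \<Longrightarrow> f s = g s"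
  then have "f ` \<Omega> = g ` \<Omega>" "inj_on f \<Omega> = inj_on g \<Omega>" "f ` T = g ` T"
    using T_subset by (auto simp: inj_on_def subset_iff intro!: image_cong)
  then show ?thesis using * pi_closed by (auto simp: compat_def)
qed

text \<open>Choosing another facelet of a cubie adds the same number of steps to the labels before
  and after the move, since \<open>f\<close> commutes with \<pi>. The difference does not see the
  choice.\<close>

lemma twist_transversal:
  assumes "compat f" "transversal A"
  shows "twist f = (\<Sum>s\<in>A. (lab (f s) - lab s) mod int d)"
proof -
  have A: "A \<subseteq> \<Omega>" "inj_on blk A" "blk ` A = blk ` \<Omega>"
    using assms by (auto simp: transversal_def bij_betw_def)
  have c: "(lab (f (rep (blk s))) - lab (rep (blk s))) mod int d = (lab (f s) - lab s) mod int d"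
    if s: "s \<in> \<Omega>" for s
  proof -
    have r: "rep (blk s) \<in> \<Omega>" "blk (rep (blk s)) = blk s" using rep[of "blk s"] s by auto
    then obtain j where j: "rep (blk s) = (\<pi> ^^ j) s" using s by (metis blk_eqE)
    have "[lab ((\<pi> ^^ j) (f s)) - lab ((\<pi> ^^ j) s) = (lab (f s) + int j) - (lab s + int j)] (mod int d)"
      using s compatD(1)[OF assms(1)] by (intro cong_diff lab_pi_pow) auto
    then show ?thesis using j compatD(3)[OF assms(1) s] by (simp add: cong_def)
  qed
  show ?thesis unfolding twist_def A(3)[symmetric]
    by (subst sum.reindex[OF A(2)]) (use A c in \<open>auto intro!: sum.cong\<close>)
qed

lemma transversal_rep: "transversal (rep ` blk ` \<Omega>)"
  unfolding transversal_def bij_betw_def inj_on_def by (auto simp: rep image_image)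

lemma transversal_image:
  assumes "compat f" "transversal A"
  shows "transversal (f ` A)"
proof -
  have A: "A \<subseteq> \<Omega>" "inj_on blk A" "blk ` A = blk ` \<Omega>"
    using assms by (auto simp: transversal_def bij_betw_def)
  have p: "bact f permutes blk ` \<Omega>" using bact_permutes assms by blast
  have "blk ` f ` A = bact f ` blk ` A"
    unfolding image_image using A bact_blk[OF assms(1)] by (intro image_cong) auto
  then have im: "blk ` f ` A = blk ` \<Omega>"
    using A permutes_image[OF p] by simp
  have "inj_on blk (f ` A)"
  proof (rule inj_onI)
    fix u v assume uv: "u \<in> f ` A" "v \<in> f ` A" "blk u = blk v"
    then obtain s t where st: "s \<in> A" "t \<in> A" "u = f s" "v = f t" by blast
    then have "bact f (blk s) = bact f (blk t)" using uv A(1) bact_blk[OF assms(1)] by (metis subsetD)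
    then have "blk s = blk t" using permutes_inj[OF p] by (simp add: inj_eq)
    then show "u = v" using st A by (auto dest: inj_onD)
  qed
  then show ?thesis
    using A compatD(1)[OF assms(1)] im by (auto simp: transversal_def bij_betw_def)
qed

text \<open>Sum for \<open>g\<close> over a transversal and for \<open>f\<close> over its image
  under \<open>g\<close>: the labels of \<open>g s\<close> cancel term by term.\<close>

lemma twist_comp:
  assumes "compat f" "compat g"
  shows "[twist (f \<circ> g) = twist f + twist g] (mod int d)"
proof -
  define A where "A = rep ` blk ` \<Omega>"
  have A: "transversal A" using transversal_rep by (simp add: A_def)
  then have sub: "A \<subseteq> \<Omega>" by (simp add: transversal_def)
  have inj: "inj_on g A" using sub assms(2) inj_on_subset by (auto simp: compat_def)
  have "twist f = (\<Sum>s\<in>A. (lab (f (g s)) - lab (g s)) mod int d)"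
    using twist_transversal[OF assms(1) transversal_image[OF assms(2) A]] inj
    by (simp add: sum.reindex)
  moreover have "twist g = (\<Sum>s\<in>A. (lab (g s) - lab s) mod int d)"
    using twist_transversal[OF assms(2) A] .
  ultimately have e: "twist f + twist g =
      (\<Sum>s\<in>A. (lab (f (g s)) - lab (g s)) mod int d + (lab (g s) - lab s) mod int d)"
    by (simp add: sum.distrib)
  have "twist (f \<circ> g) = (\<Sum>s\<in>A. (lab (f (g s)) - lab s) mod int d)"
    using twist_transversal[OF compat_comp[OF assms] A] by simp
  also have "[\<dots> = twist f + twist g] (mod int d)"
    unfolding e
  proof (rule cong_sum)
    fix s
    show "[(lab (f (g s)) - lab s) mod int d =
      (lab (f (g s)) - lab (g s)) mod int d + (lab (g s) - lab s) mod int d] (mod int d)"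
      unfolding cong_def mod_add_eq by simp
  qed
  finally show ?thesis .
qed

text \<open>A permutation of the chosen facelets leaves the sum of their labels unchanged, whatever
  the labels are. So a vanishing twist can be seen on any convenient transversal, not only on the
  one by which orientations are defined.\<close>

lemma twist_invariant_transversal:
  assumes "compat f" "transversal A" "f ` A \<subseteq> A"
  shows "[twist f = 0] (mod int d)"
proof -
  have sub: "A \<subseteq> \<Omega>" using assms by (simp add: transversal_def)
  have inj: "inj_on f A" using sub assms(1) inj_on_subset by (auto simp: compat_def)
  have "f ` A = A" using endo_inj_surj[OF finite_subset[OF sub finite_Omega] assms(3) inj] .
  then have "(\<Sum>s\<in>A. lab (f s)) = (\<Sum>s\<in>A. lab s)"
    using sum.reindex[OF inj, of lab] by (simp add: comp_def)
  then have "(\<Sum>s\<in>A. lab (f s) - lab s) = 0" by (simp add: sum_subtractf)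
  moreover have "[twist f = (\<Sum>s\<in>A. lab (f s) - lab s)] (mod int d)"
    unfolding twist_transversal[OF assms(1,2)] by (rule cong_sum) (simp add: cong_def)
  ultimately show ?thesis by simp
qed

text \<open>Following all powers of \<pi> fixes the orientations along with the cycle of cubies: the
  three cubies return untwisted after three steps. Points outside \<Omega> are fixed too, so this
  describes an arrangement of the whole cube.\<close>

definition cyc3 :: "'a \<Rightarrow> 'a \<Rightarrow> 'a \<Rightarrow> ('a \<Rightarrow> 'a) \<Rightarrow> bool" where
  "cyc3 a b c k \<longleftrightarrow>
     (\<forall>j. k ((\<pi> ^^ j) a) = (\<pi> ^^ j) b) \<and> (\<forall>j. k ((\<pi> ^^ j) b) = (\<pi> ^^ j) c) \<and>
     (\<forall>j. k ((\<pi> ^^ j) c) = (\<pi> ^^ j) a) \<and>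
     (\<forall>s. s \<notin> \<Omega> \<or> blk s \<notin> {blk a, blk b, blk c} \<longrightarrow> k s = s)"

definition triple :: "'a \<Rightarrow> 'a \<Rightarrow> 'a \<Rightarrow> bool" where
  "triple a b c \<longleftrightarrow> a \<in> T \<and> b \<in> T \<and> c \<in> T \<and> blk a \<noteq> blk b \<and> blk a \<noteq> blk c \<and> blk b \<noteq> blk c"

lemma cyc3D:
  assumes "cyc3 a b c k"
  shows "k ((\<pi> ^^ j) a) = (\<pi> ^^ j) b" "k ((\<pi> ^^ j) b) = (\<pi> ^^ j) c" "k ((\<pi> ^^ j) c) = (\<pi> ^^ j) a"
    "k a = b" "k b = c" "k c = a"
    "s \<notin> \<Omega> \<or> blk s \<notin> {blk a, blk b, blk c} \<Longrightarrow> k s = s"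
  using assms spec[of "\<lambda>j. k ((\<pi> ^^ j) a) = (\<pi> ^^ j) b" 0]
    spec[of "\<lambda>j. k ((\<pi> ^^ j) b) = (\<pi> ^^ j) c" 0] spec[of "\<lambda>j. k ((\<pi> ^^ j) c) = (\<pi> ^^ j) a" 0]
  by (auto simp: cyc3_def)

lemma tripleD: "triple a b c \<Longrightarrow> a \<in> \<Omega> \<and> b \<in> \<Omega> \<and> c \<in> \<Omega>"
  using T_subset by (auto simp: triple_def)

lemma cyc3_cases:
  assumes "triple a b c"
  obtains j where "s = (\<pi> ^^ j) a" | j where "s = (\<pi> ^^ j) b" | j where "s = (\<pi> ^^ j) c"
  | "s \<notin> \<Omega> \<or> blk s \<notin> {blk a, blk b, blk c}"
  using tripleD[OF assms] by (metis blk_eqE insertE singletonD)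

lemma cyc3_cube:
  assumes "triple a b c" "cyc3 a b c k"
  shows "k (k (k s)) = s"
  by (cases s rule: cyc3_cases[OF assms(1)]) (simp_all add: cyc3D[OF assms(2)])

lemma cyc3_rotate: "cyc3 a b c k \<Longrightarrow> cyc3 b c a k"
  by (auto simp: cyc3_def)

lemma cyc3_square: "cyc3 a b c k \<Longrightarrow> cyc3 a c b (k \<circ> k)"
  by (auto simp: cyc3_def)

lemma cyc3_shift:
  assumes "triple a b c" "cyc3 a b c k"
  shows "cyc3 ((\<pi> ^^ i) a) ((\<pi> ^^ i) b) ((\<pi> ^^ i) c) k"
  using assms(2) tripleD[OF assms(1)] unfolding cyc3_def
  by (simp add: funpow_add[THEN fun_cong, unfolded comp_def, symmetric])

text \<open>By \<open>T_homogeneous\<close>, whether j steps from a facelet of T lead back into T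
  depends on j alone. This is why a cycle that starts from three facelets of T preserves T.\<close>

lemma compat_cyc3:
  assumes "triple a b c" "cyc3 a b c k"
  shows "compat k"
proof -
  note abc = tripleD[OF assms(1)]
  have cl: "k s \<in> \<Omega>" if "s \<in> \<Omega>" for s
    using that assms(2) abc
    by (cases s rule: cyc3_cases[OF assms(1)]) (auto simp: cyc3D pi_pow_closed)
  have T: "k s \<in> T" if s: "s \<in> T" for s
    using assms(1)
    by (cases s rule: cyc3_cases[OF assms(1)])
      (use s assms in \<open>auto simp: triple_def cyc3D intro: T_homogeneous\<close>)
  have cm: "k (\<pi> s) = \<pi> (k s)" if s: "s \<in> \<Omega>" for s
  proof (cases s rule: cyc3_cases[OF assms(1)])
    case 4
    then have "k s = s" "k (\<pi> s) = \<pi> s"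
      using s blk_pi_pow[OF s, of 1] cyc3D(7)[OF assms(2)] by auto
    then show ?thesis by simp
  qed (use cyc3D(1-3)[OF assms(2), of "Suc j" for j] cyc3D(1-3)[OF assms(2)] in simp_all)
  have "inj k" using cyc3_cube[OF assms] by (metis injI)
  then show ?thesis using cl T cm by (auto simp: compat_def inj_on_def)
qed

text \<open>Since the third power is the identity, \<open>k\<close> is the square of
  \<open>k \<circ> k\<close>, and squares are even.\<close>

lemma osign_cyc3:
  assumes "triple a b c" "cyc3 a b c k"
  shows "osign k = 1"
proof -
  have k: "compat k" using compat_cyc3 assms by blast
  then have kk: "compat (k \<circ> k)" using compat_comp by blast
  have "k = (k \<circ> k) \<circ> (k \<circ> k)" using cyc3_cube[OF assms] by (simp add: fun_eq_iff)
  then show ?thesis using osign_comp[OF kk kk] osign_square by metis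
qed

text \<open>A transversal that passes through a, b and c themselves is permuted by
  \<open>k\<close>.\<close>

lemma twist_cyc3:
  assumes "triple a b c" "cyc3 a b c k"
  shows "[twist k = 0] (mod int d)"
proof -
  note abc = tripleD[OF assms(1)]
  define B where "B = rep ` (blk ` \<Omega> - {blk a, blk b, blk c}) \<union> {a, b, c}"
  have B: "B \<subseteq> \<Omega>" using abc rep by (auto simp: B_def)
  have im: "blk ` B = blk ` \<Omega>"
    using abc rep unfolding B_def by (force simp: image_Un image_image)
  have "inj_on blk B"
    using assms(1) rep unfolding B_def inj_on_def triple_def by (auto; metis)
  then have "transversal B" using B im by (simp add: transversal_def bij_betw_def)
  moreover have "k ` B \<subseteq> B"
  proof
    fix u assume "u \<in> k ` B"
    then obtain s where s: "s \<in> B" "u = k s" by blast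
    show "u \<in> B"
    proof (cases "s \<in> {a, b, c}")
      case True
      then show ?thesis using s cyc3D(4-6)[OF assms(2)] by (auto simp: B_def)
    next
      case False
      then have "blk s \<notin> {blk a, blk b, blk c}" using s rep by (auto simp: B_def)
      then show ?thesis using s cyc3D(7)[OF assms(2), of s] by simp
    qed
  qed
  ultimately show ?thesis using twist_invariant_transversal compat_cyc3 assms by blast
qed

text \<open>The inverse is passed as an explicit map, so that \<open>f \<circ> f\<close> can serve
  when \<open>f\<close> is itself a three-cycle.\<close>

lemma cyc3_conj:
  assumes "triple a b c" "cyc3 a b c k"
    and "compat f" "\<And>s. f (f' s) = s" "\<And>s. f' (f s) = s"
  shows "cyc3 (f a) (f b) (f c) (f \<circ> k \<circ> f')"
proof -
  note abc = tripleD[OF assms(1)]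
  have *: "f' ((\<pi> ^^ j) (f x)) = (\<pi> ^^ j) x" if "x \<in> \<Omega>" for x j
    using compatD(3)[OF assms(3) that] assms(5) by metis
  have "k (f' s) = f' s" if s: "s \<notin> \<Omega> \<or> blk s \<notin> {blk (f a), blk (f b), blk (f c)}" for s
  proof (cases "f' s" rule: cyc3_cases[OF assms(1)])
    case 4
    then show ?thesis using cyc3D(7)[OF assms(2)] by blast
  qed (use s abc compatD[OF assms(3)] assms(4) in \<open>metis blk_pi_pow insertCI pi_pow_closed\<close>)+
  then show ?thesis
    using assms(4) * abc cyc3D[OF assms(2)] compatD(3)[OF assms(3)] by (simp add: cyc3_def)
qed

lemma fixed_outside:
  assumes "compat h" "x \<in> \<Omega>" "h x = x" "y \<in> \<Omega>" "blk y = blk x"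
  shows "h y = y"
  using assms by (metis blk_eqE compatD(3))

text \<open>By \<open>only\<close>, the supports of \<open>A\<close> and \<open>C\<close> meet in the single cubie of \<open>U t\<close>.\<close>

lemma commutator_cyc3:
  assumes bij: "bij A" "bij S" "bij U" and comp: "compat A" "compat S" "compat U"
    and t: "t \<in> \<Omega>" "blk (S t) \<noteq> blk t" "blk (A (U t)) \<noteq> blk (U t)"
    and only: "\<And>u. S u \<noteq> u \<Longrightarrow> A (U u) \<noteq> U u \<Longrightarrow> u \<in> \<Omega> \<and> blk u = blk t"
  defines "C \<equiv> U \<circ> S \<circ> inv U"
  shows "cyc3 (U t) (A (U t)) (U (S t)) (A \<circ> C \<circ> inv A \<circ> inv C)"
proof -
  define k where "k = A \<circ> C \<circ> inv A \<circ> inv C"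
  have i: "A (inv A s) = s" "inv A (A s) = s" "S (inv S s) = s" "inv S (S s) = s"
    "U (inv U s) = s" "inv U (U s) = s" for s
    using bij by (simp_all add: bij_is_surj surj_f_inv_f bij_is_inj)
  have invC: "inv C = U \<circ> inv S \<circ> inv U"
    unfolding C_def by (rule inv_unique_comp) (simp_all add: fun_eq_iff i)
  have k: "k s = A (U (S (inv U (inv A (U (inv S (inv U s)))))))" for s
    unfolding k_def invC by (simp add: C_def)
  \<comment> \<open>The common cubie, seen before \<open>U\<close>. Since \<open>C\<close> moves
    \<open>U u\<close> exactly when \<open>S\<close> moves \<open>u\<close>, the supports are
    compared at points \<open>u\<close>.\<close>
  define B where "B = {v \<in> \<Omega>. blk v = blk t}"
  have Ut: "U t \<in> \<Omega>" "S t \<in> \<Omega>" using compatD(1) comp t(1) by blast+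
  have SB: "S v \<notin> B" if "v \<in> B" for v
    using that t compat_blk_eq[OF comp(2), of v t] by (auto simp: B_def)
  have AB: "A (U v) \<noteq> U w" if "v \<in> B" "w \<in> B" for v w
  proof
    assume e: "A (U v) = U w"
    have vw: "v \<in> \<Omega>" "blk v = blk t" "w \<in> \<Omega>" "blk w = blk t"
      using that by (simp_all add: B_def)
    have "blk (U w) = blk (U t)" by (rule compat_blk_eq[OF comp(3) vw(3) t(1) vw(4)])
    moreover have "blk (U v) = blk (U t)" by (rule compat_blk_eq[OF comp(3) vw(1) t(1) vw(2)])
    then have "blk (A (U v)) = blk (A (U t))"
      by (rule compat_blk_eq[OF comp(1) compatD(1)[OF comp(3) vw(1)] Ut(1)])
    ultimately show False using t(3) e by simp
  qed
  \<comment> \<open>Each of the four facts below follows from \<open>only\<close>: a point that has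
    left the common cubie under one of \<open>A\<close>, \<open>C\<close> or their inverses is fixed
    by the other map, because the supports meet nowhere else.\<close>
  have fix1: "A (U (S v)) = U (S v)" if v: "v \<in> B" for v
  proof (rule ccontr)
    assume "\<not> ?thesis"
    moreover have "S (S v) \<noteq> S v" using SB[OF v] v i by metis
    ultimately show False using only[of "S v"] SB[OF v] by (simp add: B_def)
  qed
  have fix2: "S (inv U (A (U v))) = inv U (A (U v))" if v: "v \<in> B" for v
  proof (rule ccontr)
    assume "\<not> ?thesis"
    moreover have "A (U (inv U (A (U v)))) \<noteq> U (inv U (A (U v)))" using AB[OF v v] i by metis
    ultimately have "inv U (A (U v)) \<in> B" using only by (simp add: B_def)
    then show False using AB[OF v] i by metis
  qed
  have fix3: "A (U (inv S v)) = U (inv S v)" if v: "v \<in> B" for v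
  proof (rule ccontr)
    assume "\<not> ?thesis"
    moreover have "S (inv S v) \<noteq> inv S v" using SB[of v] v i by metis
    ultimately have "inv S v \<in> B" using only by (simp add: B_def)
    then show False using SB v i by metis
  qed
  have fix4: "S (inv U (inv A (U v))) = inv U (inv A (U v))" if v: "v \<in> B" for v
  proof (rule ccontr)
    assume "\<not> ?thesis"
    moreover have "A (U (inv U (inv A (U v)))) \<noteq> U (inv U (inv A (U v)))" using AB[OF v v] i by metis
    ultimately have "inv U (inv A (U v)) \<in> B" using only by (simp add: B_def)
    then show False using AB[OF _ v] i by metis
  qed
  \<comment> \<open>Reading the commutator from the right: \<open>inv C\<close> moves
    \<open>U v\<close> out of the support of \<open>A\<close>, so \<open>C\<close> brings it back
    and \<open>A\<close> acts last. The other two values are found in the same way.\<close>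
  have k1: "k (U v) = A (U v)" if v: "v \<in> B" for v
    unfolding k using fix3[OF v] i by metis
  have k2: "k (A (U v)) = U (S v)" if v: "v \<in> B" for v
    unfolding k using fix2[OF v] fix1[OF v] i by metis
  have k3: "k (U (S v)) = U v" if v: "v \<in> B" for v
    unfolding k using fix4[OF v] i by metis
  have k4: "k s = s" if s: "s \<notin> \<Omega> \<or> blk s \<notin> {blk (U t), blk (A (U t)), blk (U (S t))}" for s
  proof -
    have n: "s \<noteq> U v" "s \<noteq> A (U v)" "s \<noteq> U (S v)" if v: "v \<in> B" for v
    proof -
      have v': "v \<in> \<Omega>" "blk v = blk t" using v by (simp_all add: B_def)
      have b: "blk (U v) = blk (U t)" "blk (S v) = blk (S t)"
        by (rule compat_blk_eq[OF comp(3) v'(1) t(1) v'(2)] compat_blk_eq[OF comp(2) v'(1) t(1) v'(2)])+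
      have O: "U v \<in> \<Omega>" "S v \<in> \<Omega>" "A (U v) \<in> \<Omega>" "U (S v) \<in> \<Omega>"
        using v'(1) compatD(1) comp by blast+
      have "blk (A (U v)) = blk (A (U t))" "blk (U (S v)) = blk (U (S t))"
        using compat_blk_eq[OF comp(1) O(1) Ut(1) b(1)] compat_blk_eq[OF comp(3) O(2) Ut(2) b(2)] .
      then show "s \<noteq> U v" "s \<noteq> A (U v)" "s \<noteq> U (S v)" using s b O by auto
    qed
    \<comment> \<open>\<open>U u\<close> is where \<open>inv C\<close> sends \<open>s\<close>.
      Either \<open>C\<close> fixes \<open>s\<close>, and then it also fixes the point to which
      \<open>inv A\<close> sends \<open>s\<close>; or \<open>A\<close> fixes both \<open>s\<close>
      and \<open>U u\<close>. In both cases everything cancels.\<close>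
    define u where "u = inv S (inv U s)"
    have Su: "U (S u) = s" by (simp add: u_def i)
    show ?thesis
    proof (cases "S u = u")
      case True
      then have Uu: "U u = s" using Su by simp
      define w where "w = inv U (inv A s)"
      have w: "A (U w) = s" by (simp add: w_def i)
      have "S w = w"
      proof (rule ccontr)
        assume Sw: "S w \<noteq> w"
        then have "A (U w) = U w" using only[of w] n(2)[of w] w by (auto simp: B_def)
        then have "U w = U u" using w Uu by simp
        then have "w = u" using i by metis
        then show False using Sw True by simp
      qed
      then show ?thesis unfolding k using w_def w Uu True i u_def by metis
    next
      case Su': False
      then have A1: "A (U u) = U u" using only[of u] n(3)[of u] Su by (auto simp: B_def)
      have "S (S u) \<noteq> S u" using Su' i by metis
      then have "A (U (S u)) = U (S u)" using only[of "S u"] n(1)[of "S u"] Su by (auto simp: B_def)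
      then show ?thesis unfolding k using A1 Su u_def i by metis
    qed
  qed
  have B: "(\<pi> ^^ j) t \<in> B" for j using t pi_pow_closed by (auto simp: B_def)
  have "k ((\<pi> ^^ j) (U t)) = (\<pi> ^^ j) (A (U t))" "k ((\<pi> ^^ j) (A (U t))) = (\<pi> ^^ j) (U (S t))"
    "k ((\<pi> ^^ j) (U (S t))) = (\<pi> ^^ j) (U t)" for j
    using k1[OF B, of j] k2[OF B, of j] k3[OF B, of j] compatD(3)[OF comp(1) Ut(1), of j]
      compatD(3)[OF comp(2) t(1), of j] compatD(3)[OF comp(3) t(1), of j]
      compatD(3)[OF comp(3) Ut(2), of j] by simp_all
  then show ?thesis using k4 unfolding cyc3_def k_def by blast
qed

section \<open>Signs of four-cycles of cubies\<close>

lemma osign_fixed: "(\<And>s. s \<in> \<Omega> \<Longrightarrow> f s = s) \<Longrightarrow> osign f = 1"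
proof -
  assume *: "\<And>s. s \<in> \<Omega> \<Longrightarrow> f s = s"
  then have "bact f = id" using rep by (auto simp: bact_def fun_eq_iff)
  then show ?thesis by (simp add: osign_def)
qed

lemma twist_fixed: "(\<And>s. s \<in> \<Omega> \<Longrightarrow> f s = s) \<Longrightarrow> twist f = 0"
  unfolding twist_def by (rule sum.neutral) (simp add: rep)

definition cycle4 :: "('a \<Rightarrow> 'a) \<Rightarrow> 'a \<Rightarrow> 'b list" where
  "cycle4 f s = map blk [s, f s, f (f s), f (f (f s))]"

text \<open>A four-cycle is a product of three transpositions. The cycle is one of blocks: the other
  facelets of the same four cubies are covered by \<open>other\<close> and are not counted
  again.\<close>

lemma osign_cycle4:
  assumes f: "compat f" and s: "s \<in> \<Omega>" "f (f (f (f s))) = s"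
    and dist: "distinct (cycle4 f s)"
    and other: "\<And>t. t \<in> \<Omega> \<Longrightarrow> f t \<noteq> t \<Longrightarrow> blk t \<in> set (cycle4 f s)"
  shows "osign f = - 1"
proof -
  define p where "p = blk s" define q where "q = blk (f s)"
  define u where "u = blk (f (f s))" define v where "v = blk (f (f (f s)))"
  have O: "f s \<in> \<Omega>" "f (f s) \<in> \<Omega>" "f (f (f s)) \<in> \<Omega>" using compatD(1)[OF f] s by auto
  have b: "bact f p = q" "bact f q = u" "bact f u = v" "bact f v = p"
    using bact_blk[OF f] s O by (simp_all add: p_def q_def u_def v_def)
  have d: "p \<noteq> q" "p \<noteq> u" "p \<noteq> v" "q \<noteq> u" "q \<noteq> v" "u \<noteq> v"
    using dist by (auto simp: cycle4_def p_def q_def u_def v_def)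
  have fx: "bact f x = x" if x: "x \<notin> {p, q, u, v}" for x
  proof (cases "x \<in> blk ` \<Omega>")
    case True
    then obtain t where t: "t \<in> \<Omega>" "x = blk t" by blast
    then have "f t = t" using other[of t] x by (auto simp: cycle4_def p_def q_def u_def v_def)
    then show ?thesis using bact_blk[OF f t(1)] t by simp
  qed (simp add: bact_def)
  have "bact f = transpose p q \<circ> transpose q u \<circ> transpose u v"
  proof
    fix x
    show "bact f x = (transpose p q \<circ> transpose q u \<circ> transpose u v) x"
    proof (cases "x \<in> {p, q, u, v}")
      case True
      then show ?thesis using b d by (auto simp: transpose_def)
    next
      case False
      then show ?thesis using fx[OF False] by (simp add: transpose_def)
    qed
  qed
  then show ?thesis
    using d by (simp add: osign_def sign_compose sign_swap_id permutation_swap_id permutation_compose)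
qed

text \<open>Six transpositions, hence even. This occurs for coupled edges in the upper layer and for
  centre corners in their own inner layer.\<close>

lemma osign_cycle4_cycle4:
  assumes f: "compat f" and s: "s \<in> \<Omega>" "f (f (f (f s))) = s" and t: "t \<in> \<Omega>" "f (f (f (f t))) = t"
    and dist: "distinct (cycle4 f s @ cycle4 f t)"
    and other: "\<And>w. w \<in> \<Omega> \<Longrightarrow> f w \<noteq> w \<Longrightarrow> blk w \<in> set (cycle4 f s @ cycle4 f t)"
  shows "osign f = 1"
proof -
  define p where "p = blk s" define q where "q = blk (f s)"
  define u where "u = blk (f (f s))" define v where "v = blk (f (f (f s)))"
  define p' where "p' = blk t" define q' where "q' = blk (f t)"
  define u' where "u' = blk (f (f t))" define v' where "v' = blk (f (f (f t)))"
  note defs = p_def q_def u_def v_def p'_def q'_def u'_def v'_def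
  have O: "f s \<in> \<Omega>" "f (f s) \<in> \<Omega>" "f (f (f s)) \<in> \<Omega>" "f t \<in> \<Omega>" "f (f t) \<in> \<Omega>" "f (f (f t)) \<in> \<Omega>"
    using compatD(1)[OF f] s t by auto
  have b: "bact f p = q" "bact f q = u" "bact f u = v" "bact f v = p"
     "bact f p' = q'" "bact f q' = u'" "bact f u' = v'" "bact f v' = p'"
    using bact_blk[OF f] s t O by (simp_all add: defs)
  have d: "distinct [p, q, u, v, p', q', u', v']"
    using dist by (simp add: cycle4_def defs)
  have ne: "p \<noteq> q" "p \<noteq> u" "p \<noteq> v" "p \<noteq> p'" "p \<noteq> q'"
    "p \<noteq> u'" "p \<noteq> v'" "q \<noteq> u" "q \<noteq> v" "q \<noteq> p'"
    "q \<noteq> q'" "q \<noteq> u'" "q \<noteq> v'" "u \<noteq> v" "u \<noteq> p'"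
    "u \<noteq> q'" "u \<noteq> u'" "u \<noteq> v'" "v \<noteq> p'" "v \<noteq> q'"
    "v \<noteq> u'" "v \<noteq> v'" "p' \<noteq> q'" "p' \<noteq> u'" "p' \<noteq> v'"
    "q' \<noteq> u'" "q' \<noteq> v'" "u' \<noteq> v'"
    using d by auto
  have fx: "bact f x = x" if x: "x \<notin> {p, q, u, v, p', q', u', v'}" for x
  proof (cases "x \<in> blk ` \<Omega>")
    case True
    then obtain w where w: "w \<in> \<Omega>" "x = blk w" by blast
    then have "f w = w" using other[of w] x by (auto simp: cycle4_def defs)
    then show ?thesis using bact_blk[OF f w(1)] w by simp
  qed (simp add: bact_def)
  have "bact f = transpose p q \<circ> transpose q u \<circ> transpose u v \<circ>
      transpose p' q' \<circ> transpose q' u' \<circ> transpose u' v'"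
  proof
    fix x
    show "bact f x = (transpose p q \<circ> transpose q u \<circ> transpose u v \<circ>
      transpose p' q' \<circ> transpose q' u' \<circ> transpose u' v') x"
    proof (cases "x \<in> {p, q, u, v, p', q', u', v'}")
      case True
      then show ?thesis
        by (elim insertE emptyE) (simp_all add: b transpose_def ne ne[THEN not_sym])
    next
      case False
      then show ?thesis using fx[OF False] by (simp add: transpose_def)
    qed
  qed
  then show ?thesis
    using d by (simp add: osign_def sign_compose sign_swap_id permutation_swap_id permutation_compose)
qed

text \<open>Orientations are indexed by the position at which a cubie arrives, twists by the facelet
  from which it starts. This is the change of index between them.\<close>

lemma sum_blk_transversal:
  assumes "compat g" "transversal A"
  shows "(\<Sum>p\<in>blk ` \<Omega>. F p) = (\<Sum>s\<in>A. F (blk (g s)))"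
proof -
  have blk: "inj_on blk (g ` A)" "blk ` g ` A = blk ` \<Omega>"
    using transversal_image[OF assms] by (simp_all add: transversal_def bij_betw_def)
  have g: "inj_on g A"
    using assms inj_on_subset unfolding compat_def transversal_def by blast
  show ?thesis
    unfolding blk(2)[symmetric] sum.reindex[OF blk(1)] sum.reindex[OF g] by simp
qed

end

text \<open>Inverses come for free, since the inverse of a three-cycle is its square. Five cubies
  are asked for because \<open>J_ab\<close> uses two auxiliary ones besides those of a, b and
  x.\<close>

locale cyc3_group = block_orbit +
  fixes H :: "('a \<Rightarrow> 'a) set" and a b :: 'a
  assumes id_H: "id \<in> H"
    and comp_H: "f \<in> H \<Longrightarrow> g \<in> H \<Longrightarrow> f \<circ> g \<in> H"
    and a_T: "a \<in> T" and b_T: "b \<in> T" and ab: "blk a \<noteq> blk b"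
    and base: "x \<in> T \<Longrightarrow> blk x \<noteq> blk a \<Longrightarrow> blk x \<noteq> blk b \<Longrightarrow> \<exists>k\<in>H. cyc3 a b x k"
    and five: "\<exists>xs. length xs = 5 \<and> set xs \<subseteq> T \<and> distinct (map blk xs)"
begin

definition J :: "'a \<Rightarrow> 'a \<Rightarrow> 'a \<Rightarrow> bool" where
  "J x y z \<longleftrightarrow> triple x y z \<and> (\<exists>k\<in>H. cyc3 x y z k)"

lemma J_rotate: "J x y z \<Longrightarrow> J y z x"
  unfolding J_def triple_def using cyc3_rotate by metis

lemma J_swap: "J x y z \<Longrightarrow> J x z y"
  unfolding J_def triple_def using cyc3_square comp_H by metis

lemma J_shift:
  assumes "J x y z" "(\<pi> ^^ i) x \<in> T"
  shows "J ((\<pi> ^^ i) x) ((\<pi> ^^ i) y) ((\<pi> ^^ i) z)"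
proof -
  obtain k where k: "triple x y z" "k \<in> H" "cyc3 x y z k" using assms by (auto simp: J_def)
  have "triple ((\<pi> ^^ i) x) ((\<pi> ^^ i) y) ((\<pi> ^^ i) z)"
    using k(1) tripleD[OF k(1)] T_homogeneous[OF _ _ assms(2)] by (simp add: triple_def)
  then show ?thesis using k cyc3_shift unfolding J_def by blast
qed

text \<open>The conjugator is a three-cycle in \<open>H\<close>, so its inverse
  \<open>f \<circ> f\<close> lies in \<open>H\<close> as well. Only its values are exported, and the
  lemmas below compute with these.\<close>

lemma J_conj:
  assumes "J x y z" "J u v w"
  shows "\<exists>f. f u = v \<and> f v = w \<and> f w = u \<and>
    (\<forall>s\<in>\<Omega>. blk s \<notin> {blk u, blk v, blk w} \<longrightarrow> f s = s) \<and> J (f x) (f y) (f z)"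
proof -
  obtain k f where k: "k \<in> H" "cyc3 x y z k" and f: "f \<in> H" "cyc3 u v w f"
    and t: "triple x y z" "triple u v w"
    using assms by (auto simp: J_def)
  have cf: "compat f" using compat_cyc3 t f by blast
  have "cyc3 (f x) (f y) (f z) (f \<circ> k \<circ> (f \<circ> f))"
    using cyc3_cube[OF t(2) f(2)] by (intro cyc3_conj[OF t(1) k(2) cf]) auto
  moreover have "triple (f x) (f y) (f z)"
  proof -
    have "inj (bact f)" using bact_permutes[OF cf] permutes_inj by blast
    then show ?thesis
      using t(1) tripleD[OF t(1)] compat_T[OF cf] bact_blk[OF cf]
      unfolding triple_def by (metis injD)
  qed
  ultimately have "J (f x) (f y) (f z)"
    using k f comp_H unfolding J_def by blast
  then show ?thesis using cyc3D(4-7)[OF f(2)] by blast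
qed

lemma fresh: "\<exists>y\<in>T. blk y \<notin> {p, q, r, s}"
proof (rule ccontr)
  assume *: "\<not> ?thesis"
  from five obtain xs where xs: "length xs = 5" "set xs \<subseteq> T" "distinct (map blk xs)"
    by (elim exE conjE)
  have "blk y \<in> {p, q, r, s}" if "y \<in> T" for y using * that by blast
  then have "set (map blk xs) \<subseteq> {p, q, r, s}" using xs(2) by auto
  then have "card (set (map blk xs)) \<le> card {p, q, r, s}" by (intro card_mono) auto
  also have "\<dots> \<le> 4" by (simp add: card_insert_if)
  finally show False using distinct_card[OF xs(3)] xs(1) by simp
qed

lemma J_base: "x \<in> T \<Longrightarrow> blk x \<noteq> blk a \<Longrightarrow> blk x \<noteq> blk b \<Longrightarrow> J a b x"
  using base a_T b_T ab unfolding J_def triple_def by metis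

definition outer :: "'a \<Rightarrow> bool" where
  "outer x \<longleftrightarrow> x \<in> T \<and> blk x \<noteq> blk a \<and> blk x \<noteq> blk b"

lemma outer_Omega: "outer x \<Longrightarrow> x \<in> \<Omega>"
  using T_subset by (auto simp: outer_def)

text \<open>Conjugating (a b x) by (a b y) sends a to b and b to y.\<close>

lemma J_b: assumes "outer x" "outer y" "blk x \<noteq> blk y" shows "J b y x"
proof -
  have "J a b x" "J a b y" using assms J_base by (auto simp: outer_def)
  then obtain f where f: "f a = b" "f b = y" "f y = a"
    "\<forall>s\<in>\<Omega>. blk s \<notin> {blk a, blk b, blk y} \<longrightarrow> f s = s" "J (f a) (f b) (f x)"
    using J_conj by blast
  then show ?thesis using assms f(4)[THEN bspec, OF outer_Omega[OF assms(1)]] by (simp add: outer_def)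
qed

text \<open>Conjugating (a b x) by (a y b) gives (y a x), which is a rotation of (a x y).\<close>

lemma J_a: assumes "outer x" "outer y" "blk x \<noteq> blk y" shows "J a x y"
proof -
  have "J a b x" "J a y b" using assms J_base J_swap by (auto simp: outer_def)
  then obtain f where f: "f a = y" "f y = b" "f b = a"
    "\<forall>s\<in>\<Omega>. blk s \<notin> {blk a, blk y, blk b} \<longrightarrow> f s = s" "J (f a) (f b) (f x)"
    using J_conj by blast
  then have "J y a x" using assms f(4)[THEN bspec, OF outer_Omega[OF assms(1)]] by (simp add: outer_def)
  then show ?thesis by (rule J_rotate)
qed

text \<open>Conjugating (b y z) by (b x a) puts x in the place of b.\<close>

lemma J_outer:
  assumes "outer x" "outer y" "outer z" "blk x \<noteq> blk y" "blk x \<noteq> blk z" "blk y \<noteq> blk z"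
  shows "J x y z"
proof -
  have "J b y z" using assms J_b by metis
  moreover have "J b x a" using assms J_base J_rotate by (metis outer_def)
  ultimately obtain f where f: "f b = x" "f x = a" "f a = b"
    "\<forall>s\<in>\<Omega>. blk s \<notin> {blk b, blk x, blk a} \<longrightarrow> f s = s" "J (f b) (f y) (f z)"
    using J_conj by blast
  then show ?thesis
    using assms f(4)[THEN bspec, OF outer_Omega[OF assms(2)]] f(4)[THEN bspec, OF outer_Omega[OF assms(3)]]
    by (simp add: outer_def)
qed

text \<open>The given cycles contain b in one orientation only. A shifted cycle through b contains
  b' instead, together with two auxiliary cubies y and w. Conjugating (a y x) by its rotation (y b'
  w) then puts b' in the place of y.\<close>

lemma J_ab:
  assumes "b' \<in> T" "blk b' = blk b" "outer x"
  shows "J a b' x"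
proof -
  obtain y where y: "y \<in> T" "blk y \<notin> {blk a, blk b, blk x}" using fresh[of "blk a" "blk b" "blk x" "blk x"] by auto
  obtain w where w: "w \<in> T" "blk w \<notin> {blk a, blk b, blk x, blk y}" using fresh by blast
  have o: "outer y" "outer w" using y w by (auto simp: outer_def)
  obtain j where j: "b' = (\<pi> ^^ j) b" using assms b_T T_subset by (metis blk_eqE subsetD)
  obtain j' where j': "\<And>s. s \<in> \<Omega> \<Longrightarrow> (\<pi> ^^ j') ((\<pi> ^^ j) s) = s"
    "\<And>s. s \<in> \<Omega> \<Longrightarrow> (\<pi> ^^ j) ((\<pi> ^^ j') s) = s" using pi_pow_inverse by metis
  \<comment> \<open>Going back j' steps leads from b' to b, and both lie in T; by homogeneity j'
    steps then keep all of T.\<close>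
  have "(\<pi> ^^ j') b' \<in> T" using j j'(1)[of b] b_T T_subset by auto
  then have cl: "(\<pi> ^^ j') s \<in> T" if "s \<in> T" for s
    using that T_homogeneous assms(1) by blast
  have "outer ((\<pi> ^^ j') w)" "outer ((\<pi> ^^ j') y)"
    using o cl outer_Omega by (auto simp: outer_def)
  then have "J b ((\<pi> ^^ j') w) ((\<pi> ^^ j') y)"
    using J_b[of "(\<pi> ^^ j') y" "(\<pi> ^^ j') w"] w o[THEN outer_Omega] by auto
  then have "J b' w y"
    using J_shift[of b "(\<pi> ^^ j') w" "(\<pi> ^^ j') y" j] assms(1) j j'(2) o outer_Omega by simp
  then have "J y b' w" by (intro J_rotate[of w y b'] J_rotate[of b' w y])
  moreover have "J a y x" using J_a o assms(3) y by auto
  ultimately obtain f where f: "f y = b'" "f b' = w" "f w = y"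
    "\<forall>s\<in>\<Omega>. blk s \<notin> {blk y, blk b', blk w} \<longrightarrow> f s = s" "J (f a) (f y) (f x)"
    using J_conj[of a y x y b' w] by blast
  moreover have "f a = a" using f(4)[THEN bspec, of a] T_Omega[OF a_T] y w ab assms(2) by auto
  moreover have "f x = x" using f(4)[THEN bspec, of x] outer_Omega[OF assms(3)] y w assms by (auto simp: outer_def)
  ultimately show ?thesis by simp
qed

lemma J_with_a:
  assumes "triple a y z"
  shows "J a y z"
proof (cases "blk y = blk b \<or> blk z = blk b")
  case True
  then show ?thesis
  proof
    assume "blk y = blk b"
    then show ?thesis using assms by (intro J_ab) (auto simp: triple_def outer_def)
  next
    assume "blk z = blk b"
    then show ?thesis using assms by (intro J_swap[OF J_ab]) (auto simp: triple_def outer_def)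
  qed
next
  case False
  then show ?thesis using assms by (intro J_a) (auto simp: triple_def outer_def)
qed

text \<open>Turning all three facelets back by the same number of steps makes the first one a
  itself, and the result is shifted forward again.\<close>

lemma J_with_block_a:
  assumes "triple x y z" "blk x = blk a"
  shows "J x y z"
proof -
  obtain j where j: "x = (\<pi> ^^ j) a" using assms a_T T_subset by (metis blk_eqE subsetD triple_def)
  obtain j' where j': "\<And>s. s \<in> \<Omega> \<Longrightarrow> (\<pi> ^^ j') ((\<pi> ^^ j) s) = s"
    "\<And>s. s \<in> \<Omega> \<Longrightarrow> (\<pi> ^^ j) ((\<pi> ^^ j') s) = s" using pi_pow_inverse by metis
  have "(\<pi> ^^ j') x \<in> T" using j j'(1)[of a] a_T T_subset by auto
  then have "(\<pi> ^^ j') s \<in> T" if "s \<in> T" for s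
    using that T_homogeneous assms(1) unfolding triple_def by blast
  then have "triple a ((\<pi> ^^ j') y) ((\<pi> ^^ j') z)"
    using assms a_T tripleD[OF assms(1)] by (simp add: triple_def)
  then have "J a ((\<pi> ^^ j') y) ((\<pi> ^^ j') z)" by (rule J_with_a)
  then show ?thesis
    using J_shift[of a "(\<pi> ^^ j') y" "(\<pi> ^^ j') z" j] assms(1) j j'(2) tripleD[OF assms(1)]
    by (simp add: triple_def)
qed

lemma J_with_block_b:
  assumes "triple x y z" "blk x = blk b" "blk y \<noteq> blk a" "blk z \<noteq> blk a"
  shows "J x y z"
proof -
  obtain j where j: "x = (\<pi> ^^ j) b" using assms b_T T_subset by (metis blk_eqE subsetD triple_def)
  obtain j' where j': "\<And>s. s \<in> \<Omega> \<Longrightarrow> (\<pi> ^^ j') ((\<pi> ^^ j) s) = s"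
    "\<And>s. s \<in> \<Omega> \<Longrightarrow> (\<pi> ^^ j) ((\<pi> ^^ j') s) = s" using pi_pow_inverse by metis
  have "(\<pi> ^^ j') x \<in> T" using j j'(1)[of b] b_T T_subset by auto
  then have "(\<pi> ^^ j') s \<in> T" if "s \<in> T" for s
    using that T_homogeneous assms(1) unfolding triple_def by blast
  moreover have "blk y \<noteq> blk b" "blk z \<noteq> blk b" using assms by (auto simp: triple_def)
  ultimately have "outer ((\<pi> ^^ j') y)" "outer ((\<pi> ^^ j') z)"
    using assms tripleD[OF assms(1)] by (simp_all add: triple_def outer_def)
  then have "J b ((\<pi> ^^ j') y) ((\<pi> ^^ j') z)"
    using assms(1)[unfolded triple_def] tripleD[OF assms(1)] J_b[of "(\<pi> ^^ j') z" "(\<pi> ^^ j') y"]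
    by fastforce
  then show ?thesis
    using J_shift[of b "(\<pi> ^^ j') y" "(\<pi> ^^ j') z" j] assms(1) j j'(2) tripleD[OF assms(1)]
    by (simp add: triple_def)
qed

text \<open>A rotation of the triple brings an entry from the cubie of a to the front, or else one
  from the cubie of b. A triple that avoids both is covered by \<open>J_outer\<close>.\<close>

lemma all_cyc3:
  assumes "triple x y z"
  shows "\<exists>k\<in>H. cyc3 x y z k"
proof -
  have t: "triple y z x" "triple z x y" using assms by (auto simp: triple_def)
  have "J x y z"
  proof (cases "blk a \<in> {blk x, blk y, blk z}")
    case True
    then show ?thesis
      using J_with_block_a[OF assms] J_rotate[OF J_with_block_a[OF t(2)]]
        J_rotate[OF J_rotate[OF J_with_block_a[OF t(1)]]]
      by auto
  next
    case a: False
    show ?thesis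
    proof (cases "blk b \<in> {blk x, blk y, blk z}")
      case True
      then show ?thesis
        using a J_with_block_b[OF assms] J_rotate[OF J_with_block_b[OF t(2)]]
          J_rotate[OF J_rotate[OF J_with_block_b[OF t(1)]]]
        by auto
    next
      case False
      then show ?thesis using a assms by (intro J_outer) (auto simp: triple_def outer_def)
    qed
  qed
  then show ?thesis by (simp add: J_def)
qed

text \<open>The measure of the induction below. It counts facelets, so that a cubie which is in
  place but twisted still counts as unsolved.\<close>

definition moved :: "('a \<Rightarrow> 'a) \<Rightarrow> 'a set" where
  "moved h = {s \<in> T. h s \<noteq> s}"

lemma finite_moved: "finite (moved h)"
  using finite_subset[OF T_subset finite_Omega] by (simp add: moved_def)

lemma moved_image:
  assumes "compat h" "x \<in> moved h"
  shows "h x \<in> moved h"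
  using assms compat_T compat_inj T_subset unfolding moved_def by blast

text \<open>A transposition of two cubies is odd, so an even permutation that moves a cubie to another
  place moves at least three cubies.\<close>

lemma third_moved:
  assumes h: "compat h" "osign h = 1" and x: "x \<in> moved h" "blk (h x) \<noteq> blk x"
  shows "\<exists>z. z \<in> moved h \<and> blk z \<noteq> blk x \<and> blk z \<noteq> blk (h x)"
proof (rule ccontr)
  assume "\<not> ?thesis"
  then have *: "blk z = blk x \<or> blk z = blk (h x)" if "z \<in> moved h" for z using that by blast
  have xT: "x \<in> T" "x \<in> \<Omega>" using x T_subset by (auto simp: moved_def)
  have hx: "h x \<in> T" "h x \<in> \<Omega>" using compat_T[OF h(1)] xT T_subset by auto
  have inj: "bact h p = bact h q \<Longrightarrow> p = q" for p q
    using bact_permutes[OF h(1)] permutes_inj by (metis injD)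
  have fixed: "bact h (blk s) = blk s" if s: "s \<in> \<Omega>" "blk s \<notin> {blk x, blk (h x)}" for s
  proof -
    obtain t where t: "t \<in> T" "blk t = blk s" using T_meets s by blast
    then have "h t = t" using *[of t] s by (auto simp: moved_def)
    then show ?thesis using bact_blk[OF h(1), of t] t T_subset by auto
  qed
  have bx: "bact h (blk x) = blk (h x)" using bact_blk h xT by blast
  have bb: "bact h (blk (h x)) = blk (h (h x))" using bact_blk h hx by blast
  have "blk (h (h x)) = blk x"
  proof (rule ccontr)
    assume n: "blk (h (h x)) \<noteq> blk x"
    have "blk (h (h x)) \<noteq> blk (h x)" using inj[of "blk x" "blk (h x)"] bx bb x(2) by metis
    then have "bact h (blk (h (h x))) = blk (h (h x))"
      using fixed n compatD(1)[OF h(1) hx(2)] by blast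
    then show False using inj bb \<open>blk (h (h x)) \<noteq> blk (h x)\<close> by metis
  qed
  then have "bact h = transpose (blk x) (blk (h x))"
    using bx bb fixed by (auto simp: fun_eq_iff transpose_def bact_def[of h])
  then have "osign h = -1" using x(2) by (simp add: osign_def sign_swap_id)
  then show False using h by simp
qed

text \<open>A single twisted cubie would carry the whole twist. As this vanishes, the label is
  unchanged and the cubie is not twisted after all.\<close>

lemma second_twisted:
  assumes h: "compat h" "[twist h = 0] (mod int d)" and st: "\<And>s. s \<in> \<Omega> \<Longrightarrow> blk (h s) = blk s"
    and x: "x \<in> moved h"
  shows "\<exists>z. z \<in> moved h \<and> blk z \<noteq> blk x"
proof (rule ccontr)
  assume "\<not> ?thesis"
  then have *: "blk z = blk x" if "z \<in> moved h" for z using that by blast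
  have xT: "x \<in> T" "x \<in> \<Omega>" "h x \<noteq> x" using x T_subset by (auto simp: moved_def)
  define A where "A = rep ` (blk ` \<Omega> - {blk x}) \<union> {x}"
  have tr: "transversal A"
    unfolding transversal_def bij_betw_def A_def inj_on_def
    using rep xT by (auto simp: image_Un image_image; force)
  have fx: "h s = s" if s: "s \<in> A - {x}" for s
  proof -
    have s': "s \<in> \<Omega>" "blk s \<noteq> blk x" using s rep by (auto simp: A_def)
    obtain t where t: "t \<in> T" "blk t = blk s" using T_meets s' by blast
    then have "h t = t" using *[of t] s' by (auto simp: moved_def)
    then show ?thesis using fixed_outside[OF h(1), of t s] t T_Omega s' by auto
  qed
  have fin: "finite A" using finite_Omega by (simp add: A_def)
  have "twist h = (lab (h x) - lab x) mod int d + (\<Sum>s\<in>A - {x}. (lab (h s) - lab s) mod int d)"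
    unfolding twist_transversal[OF h(1) tr]
    by (rule sum.remove) (use fin in \<open>auto simp: A_def\<close>)
  also have "\<dots> = (lab (h x) - lab x) mod int d" using fx by (simp add: sum.neutral)
  finally have "[lab (h x) - lab x = 0] (mod int d)" using h(2) by (simp add: cong_def)
  then have c: "[lab (h x) = lab x] (mod int d)" using cong_diff_iff_cong_0 by blast
  obtain j where j: "h x = (\<pi> ^^ j) x" using st[OF xT(2)] compatD(1)[OF h(1) xT(2)] xT by (metis blk_eqE)
  then have "h x = x" using pi_pow_eqI[OF xT(2)] c by simp
  then show False using xT by simp
qed

text \<open>Each step composes with a three-cycle, or with a product of two that twists two cubies in
  opposite directions, so as to solve one more facelet without disturbing those already solved.\<close>

lemma compat_in_group:
  assumes "compat h" "osign h = 1" "[twist h = 0] (mod int d)" "\<And>s. s \<notin> \<Omega> \<Longrightarrow> h s = s"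
  shows "h \<in> H"
  using assms
proof (induction "card (moved h)" arbitrary: h rule: less_induct)
  case less
  note h = less.prems
  \<comment> \<open>Composition with \<open>k\<close> solves \<open>x\<close> and spoils nothing, so
    the induction applies to \<open>k \<circ> h\<close>; then \<open>k'\<close> undoes
    \<open>k\<close> inside \<open>H\<close>.\<close>
  have step: "h \<in> H" if k: "k \<in> H" "k' \<in> H" "compat k" "osign k = 1" "[twist k = 0] (mod int d)"
    and out: "\<And>s. s \<notin> \<Omega> \<Longrightarrow> k s = s" and inv: "\<And>s. k' (k s) = s"
    and fixes_: "\<And>s. s \<in> T \<Longrightarrow> h s = s \<Longrightarrow> k s = s" and x: "x \<in> moved h" "k (h x) = x" for k k' x
  proof -
    have "k \<circ> h \<in> H"
    proof (rule less.hyps)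
      have "moved (k \<circ> h) \<subset> moved h"
        using fixes_ x by (auto simp: moved_def)
      then show "card (moved (k \<circ> h)) < card (moved h)"
        using finite_moved psubset_card_mono by blast
      show "compat (k \<circ> h)" using k h compat_comp by blast
      show "osign (k \<circ> h) = 1" using k h osign_comp by simp
      show "[twist (k \<circ> h) = 0] (mod int d)"
        using cong_trans[OF twist_comp[OF k(3) h(1)] cong_add[OF k(5) h(3)]] by simp
      show "(k \<circ> h) s = s" if "s \<notin> \<Omega>" for s using that out h(4) by simp
    qed
    then have "k' \<circ> (k \<circ> h) \<in> H" using k comp_H by blast
    moreover have "k' \<circ> (k \<circ> h) = h" using inv by (simp add: fun_eq_iff)
    ultimately show ?thesis by simp
  qed
  show ?case
  proof (cases "\<exists>x\<in>moved h. blk (h x) \<noteq> blk x")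
    case True
    then obtain x where x: "x \<in> moved h" "blk (h x) \<noteq> blk x" by blast
    obtain z where z: "z \<in> moved h" "blk z \<noteq> blk x" "blk z \<noteq> blk (h x)"
      using third_moved[OF h(1,2) x] by blast
    have mv: "h x \<in> moved h" using moved_image h x by blast
    \<comment> \<open>The cycle returns \<open>h x\<close> to \<open>x\<close> and touches only
      cubies that are unsolved already.\<close>
    have t: "triple (h x) x z" using x z mv by (auto simp: triple_def moved_def)
    then obtain k where k: "k \<in> H" "cyc3 (h x) x z k" using all_cyc3 by blast
    show ?thesis
    proof (rule step[of k "k \<circ> k" x])
      fix s assume s: "s \<in> T" "h s = s"
      have "blk s \<noteq> blk u" if "u \<in> moved h" for u
        using that s fixed_outside[OF h(1), of s u] T_Omega by (auto simp: moved_def)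
      then show "k s = s" using cyc3D(7)[OF k(2)] mv x z by blast
    next
      show "k s = s" if "s \<notin> \<Omega>" for s using that cyc3D(7)[OF k(2)] by blast
      show "(k \<circ> k) (k s) = s" for s using cyc3_cube[OF t k(2)] by simp
    qed (use k t x comp_H compat_cyc3 osign_cyc3 twist_cyc3 cyc3D(4) in blast)+
  next
    case False
    have st: "blk (h s) = blk s" if s: "s \<in> \<Omega>" for s
    proof -
      obtain u where u: "u \<in> T" "blk u = blk s" using T_meets s by blast
      then have "blk (h u) = blk u" using False by (cases "h u = u") (auto simp: moved_def)
      then show ?thesis using compat_blk_eq[OF h(1), of u s] u s T_subset by auto
    qed
    show ?thesis
    proof (cases "moved h = {}")
      case True
      have "h s = s" for s
      proof (cases "s \<in> \<Omega>")
        case s: True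
        then obtain u where u: "u \<in> T" "blk u = blk s" using T_meets by blast
        then show ?thesis using True s fixed_outside[OF h(1), of u s] T_Omega by (auto simp: moved_def)
      qed (use h in blast)
      then show ?thesis using id_H by (simp add: fun_eq_iff id_def[symmetric] ext[of h id])
    next
      case ne: False
      then obtain x where x: "x \<in> moved h" by blast
      obtain z where z: "z \<in> moved h" "blk z \<noteq> blk x"
        using second_twisted[OF h(1,3) st x] by blast
      have mv: "h x \<in> moved h" using moved_image h x by blast
      have xO: "x \<in> \<Omega>" "z \<in> \<Omega>" using x z T_subset by (auto simp: moved_def)
      obtain w where w: "w \<in> T" "blk w \<notin> {blk x, blk z}" using fresh[of "blk x" "blk z" "blk x" "blk x"] by auto
      have bx: "blk (h x) = blk x" using st xO by blast
      have t1: "triple (h x) z w" using x z w mv bx by (auto simp: triple_def moved_def)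
      have t2: "triple x w z" using x z w by (auto simp: triple_def moved_def)
      obtain k1 where k1: "k1 \<in> H" "cyc3 (h x) z w k1" using all_cyc3 t1 by blast
      obtain k2 where k2: "k2 \<in> H" "cyc3 x w z k2" using all_cyc3 t2 by blast
      \<comment> \<open>The squares run the cycles backwards: \<open>h x\<close> goes to w and then
        to x; w goes to z and back to w; z goes to \<open>h x\<close> and on to a rotated z. So w is
        only borrowed, and the twist removed from the cubie of x is passed to that of z.\<close>
      define k where "k = (k2 \<circ> k2) \<circ> (k1 \<circ> k1)"
      have t1': "triple (h x) w z" and t2': "triple x z w" using t1 t2 by (auto simp: triple_def)
      have q1: "k1 \<circ> k1 \<in> H" "cyc3 (h x) w z (k1 \<circ> k1)" using k1 cyc3_square comp_H by auto
      have q2: "k2 \<circ> k2 \<in> H" "cyc3 x z w (k2 \<circ> k2)" using k2 cyc3_square comp_H by auto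
      have c1: "compat (k1 \<circ> k1)" "osign (k1 \<circ> k1) = 1" "[twist (k1 \<circ> k1) = 0] (mod int d)"
        using q1 t1' compat_cyc3 osign_cyc3 twist_cyc3 by blast+
      have c2: "compat (k2 \<circ> k2)" "osign (k2 \<circ> k2) = 1" "[twist (k2 \<circ> k2) = 0] (mod int d)"
        using q2 t2' compat_cyc3 osign_cyc3 twist_cyc3 by blast+
      have kx: "k (h x) = x" using cyc3D(4-6)[OF k1(2)] cyc3D(4-6)[OF k2(2)] by (simp add: k_def)
      show ?thesis
      proof (rule step[of k "k1 \<circ> k2" x])
        show "k \<in> H" "k1 \<circ> k2 \<in> H" using k1 k2 comp_H by (auto simp: k_def)
        show "compat k" "osign k = 1" using c1 c2 compat_comp osign_comp by (auto simp: k_def)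
        show "[twist k = 0] (mod int d)"
          using cong_trans[OF twist_comp[OF c2(1) c1(1)] cong_add[OF c2(3) c1(3)]] by (simp add: k_def)
        show "k s = s" if "s \<notin> \<Omega>" for s
          using that cyc3D(7)[OF k1(2)] cyc3D(7)[OF k2(2)] by (simp add: k_def)
        show "(k1 \<circ> k2) (k s) = s" for s
          using cyc3_cube[OF t1 k1(2)] cyc3_cube[OF t2 k2(2)] by (simp add: k_def)
        show "x \<in> moved h" "k (h x) = x" using x kx by auto
      next
        fix s assume s: "s \<in> T" "h s = s"
        have ne: "blk s \<noteq> blk u" if "u \<in> moved h" for u
          using that s fixed_outside[OF h(1), of s u] T_Omega by (auto simp: moved_def)
        show "k s = s"
        proof (cases "blk s = blk w")
          case True
          then obtain j where j: "s = (\<pi> ^^ j) w"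
            using s w T_subset by (metis blk_eqE subsetD)
          then show ?thesis
            using cyc3D(1-3)[OF k1(2)] cyc3D(1-3)[OF k2(2)] compatD(3)[OF h(1) xO(1)] by (simp add: k_def)
        next
          case False
          then show ?thesis
            using ne[OF x] ne[OF z(1)] ne[OF mv] cyc3D(7)[OF k1(2)] cyc3D(7)[OF k2(2)]
            by (simp add: k_def)
        qed
      qed
    qed
  qed
qed

end

section \<open>Slices and the group of valid arrangements\<close>

definition rot :: "face \<Rightarrow> facelet \<Rightarrow> facelet" where
  "rot X s = (rot_cw (normal X) (fst s), rot_cw (normal X) (snd s))"

lemma facelet_exhaust:
  obtains x y z u v w where "s = ((x, y, z), (u, v, w) :: vec)"
  by (cases s rule: prod_cases4) (metis surj_pair)

lemma rot_cw_simps: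
  "rot_cw (normal Up) (x, y, z) = (- z, y, x)"
  "rot_cw (normal Down) (x, y, z) = (z, y, - x)"
  "rot_cw (normal Right) (x, y, z) = (x, z, - y)"
  "rot_cw (normal Left) (x, y, z) = (x, - z, y)"
  "rot_cw (normal Front) (x, y, z) = (y, - x, z)"
  "rot_cw (normal Back) (x, y, z) = (- y, x, z)"
  by (simp_all add: Let_def)

lemma rot_simps:
  "rot Up ((x, y, z), (u, v, w)) = ((- z, y, x), (- w, v, u))"
  "rot Down ((x, y, z), (u, v, w)) = ((z, y, - x), (w, v, - u))"
  "rot Right ((x, y, z), (u, v, w)) = ((x, z, - y), (u, w, - v))"
  "rot Left ((x, y, z), (u, v, w)) = ((x, - z, y), (u, - w, v))"
  "rot Front ((x, y, z), (u, v, w)) = ((y, - x, z), (v, - u, w))"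
  "rot Back ((x, y, z), (u, v, w)) = ((- y, x, z), (- v, u, w))"
  by (simp_all only: rot_def fst_conv snd_conv rot_cw_simps)

lemma rot_order: "rot X (rot X (rot X (rot X s))) = s"
  by (cases X; cases s rule: facelet_exhaust) (auto simp: rot_simps)

lemma rot_opposite: "rot (opposite X) s = rot X (rot X (rot X s))"
  by (cases X; cases s rule: facelet_exhaust) (auto simp: rot_simps)

lemma dot_rot: "dot (fst (rot X s)) (normal X) = dot (fst s) (normal X)"
  by (cases X; cases s rule: facelet_exhaust) (auto simp: rot_simps)

lemma dot_opposite: "dot p (normal (opposite X)) = - dot p (normal X)"
  by (cases X; cases p rule: prod_cases3) auto

lemma dot_rot_opposite: "dot (fst (rot (opposite X) s)) (normal X) = dot (fst s) (normal X)"
  by (cases X; cases s rule: facelet_exhaust) (auto simp: rot_simps)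

lemma normal_opposite: "opposite (opposite X) = X"
  by (cases X) auto

text \<open>The face to which the rotation about X carries Y, picked by its normal.\<close>

definition face_rot :: "face \<Rightarrow> face \<Rightarrow> face" where
  "face_rot X Y = (SOME Z. normal Z = rot_cw (normal X) (normal Y))"

lemma normal_face_rot: "normal (face_rot X Y) = rot_cw (normal X) (normal Y)"
proof -
  have "\<exists>Z. normal Z = rot_cw (normal X) (normal Y)"
    by (cases X; cases Y)
      (auto simp: Let_def intro: exI[of _ Up] exI[of _ Down] exI[of _ Left] exI[of _ Right]
        exI[of _ Front] exI[of _ Back])
  then show ?thesis unfolding face_rot_def by (rule someI_ex)
qed

text \<open>A proper rotation keeps clockwise turns clockwise, so conjugation changes the axis
  only.\<close>

lemma rot_conj: "rot X (rot Y s) = rot (face_rot X Y) (rot X s)"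
  unfolding rot_def[of "face_rot X Y"] normal_face_rot
  by (cases X; cases Y; cases s rule: facelet_exhaust) (auto simp: rot_simps Let_def)

lemma dot_face_rot: "dot (fst (rot X s)) (normal (face_rot X Y)) = dot (fst s) (normal Y)"
  unfolding normal_face_rot
  by (cases X; cases Y; cases s rule: facelet_exhaust) (auto simp: rot_simps Let_def)

text \<open>\<open>r\<close> is the coordinate of the outermost layers. For odd \<open>n\<close> all
  layers have even coordinates and the middle one is at 0.\<close>

locale odd_cube =
  fixes n :: nat and r :: int
  assumes n3: "n \<ge> 3" and odd_n: "odd n" and r_def: "r = int n - 1"
begin

lemma r2: "r \<ge> 2" and even_r: "even r"
  using n3 odd_n by (auto simp: r_def)

definition layer :: "int \<Rightarrow> bool" where
  "layer x \<longleftrightarrow> even x \<and> \<bar>x\<bar> \<le> r"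

lemma layer_simps [simp]: "layer (- x) \<longleftrightarrow> layer x" "layer 0" "layer r"
  using r2 even_r by (auto simp: layer_def)

lemma layer_coord: "layer x \<longleftrightarrow> (\<exists>k\<in>{1..n}. x = coord n k)"
proof
  assume x: "layer x"
  obtain x' where x': "x = 2 * x'" using x by (auto simp: layer_def elim: evenE)
  obtain r' where r': "r = 2 * r'" using even_r by (rule evenE)
  have n: "int n = 2 * r' + 1" using r' r_def by simp
  have "\<bar>x'\<bar> \<le> r'" using x[unfolded layer_def] x' r' by linarith
  then have "x = coord n (nat (x' + r' + 1))" "nat (x' + r' + 1) \<in> {1..n}"
    using x' n by (auto simp: coord_def)
  then show "\<exists>k\<in>{1..n}. x = coord n k" by blast
next
  assume "\<exists>k\<in>{1..n}. x = coord n k"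
  then show "layer x" using odd_n unfolding layer_def by (auto simp: coord_def r_def)
qed

lemma coord_reflect: "k \<le> n \<Longrightarrow> coord n (n + 1 - k) = - coord n k"
  by (auto simp: coord_def of_nat_diff)

lemma layer_neg_coord: "layer x \<Longrightarrow> \<exists>k\<in>{1..n}. - x = coord n k"
  using layer_coord[of "- x"] by simp

lemma facelets_iff:
  "((a, b, c), u) \<in> facelets n \<longleftrightarrow> layer a \<and> layer b \<and> layer c \<and>
     (u = (1, 0, 0) \<and> a = r \<or> u = (- 1, 0, 0) \<and> a = - r \<or> u = (0, 1, 0) \<and> b = r \<or>
      u = (0, - 1, 0) \<and> b = - r \<or> u = (0, 0, 1) \<and> c = r \<or> u = (0, 0, - 1) \<and> c = - r)"
  (is "?L \<longleftrightarrow> ?R")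
proof
  assume ?L
  then obtain X k l where *: "((a, b, c), u) = facelet_at n X k l" "k \<in> {1..n}" "l \<in> {1..n}"
    by (auto simp: facelets_def)
  then have "layer (coord n k)" "layer (coord n l)" by (auto simp: layer_coord)
  then show ?R using * by (cases X) (auto simp: facelet_at_def r_def[symmetric])
next
  assume R: ?R
  have mem: "facelet_at n X k l \<in> facelets n" if "k \<in> {1..n}" "l \<in> {1..n}" for X k l
    using that by (auto simp: facelets_def)
  obtain ka kb kc where p: "ka \<in> {1..n}" "kb \<in> {1..n}" "kc \<in> {1..n}"
    "a = coord n ka" "b = coord n kb" "c = coord n kc" using R layer_coord by metis
  obtain ma mb mc where m: "ma \<in> {1..n}" "mb \<in> {1..n}" "mc \<in> {1..n}"
    "- a = coord n ma" "- b = coord n mb" "- c = coord n mc" using R layer_neg_coord by metis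
  from R show ?L
  proof (elim conjE disjE)
    assume "u = (1, 0, 0)" "a = r"
    then have "((a, b, c), u) = facelet_at n Right mb mc"
      by (simp add: facelet_at_def m(4-6)[symmetric] r_def)
    then show ?thesis using mem m by auto
  next
    assume "u = (- 1, 0, 0)" "a = - r"
    then have "((a, b, c), u) = facelet_at n Left mb kc"
      by (simp add: facelet_at_def m(4-6)[symmetric] p(4-6)[symmetric] r_def)
    then show ?thesis using mem m p by auto
  next
    assume "u = (0, 1, 0)" "b = r"
    then have "((a, b, c), u) = facelet_at n Up kc ka"
      by (simp add: facelet_at_def p(4-6)[symmetric] r_def)
    then show ?thesis using mem p by auto
  next
    assume "u = (0, - 1, 0)" "b = - r"
    then have "((a, b, c), u) = facelet_at n Down mc ka"
      by (simp add: facelet_at_def m(4-6)[symmetric] p(4-6)[symmetric] r_def)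
    then show ?thesis using mem m p by auto
  next
    assume "u = (0, 0, 1)" "c = r"
    then have "((a, b, c), u) = facelet_at n Front mb ka"
      by (simp add: facelet_at_def m(4-6)[symmetric] p(4-6)[symmetric] r_def)
    then show ?thesis using mem m p by auto
  next
    assume "u = (0, 0, - 1)" "c = - r"
    then have "((a, b, c), u) = facelet_at n Back mb ma"
      by (simp add: facelet_at_def m(4-6)[symmetric] p(4-6)[symmetric] r_def)
    then show ?thesis using mem m p by auto
  qed
qed

lemma facelets_simps:
  "((a, b, c), (1, 0, 0)) \<in> facelets n \<longleftrightarrow> a = r \<and> layer b \<and> layer c"
  "((a, b, c), (- 1, 0, 0)) \<in> facelets n \<longleftrightarrow> a = - r \<and> layer b \<and> layer c"
  "((a, b, c), (0, 1, 0)) \<in> facelets n \<longleftrightarrow> b = r \<and> layer a \<and> layer c"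
  "((a, b, c), (0, - 1, 0)) \<in> facelets n \<longleftrightarrow> b = - r \<and> layer a \<and> layer c"
  "((a, b, c), (0, 0, 1)) \<in> facelets n \<longleftrightarrow> c = r \<and> layer a \<and> layer b"
  "((a, b, c), (0, 0, - 1)) \<in> facelets n \<longleftrightarrow> c = - r \<and> layer a \<and> layer b"
  by (auto simp: facelets_iff)

lemma facelets_cases:
  assumes "s \<in> facelets n"
  obtains b c where "s = ((r, b, c), (1, 0, 0))" "layer b" "layer c"
  | b c where "s = ((- r, b, c), (- 1, 0, 0))" "layer b" "layer c"
  | a c where "s = ((a, r, c), (0, 1, 0))" "layer a" "layer c"
  | a c where "s = ((a, - r, c), (0, - 1, 0))" "layer a" "layer c"
  | a b where "s = ((a, b, r), (0, 0, 1))" "layer a" "layer b"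
  | a b where "s = ((a, b, - r), (0, 0, - 1))" "layer a" "layer b"
  using assms by (cases s rule: prod_cases4) (auto simp: facelets_iff)

lemma finite_facelets: "finite (facelets n)"
proof -
  have "(UNIV :: face set) \<subseteq> {Up, Down, Front, Back, Right, Left}"
  proof
    fix x :: face
    show "x \<in> {Up, Down, Front, Back, Right, Left}" by (cases x) simp_all
  qed
  then have "finite (UNIV :: face set)" by (rule finite_subset) simp
  moreover have "facelets n = (\<lambda>(X, k, l). facelet_at n X k l) ` (UNIV \<times> {1..n} \<times> {1..n})"
    unfolding facelets_def by force
  ultimately show ?thesis by simp
qed

lemma rot_facelets:
  assumes "s \<in> facelets n"
  shows "rot X s \<in> facelets n"
  using assms by (rule facelets_cases) (cases X; simp add: rot_simps facelets_simps)+

lemma dot_layer: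
  assumes "s \<in> facelets n"
  shows "layer (dot (fst s) (normal X))"
  using assms by (rule facelets_cases) (cases X; simp)+

text \<open>Layers are named by their coordinate, which treats slices on both sides of the middle
  and the middle slice \<open>c = 0\<close> alike. A value \<open>c\<close> at which there is no
  layer gives the identity.\<close>

definition slice :: "face \<Rightarrow> int \<Rightarrow> facelet \<Rightarrow> facelet" where
  "slice X c s = (if s \<in> facelets n \<and> dot (fst s) (normal X) = c then rot X s else s)"

definition whole :: "face \<Rightarrow> facelet \<Rightarrow> facelet" where
  "whole X s = (if s \<in> facelets n then rot X s else s)"

lemma slice_order: "slice X c (slice X c (slice X c (slice X c s))) = s"
  by (auto simp: slice_def rot_facelets dot_rot rot_order)

lemma whole_order: "whole X (whole X (whole X (whole X s))) = s"
  by (auto simp: whole_def rot_facelets rot_order)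

lemma bijI4: "(\<And>s. f (f (f (f s))) = s) \<Longrightarrow> bij f"
  by (rule o_bij[of "f \<circ> f \<circ> f"]) (auto simp: fun_eq_iff)

lemma bij_slice: "bij (slice X c)" and bij_whole: "bij (whole X)"
  by (rule bijI4; simp add: slice_order whole_order)+

lemma move_slice: "move n X k = slice X (int n + 1 - 2 * int k)"
  by (simp add: fun_eq_iff move_def slice_def rot_def)

section \<open>The group generated by the moves\<close>

lemma valid_comp: "valid n f \<Longrightarrow> valid n g \<Longrightarrow> valid n (f \<circ> g)"
  by (induction rule: valid.induct) (auto simp: comp_assoc intro: valid.intros)

lemma valid_move: "1 \<le> k \<Longrightarrow> k \<le> n div 2 \<Longrightarrow> valid n (move n X k)"
  using valid.turn[OF valid.solved, of k n X] by simp

lemma valid_bij: "valid n g \<Longrightarrow> bij g"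
proof (induction rule: valid.induct)
  case solved
  show ?case by (rule bij_id)
next
  case (turn g k X)
  then show ?case unfolding move_slice by (intro bij_comp bij_slice)
qed

lemma inv4: "(\<And>s. f (f (f (f s))) = s) \<Longrightarrow> inv f = f \<circ> f \<circ> f"
  by (rule inv_unique_comp) (auto simp: fun_eq_iff)

text \<open>Only clockwise turns are moves; an anticlockwise turn is three clockwise ones.\<close>

lemma valid_inv: "valid n g \<Longrightarrow> valid n (inv g)"
proof (induction rule: valid.induct)
  case (turn g k X)
  have "inv (move n X k) = move n X k \<circ> move n X k \<circ> move n X k"
    by (rule inv4) (simp add: move_slice slice_order)
  moreover have "inv (move n X k \<circ> g) = inv g \<circ> inv (move n X k)"
    using turn valid_bij bij_slice by (intro o_inv_distrib) (auto simp: move_slice)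
  ultimately show ?case using turn valid_comp valid_move by metis
qed (metis inv_id valid.solved)

lemma valid_slice:
  assumes "c \<noteq> 0"
  shows "valid n (slice X c)"
proof -
  have pos: "valid n (slice X c)" if c: "c > 0" "layer c" for X c
  proof -
    obtain c' where c': "c = 2 * c'" using c by (auto simp: layer_def elim: evenE)
    obtain r' where r': "r = 2 * r'" using even_r by (rule evenE)
    have n: "int n = 2 * r' + 1" using r' r_def by simp
    have k: "1 \<le> r' + 1 - c'" "c' > 0" using c[unfolded layer_def] c' r' by linarith+
    \<comment> \<open>The number k = r' + 1 - c' of the slice is the solution of n + 1 - 2 * k =
      c.\<close>
    then have "slice X c = move n X (nat (r' + 1 - c'))"
      using c' n by (simp add: move_slice)
    moreover have "1 \<le> nat (r' + 1 - c')" "nat (r' + 1 - c') \<le> n div 2"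
      using k n by linarith+
    ultimately show ?thesis using valid_move by simp
  qed
  consider "c > 0" "layer c" | "c < 0" "layer c" | "\<not> layer c" using assms by linarith
  then show ?thesis
  proof cases
    case 2
    \<comment> \<open>Beyond the middle, a clockwise turn seen from X is three clockwise turns of a
      slice counted from the opposite face.\<close>
    let ?f = "slice (opposite X) (- c)"
    have "slice X c s = ?f (?f (?f s))" for s
      using rot_opposite[of "opposite X" s] dot_rot_opposite
      by (simp add: slice_def rot_facelets dot_opposite normal_opposite) blast
    then have "slice X c = ?f \<circ> ?f \<circ> ?f" by (simp add: fun_eq_iff)
    then show ?thesis using pos[of "- c" "opposite X"] 2 valid_comp by simp
  next
    case 3
    then have "slice X c = id" using dot_layer by (auto simp: fun_eq_iff slice_def)
    then show ?thesis using valid.solved by simp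
  qed (rule pos)
qed

section \<open>Maps that normalize the group of valid arrangements\<close>

definition normalizing :: "(facelet \<Rightarrow> facelet) \<Rightarrow> bool" where
  "normalizing h \<longleftrightarrow> bij h \<and> (\<forall>g. valid n g \<longrightarrow> valid n (h \<circ> g \<circ> inv h))"

lemma normalizing_valid: "valid n h \<Longrightarrow> normalizing h"
  unfolding normalizing_def using valid_bij valid_comp valid_inv by blast

lemma normalizing_comp:
  assumes "normalizing f" "normalizing g"
  shows "normalizing (f \<circ> g)"
proof -
  have b: "bij f" "bij g" using assms by (auto simp: normalizing_def)
  then have "inv (f \<circ> g) = inv g \<circ> inv f" by (rule o_inv_distrib)
  then have "(f \<circ> g) \<circ> h \<circ> inv (f \<circ> g) = f \<circ> (g \<circ> h \<circ> inv g) \<circ> inv f" for h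
    by (simp add: comp_assoc)
  then show ?thesis using assms b bij_comp by (auto simp: normalizing_def)
qed

text \<open>Turning the whole cube renames the faces and thus permutes the moves.\<close>

lemma normalizing_whole: "normalizing (whole X)"
  unfolding normalizing_def
proof (intro conjI allI impI)
  show "bij (whole X)" by (rule bij_whole)
  fix g assume "valid n g"
  then show "valid n (whole X \<circ> g \<circ> inv (whole X))"
  proof (induction rule: valid.induct)
    case solved
    have "whole X \<circ> id \<circ> inv (whole X) = id"
      using bij_whole[of X] by (simp add: fun_eq_iff bij_is_surj surj_f_inv_f)
    then show ?case by (metis valid.solved)
  next
    case (turn g k Y)
    have "whole X (move n Y k s) = move n (face_rot X Y) k (whole X s)" for s
      using rot_conj[of X Y s]
      by (simp add: move_slice slice_def whole_def rot_facelets dot_face_rot)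
    then have "whole X \<circ> (move n Y k \<circ> g) \<circ> inv (whole X) =
        move n (face_rot X Y) k \<circ> (whole X \<circ> g \<circ> inv (whole X))"
      by (simp add: fun_eq_iff)
    then show ?case using turn valid.turn by metis
  qed
qed

text \<open>The middle slice is the product of a rotation of the whole cube and the inverses of all
  other slices of its axis, so that it normalizes the group of valid arrangements although it is
  not valid itself.\<close>

lemma normalizing_slice: "normalizing (slice X c)"
proof (cases "c = 0")
  case True
  \<comment> \<open>\<open>P K\<close> turns the K outermost layers at both ends of the axis in the
    same sense. For K = 0 it is the identity, for 2 * K = r it turns everything but the middle
    slice.\<close>
  define P where "P K s = (if s \<in> facelets n \<and> \<bar>dot (fst s) (normal X)\<bar> > r - 2 * int K
    then rot X s else s)" for K s
  have "valid n (P K)" if "2 * int K \<le> r" for K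
    using that
  proof (induction K)
    case 0
    have "\<bar>dot (fst s) (normal X)\<bar> \<le> r" if "s \<in> facelets n" for s
      using dot_layer[OF that] by (simp add: layer_def)
    then have "P 0 = id" by (force simp: P_def fun_eq_iff)
    then show ?case by (metis valid.solved)
  next
    case (Suc K)
    let ?c = "r - 2 * int K"
    have "P (Suc K) s = slice X ?c (slice X (- ?c) (P K s))" for s
    proof (cases "s \<in> facelets n")
      case True
      have e: "even (dot (fst s) (normal X))" "even ?c"
        using dot_layer[OF True, of X] even_r by (auto simp: layer_def)
      \<comment> \<open>Layers are 2 apart, so beyond \<open>?c - 2\<close> means from layer
        \<open>?c\<close> outwards.\<close>
      then have "\<bar>dot (fst s) (normal X)\<bar> > ?c - 2 \<longleftrightarrow> \<bar>dot (fst s) (normal X)\<bar> \<ge> ?c"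
        by presburger
      then show ?thesis
        using True Suc.prems by (auto simp: P_def slice_def rot_facelets dot_rot)
    qed (simp add: P_def slice_def)
    then have "P (Suc K) = slice X ?c \<circ> (slice X (- ?c) \<circ> P K)" by (simp add: fun_eq_iff)
    moreover have "valid n (slice X ?c)" "valid n (slice X (- ?c))"
      using Suc.prems by (auto intro!: valid_slice)
    moreover have "valid n (P K)" using Suc by simp
    ultimately show ?case using valid_comp by metis
  qed
  then have v: "valid n (P (nat (r div 2)))" using r2 even_r by simp
  have "whole X s = slice X 0 (P (nat (r div 2)) s)" for s
    using r2 even_r by (auto simp: whole_def P_def slice_def dot_rot)
  then have "whole X = slice X 0 \<circ> P (nat (r div 2))" by (simp add: fun_eq_iff)
  moreover have "P (nat (r div 2)) \<circ> inv (P (nat (r div 2))) = id"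
    using valid_bij[OF v] bij_is_surj surj_iff by blast
  ultimately have "slice X 0 = whole X \<circ> inv (P (nat (r div 2)))"
    by (simp add: comp_assoc)
  then show ?thesis
    using True normalizing_comp[OF normalizing_whole normalizing_valid[OF valid_inv[OF v]]] by metis
qed (simp add: normalizing_valid valid_slice)

text \<open>Read as A (C A^-1 C^-1) or as (A C A^-1) C^-1, the commutator becomes valid through one
  valid factor; the other may contain middle slices.\<close>

lemma valid_commutator:
  assumes "normalizing A" "normalizing C" "valid n A \<or> valid n C"
  shows "valid n (A \<circ> C \<circ> inv A \<circ> inv C)"
  using assms(3)
proof
  assume A: "valid n A"
  then have "valid n (C \<circ> inv A \<circ> inv C)" using assms(2) valid_inv by (auto simp: normalizing_def)
  then show ?thesis using A valid_comp by (simp add: comp_assoc)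
next
  assume C: "valid n C"
  then have "valid n (A \<circ> C \<circ> inv A)" using assms(1) by (auto simp: normalizing_def)
  then show ?thesis using C valid_comp valid_inv by blast
qed

end

section \<open>Three-cycles from commutators\<close>

text \<open>Invariance is stated for rotations of all of space. Slices inherit it because, by
  \<open>fst_pi\<close>, the facelets of a cubie always lie in the same layer.\<close>

locale cube_orbit = odd_cube n r + block_orbit \<Omega> T \<pi> blk lab d
  for n r and \<Omega> T :: "facelet set" and \<pi> and blk :: "facelet \<Rightarrow> 'b" and lab d +
  assumes Omega_facelets: "\<Omega> \<subseteq> facelets n"
    and rot_Omega: "s \<in> \<Omega> \<Longrightarrow> rot X s \<in> \<Omega>"
    and rot_T: "s \<in> T \<Longrightarrow> rot X s \<in> T"
    and rot_pi: "s \<in> \<Omega> \<Longrightarrow> rot X (\<pi> s) = \<pi> (rot X s)"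
    and fst_pi: "s \<in> \<Omega> \<Longrightarrow> fst (\<pi> s) = fst s"
begin

lemma compat_slice: "compat (slice X c)"
  unfolding compat_def
proof (intro conjI ballI)
  show "slice X c ` \<Omega> \<subseteq> \<Omega>" using rot_Omega by (auto simp: slice_def)
  show "slice X c ` T \<subseteq> T" using rot_T by (auto simp: slice_def)
  show "inj_on (slice X c) \<Omega>" using bij_slice bij_is_inj inj_on_subset by blast
  show "slice X c (\<pi> s) = \<pi> (slice X c s)" if s: "s \<in> \<Omega>" for s
  proof -
    have "s \<in> facelets n" "\<pi> s \<in> facelets n" using s Omega_facelets pi_closed by blast+
    then show ?thesis using s by (simp add: slice_def fst_pi rot_pi)
  qed
qed

definition reach :: "facelet \<Rightarrow> facelet \<Rightarrow> facelet \<Rightarrow> bool" where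
  "reach a b x \<longleftrightarrow> triple a b x \<and> (\<exists>k. valid n k \<and> cyc3 a b x k)"

text \<open>Conjugation by the slice through x. For the middle slice the result is still valid,
  since all slices are normalizing.\<close>

lemma reach_rot:
  assumes "reach a b x" "dot (fst a) (normal X) \<noteq> dot (fst x) (normal X)"
    "dot (fst b) (normal X) \<noteq> dot (fst x) (normal X)"
  shows "reach a b (rot X x)"
proof -
  let ?h = "slice X (dot (fst x) (normal X))"
  obtain k where k: "triple a b x" "valid n k" "cyc3 a b x k" using assms by (auto simp: reach_def)
  have h: "?h a = a" "?h b = b" "?h x = rot X x"
    using assms tripleD[OF k(1)] Omega_facelets by (auto simp: slice_def)
  have "cyc3 (?h a) (?h b) (?h x) (?h \<circ> k \<circ> inv ?h)"
    using bij_slice[of X "dot (fst x) (normal X)"]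
    by (intro cyc3_conj[OF k(1,3) compat_slice])
      (simp_all add: bij_is_surj surj_f_inv_f bij_is_inj)
  moreover have "valid n (?h \<circ> k \<circ> inv ?h)"
    using normalizing_slice k(2) by (auto simp: normalizing_def)
  moreover have "triple (?h a) (?h b) (?h x)"
  proof -
    have "inj (bact ?h)" using bact_permutes[OF compat_slice] permutes_inj by blast
    then show ?thesis
      using k(1) tripleD[OF k(1)] compat_T[OF compat_slice] bact_blk[OF compat_slice]
      unfolding triple_def by (metis injD)
  qed
  ultimately show ?thesis using h unfolding reach_def by auto
qed

text \<open>By \<open>c\<close>, one of the factors \<open>A\<close> and
  \<open>U \<circ> S \<circ> inv U\<close> is valid. A middle slice occurs as \<open>S\<close> for
  centres with \<beta> = 0, and as \<open>A\<close> for single edges.\<close>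

lemma reach_commutator:
  fixes XA XU XS cA cU cS
  defines "A \<equiv> slice XA cA" and "U \<equiv> slice XU cU" and "S \<equiv> slice XS cS"
  assumes t: "t \<in> T" "blk (S t) \<noteq> blk t" "blk (A (U t)) \<noteq> blk (U t)" "blk (A (U t)) \<noteq> blk (U (S t))"
    and only: "\<And>u. u \<in> facelets n \<Longrightarrow> dot (fst u) (normal XS) = cS \<Longrightarrow>
      dot (fst (U u)) (normal XA) = cA \<Longrightarrow> u \<in> \<Omega> \<and> blk u = blk t"
    and c: "cA \<noteq> 0 \<or> cU \<noteq> 0 \<and> cS \<noteq> 0"
  shows "reach (U t) (A (U t)) (U (S t))"
proof -
  have bij: "bij A" "bij S" "bij U" by (simp_all add: A_def S_def U_def bij_slice)
  have cm: "compat A" "compat S" "compat U" by (simp_all add: A_def S_def U_def compat_slice)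
  have nz: "normalizing A" "normalizing S" "normalizing U"
    by (simp_all add: A_def S_def U_def normalizing_slice)
  have tO: "t \<in> \<Omega>" using t T_Omega by blast
  have "u \<in> \<Omega> \<and> blk u = blk t" if u: "S u \<noteq> u" "A (U u) \<noteq> U u" for u
  proof (rule only)
    show "u \<in> facelets n" "dot (fst u) (normal XS) = cS"
      using u(1) by (auto simp: S_def slice_def split: if_splits)
    show "dot (fst (U u)) (normal XA) = cA"
      using u(2) by (auto simp: A_def slice_def split: if_splits)
  qed
  then have cyc: "cyc3 (U t) (A (U t)) (U (S t))
      (A \<circ> (U \<circ> S \<circ> inv U) \<circ> inv A \<circ> inv (U \<circ> S \<circ> inv U))"
    by (rule commutator_cyc3[OF bij cm tO t(2,3)])
  have iU: "inv U = U \<circ> U \<circ> U" unfolding U_def by (rule inv4) (simp add: slice_order)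
  have "normalizing (U \<circ> S \<circ> inv U)"
    unfolding iU using nz normalizing_comp by metis
  moreover have "valid n A \<or> valid n (U \<circ> S \<circ> inv U)"
    using c valid_slice valid_comp valid_inv unfolding A_def U_def S_def by metis
  ultimately have v: "valid n (A \<circ> (U \<circ> S \<circ> inv U) \<circ> inv A \<circ> inv (U \<circ> S \<circ> inv U))"
    using nz(1) valid_commutator by blast
  have "blk (U t) \<noteq> blk (U (S t))"
    using t(2) bact_blk[OF cm(3)] permutes_inj[OF bact_permutes[OF cm(3)]] tO
      compatD(1)[OF cm(2) tO] by (metis injD)
  then have "triple (U t) (A (U t)) (U (S t))"
    using t cm compat_T unfolding triple_def by auto
  then show ?thesis using cyc v unfolding reach_def by blast
qed

lemma valid_if_reach:
  assumes "a \<in> T" "b \<in> T" "blk a \<noteq> blk b"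
    and "\<And>x. x \<in> T \<Longrightarrow> blk x \<noteq> blk a \<Longrightarrow> blk x \<noteq> blk b \<Longrightarrow> reach a b x"
    and "\<exists>xs. length xs = 5 \<and> set xs \<subseteq> T \<and> distinct (map blk xs)"
    and h: "compat h" "osign h = 1" "[twist h = 0] (mod int d)" "\<And>s. s \<notin> \<Omega> \<Longrightarrow> h s = s"
  shows "valid n h"
proof -
  interpret cyc3_group \<Omega> T \<pi> blk lab d "{g. valid n g}" a b
  proof unfold_locales
    show "id \<in> {g. valid n g}" by (simp add: valid.solved)
    show "f \<circ> g \<in> {g. valid n g}" if "f \<in> {g. valid n g}" "g \<in> {g. valid n g}" for f g
      using that valid_comp by simp
    show "\<exists>k\<in>{g. valid n g}. cyc3 a b x k" if "x \<in> T" "blk x \<noteq> blk a" "blk x \<noteq> blk b" for x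
      using assms(4)[OF that] by (auto simp: reach_def)
  qed (use assms in auto)
  show ?thesis using compat_in_group[OF h] by simp
qed

end

section \<open>The orbits of the cube\<close>

lemma funpow_invariant: "(\<And>s. s \<in> S \<Longrightarrow> f s \<in> S \<and> q (f s) = q s) \<Longrightarrow> s \<in> S \<Longrightarrow> (f ^^ j) s \<in> S \<and> q ((f ^^ j) s) = q s"
  by (induction j) auto

context odd_cube
begin

lemma r_simps [simp]: "r \<noteq> 0" "0 < r" "sgn r = 1" "\<bar>r\<bar> = r" "r \<noteq> - r" "- r \<noteq> r" "\<not> r < 0"
  using r2 by auto

section \<open>Centre orbits\<close>

text \<open>The images of \<open>((\<alpha>, r, \<beta>), (0, 1, 0))\<close> under the 24 rotations of the cube.\<close>

definition center_orbit :: "int \<Rightarrow> int \<Rightarrow> facelet set" where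
  "center_orbit \<alpha> \<beta> =
    {((r, - \<alpha>, \<beta>), (1, 0, 0)), ((r, \<beta>, \<alpha>), (1, 0, 0)), ((r, - \<beta>, - \<alpha>), (1, 0, 0)),
     ((r, \<alpha>, - \<beta>), (1, 0, 0)), ((- r, \<alpha>, \<beta>), (- 1, 0, 0)),
     ((- r, \<beta>, - \<alpha>), (- 1, 0, 0)), ((- r, - \<beta>, \<alpha>), (- 1, 0, 0)),
     ((- r, - \<alpha>, - \<beta>), (- 1, 0, 0)), ((\<alpha>, r, \<beta>), (0, 1, 0)),
     ((- \<beta>, r, \<alpha>), (0, 1, 0)), ((\<beta>, r, - \<alpha>), (0, 1, 0)),
     ((- \<alpha>, r, - \<beta>), (0, 1, 0)), ((\<alpha>, - r, - \<beta>), (0, - 1, 0)),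
     ((- \<alpha>, - r, \<beta>), (0, - 1, 0)), ((\<beta>, - r, \<alpha>), (0, - 1, 0)),
     ((- \<beta>, - r, - \<alpha>), (0, - 1, 0)), ((\<alpha>, - \<beta>, r), (0, 0, 1)),
     ((- \<beta>, - \<alpha>, r), (0, 0, 1)), ((\<beta>, \<alpha>, r), (0, 0, 1)), ((- \<alpha>, \<beta>, r), (0, 0, 1)),
     ((\<alpha>, \<beta>, - r), (0, 0, - 1)), ((\<beta>, - \<alpha>, - r), (0, 0, - 1)),
     ((- \<beta>, \<alpha>, - r), (0, 0, - 1)), ((- \<alpha>, - \<beta>, - r), (0, 0, - 1))}"

text \<open>Every centre facelet is a cubie of its own, so \<pi> is the identity, d is 1 and there
  is no twist.\<close>

lemma center_orbit_cube_orbit: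
  assumes "layer \<alpha>" "layer \<beta>"
  shows "cube_orbit n r (center_orbit \<alpha> \<beta>) (center_orbit \<alpha> \<beta>) id id (\<lambda>_. 0) 1"
proof unfold_locales
  show "finite (center_orbit \<alpha> \<beta>)" by (simp add: center_orbit_def)
  show "center_orbit \<alpha> \<beta> \<subseteq> facelets n"
    using assms by (simp add: center_orbit_def facelets_simps)
  show "rot X s \<in> center_orbit \<alpha> \<beta>" if "s \<in> center_orbit \<alpha> \<beta>" for X s
    using that unfolding center_orbit_def
    by (elim insertE emptyE; cases X) (simp_all add: rot_simps)
qed (auto simp: cong_def)

text \<open>The half-open quadrant \<alpha> > 0 \<ge> \<beta> is a fundamental domain for the
  quarter turns of a face about its midpoint. The centre corners are the case \<beta> = - \<alpha>,
  and for \<beta> = 0 the facelets lie in middle layers.\<close>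

lemma center_orbit_valid:
  assumes ab: "0 < \<alpha>" "\<alpha> < r" "\<beta> \<le> 0" "- r < \<beta>" and layer: "layer \<alpha>" "layer \<beta>"
  defines "\<Omega> \<equiv> center_orbit \<alpha> \<beta>"
  assumes h: "h permutes \<Omega>" "sign h = 1"
  shows "valid n h"
proof -
  interpret E: cube_orbit n r \<Omega> \<Omega> id id "\<lambda>_. 0" 1
    unfolding \<Omega>_def using layer by (rule center_orbit_cube_orbit)
  let ?a = "((\<alpha>, r, \<beta>), (0, 1, 0))" and ?b = "((\<alpha>, \<beta>, - r), (0, 0, - 1))"
  note \<Omega> = center_orbit_def[of \<alpha> \<beta>, folded \<Omega>_def]
  \<comment> \<open>Of the layer x = \<beta>, the turn of the upper layer carries just one facelet
    into the layer x = \<alpha>; the facelets that it leaves alone stay outside, as \<alpha> and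
    \<beta> differ.\<close>
  have only: "u \<in> \<Omega> \<and> id u = id ((\<beta>, r, - \<alpha>), (0, 1, 0))"
    if "u \<in> facelets n" "dot (fst u) (normal Right) = \<beta>"
      "dot (fst (slice Up r u)) (normal Right) = \<alpha>" for u
    using that(1)
    by (rule facelets_cases)
      (use that ab layer in \<open>auto simp: slice_def facelets_simps rot_simps \<Omega> split: if_splits\<close>)
  have start: "E.reach ?a ?b ((\<beta>, - \<alpha>, - r), (0, 0, - 1))"
    using E.reach_commutator[of "((\<beta>, r, - \<alpha>), (0, 1, 0))" Right \<beta> Right \<alpha> Up r, OF _ _ _ _ only] ab layer
    by (simp add: slice_def facelets_simps rot_simps \<Omega>)
  \<comment> \<open>A spanning tree of the remaining facelets: each arises from an earlier one by
    the turn of a layer that contains neither \<open>?a\<close> nor \<open>?b\<close>.\<close>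
  have c0: "E.reach ?a ?b ((\<beta>, - r, \<alpha>), (0, - 1, 0))"
    using E.reach_rot[OF start, of Right] ab by (simp add: rot_simps)
  have c1: "E.reach ?a ?b ((\<beta>, r, - \<alpha>), (0, 1, 0))"
    using E.reach_rot[OF start, of Left] ab by (simp add: rot_simps)
  have c2: "E.reach ?a ?b ((- \<alpha>, - r, \<beta>), (0, - 1, 0))"
    using E.reach_rot[OF c0, of Up] ab by (simp add: rot_simps)
  have c3: "E.reach ?a ?b ((\<beta>, \<alpha>, r), (0, 0, 1))"
    using E.reach_rot[OF c0, of Right] ab by (simp add: rot_simps)
  have c4: "E.reach ?a ?b ((- r, - \<beta>, \<alpha>), (- 1, 0, 0))"
    using E.reach_rot[OF c0, of Front] ab by (simp add: rot_simps)
  have c5: "E.reach ?a ?b ((\<alpha>, - r, - \<beta>), (0, - 1, 0))"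
    using E.reach_rot[OF c0, of Down] ab by (simp add: rot_simps)
  have c6: "E.reach ?a ?b ((r, \<beta>, \<alpha>), (1, 0, 0))"
    using E.reach_rot[OF c0, of Back] ab by (simp add: rot_simps)
  have c7: "E.reach ?a ?b ((- \<beta>, - r, - \<alpha>), (0, - 1, 0))"
    using E.reach_rot[OF c2, of Up] ab by (simp add: rot_simps)
  have c8: "E.reach ?a ?b ((- \<alpha>, \<beta>, r), (0, 0, 1))"
    using E.reach_rot[OF c2, of Right] ab by (simp add: rot_simps)
  have c9: "E.reach ?a ?b ((- \<alpha>, - \<beta>, - r), (0, 0, - 1))"
    using E.reach_rot[OF c2, of Left] ab by (simp add: rot_simps)
  have c10: "E.reach ?a ?b ((- r, \<alpha>, \<beta>), (- 1, 0, 0))"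
    using E.reach_rot[OF c3, of Up] ab by (simp add: rot_simps)
  have c11: "E.reach ?a ?b ((\<alpha>, - \<beta>, r), (0, 0, 1))"
    using E.reach_rot[OF c3, of Front] ab by (simp add: rot_simps)
  have c12: "E.reach ?a ?b ((r, \<alpha>, - \<beta>), (1, 0, 0))"
    using E.reach_rot[OF c3, of Down] ab by (simp add: rot_simps)
  have c13: "E.reach ?a ?b ((- \<beta>, r, \<alpha>), (0, 1, 0))"
    using E.reach_rot[OF c4, of Front] ab by (simp add: rot_simps)
  have c14: "E.reach ?a ?b ((- r, - \<alpha>, - \<beta>), (- 1, 0, 0))"
    using E.reach_rot[OF c4, of Left] ab by (simp add: rot_simps)
  have c15: "E.reach ?a ?b ((r, - \<alpha>, \<beta>), (1, 0, 0))"
    using E.reach_rot[OF c6, of Left] ab by (simp add: rot_simps)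
  have c16: "E.reach ?a ?b ((- \<alpha>, r, - \<beta>), (0, 1, 0))"
    using E.reach_rot[OF c8, of Right] ab by (simp add: rot_simps)
  have c17: "E.reach ?a ?b ((- \<beta>, - \<alpha>, r), (0, 0, 1))"
    using E.reach_rot[OF c8, of Back] ab by (simp add: rot_simps)
  have c18: "E.reach ?a ?b ((- \<beta>, \<alpha>, - r), (0, 0, - 1))"
    using E.reach_rot[OF c10, of Up] ab by (simp add: rot_simps)
  have c19: "E.reach ?a ?b ((- r, \<beta>, - \<alpha>), (- 1, 0, 0))"
    using E.reach_rot[OF c10, of Right] ab by (simp add: rot_simps)
  have c20: "E.reach ?a ?b ((r, - \<beta>, - \<alpha>), (1, 0, 0))"
    using E.reach_rot[OF c12, of Right] ab by (simp add: rot_simps)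
  have bact_eq: "E.bact h = h"
  proof
    fix s
    show "E.bact h s = h s"
    proof (cases "s \<in> \<Omega>")
      case True
      then have "E.rep s = s" using E.rep[of s] by simp
      then show ?thesis using True by (simp add: E.bact_def)
    next
      case False
      then have "h s = s" using h(1) by (simp add: permutes_not_in)
      then show ?thesis using False by (simp add: E.bact_def)
    qed
  qed
  show ?thesis
  proof (rule E.valid_if_reach[of ?a ?b])
    show "?a \<in> \<Omega>" "?b \<in> \<Omega>" by (simp_all add: \<Omega>)
    show "id ?a \<noteq> id ?b" by simp
    fix x assume x: "x \<in> \<Omega>" "id x \<noteq> id ?a" "id x \<noteq> id ?b"
    note facts = start c0 c1 c2 c3 c4 c5 c6 c7 c8 c9 c10 c11 c12 c13 c14 c15 c16 c17 c18 c19 c20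
    show "E.reach ?a ?b x"
      using x(1)[unfolded \<Omega>] x(2,3) by (elim insertE emptyE) (simp_all only: facts id_apply simp_thms)
  next
    show "\<exists>xs. length xs = 5 \<and> set xs \<subseteq> \<Omega> \<and> distinct (map id xs)"
      by (rule exI[of _ "[((\<alpha>, r, \<beta>), (0, 1, 0)), ((\<alpha>, - r, - \<beta>), (0, - 1, 0)), ((\<alpha>, \<beta>, - r), (0, 0, - 1)),
         ((\<alpha>, - \<beta>, r), (0, 0, 1)), ((r, \<beta>, \<alpha>), (1, 0, 0))]"]) (simp add: \<Omega>)
    show "E.compat h"
      using h(1) by (auto simp: E.compat_def permutes_in_image permutes_inj inj_on_subset[OF permutes_inj])
    show "E.osign h = 1" using h(2) by (simp add: E.osign_def bact_eq)
    show "[E.twist h = 0] (mod int 1)" by (simp add: cong_def)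
    show "h s = s" if "s \<notin> \<Omega>" for s using that h(1) by (simp add: permutes_not_in)
  qed
qed

section \<open>Corners\<close>

definition corner_orbit :: "facelet set" where
  "corner_orbit = {s \<in> facelets n. fst s \<in> corners n}"

lemma corner_orbit_list:
  "corner_orbit =
    {((r, r, r), (1, 0, 0)), ((r, r, - r), (1, 0, 0)), ((r, - r, r), (1, 0, 0)),
     ((r, - r, - r), (1, 0, 0)), ((- r, r, r), (- 1, 0, 0)), ((- r, r, - r), (- 1, 0, 0)),
     ((- r, - r, r), (- 1, 0, 0)), ((- r, - r, - r), (- 1, 0, 0)), ((r, r, r), (0, 1, 0)),
     ((r, r, - r), (0, 1, 0)), ((- r, r, r), (0, 1, 0)), ((- r, r, - r), (0, 1, 0)),
     ((r, - r, r), (0, - 1, 0)), ((r, - r, - r), (0, - 1, 0)), ((- r, - r, r), (0, - 1, 0)),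
     ((- r, - r, - r), (0, - 1, 0)), ((r, r, r), (0, 0, 1)), ((r, - r, r), (0, 0, 1)),
     ((- r, r, r), (0, 0, 1)), ((- r, - r, r), (0, 0, 1)), ((r, r, - r), (0, 0, - 1)),
     ((r, - r, - r), (0, 0, - 1)), ((- r, r, - r), (0, 0, - 1)), ((- r, - r, - r), (0, 0, - 1))}" (is "_ = ?L")
proof (intro equalityI subsetI)
  fix s assume "s \<in> corner_orbit"
  then have s: "s \<in> facelets n" "fst s \<in> corners n" by (auto simp: corner_orbit_def)
  from s(1) show "s \<in> ?L"
    by (rule facelets_cases)
      (use s(2) in \<open>auto simp: corners_def r_def[symmetric] abs_eq_iff'\<close>)
qed (auto simp: corner_orbit_def corners_def facelets_simps r_def[symmetric])

text \<open>The normals at a corner are axis vectors that carry the signs of its coordinates, so a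
  step is a cyclic shift of the axes. Adjacent corners are mirror images of each other; the sign of
  the product of the coordinates therefore decides the sense of the shift.\<close>

definition corner_next :: "facelet \<Rightarrow> facelet" where
  "corner_next s = (case s of ((a, b, c), (u, v, w)) \<Rightarrow>
     ((a, b, c), if sgn a * sgn b * sgn c < 0 then (sgn a * \<bar>w\<bar>, sgn b * \<bar>u\<bar>, sgn c * \<bar>v\<bar>)
      else (sgn a * \<bar>v\<bar>, sgn b * \<bar>w\<bar>, sgn c * \<bar>u\<bar>)))"

lemma corner_orbit_rot: "s \<in> corner_orbit \<Longrightarrow> rot X s \<in> corner_orbit"
  by (cases s rule: facelet_exhaust; cases X)
    (auto simp: corner_orbit_def corners_def rot_simps dest: rot_facelets[of _ X])

lemma fst_corner_next: "fst (corner_next s) = fst s"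
  by (cases s rule: facelet_exhaust) (simp add: corner_next_def)

lemma corner_next_closed: "s \<in> corner_orbit \<Longrightarrow> corner_next s \<in> corner_orbit"
  unfolding corner_orbit_list by (elim insertE emptyE; hypsubst; simp add: corner_next_def)

lemma corner_next_order:
  "s \<in> corner_orbit \<Longrightarrow> corner_next (corner_next (corner_next s)) = s"
  unfolding corner_orbit_list by (elim insertE emptyE; hypsubst; simp add: corner_next_def)

lemma cw_step_corner_next: "s \<in> corner_orbit \<Longrightarrow> cw_step s (corner_next s)"
  unfolding corner_orbit_list
  by (elim insertE emptyE; hypsubst; simp add: corner_next_def cw_step_def)

lemma rot_corner_next: "s \<in> corner_orbit \<Longrightarrow> rot X (corner_next s) = corner_next (rot X s)"
  unfolding corner_orbit_list
  by (cases X; elim insertE emptyE; hypsubst; simp add: corner_next_def rot_simps)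

lemmas corner_next_props = corner_next_closed fst_corner_next corner_next_order
  cw_step_corner_next corner_orbit_rot rot_corner_next

lemma corner_block:
  assumes "s \<in> corner_orbit" "t \<in> corner_orbit" "fst s = fst t"
  shows "t = s \<or> t = corner_next s \<or> t = corner_next (corner_next s)"
proof -
  have "(fst s, u) = s \<or> (fst s, u) = corner_next s \<or> (fst s, u) = corner_next (corner_next s)"
    if "(fst s, u) \<in> facelets n" for u
    using assms(1) that unfolding corner_orbit_list
    by (elim insertE emptyE; hypsubst; simp add: corner_next_def facelets_iff) auto
  moreover have "(fst s, snd t) \<in> facelets n" using assms by (simp add: corner_orbit_def)
  ultimately show ?thesis using assms(3) by (metis prod.collapse)
qed

lemma corner_orbit_cube_orbit:
  assumes "\<And>s. s \<in> corner_orbit \<Longrightarrow> [lab (corner_next s) = lab s + 1] (mod 3)"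
  shows "cube_orbit n r corner_orbit corner_orbit corner_next fst lab 3"
proof unfold_locales
  show "finite corner_orbit" using finite_facelets by (simp add: corner_orbit_def)
  show "corner_orbit \<subseteq> facelets n" by (auto simp: corner_orbit_def)
  fix s assume s: "s \<in> corner_orbit"
  show "corner_next s \<in> corner_orbit" "fst (corner_next s) = fst s"
    using corner_next_props s by auto
  show "(corner_next ^^ 3) s = s" using corner_next_props(3)[OF s] by (simp add: numeral_3_eq_3)
  show "[lab (corner_next s) = lab s + 1] (mod int 3)" using assms s by simp
  show "\<exists>t\<in>corner_orbit. fst t = fst s" using s by blast
  fix t assume t: "t \<in> corner_orbit"
  show "fst s = fst t \<longleftrightarrow> (\<exists>j. t = (corner_next ^^ j) s)"
  proof
    assume "fst s = fst t"
    then consider "t = s" | "t = corner_next s" | "t = corner_next (corner_next s)"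
      using corner_block s t by blast
    then show "\<exists>j. t = (corner_next ^^ j) s"
    proof cases
      case 1 then show ?thesis by (intro exI[of _ 0]) simp
    next
      case 2 then show ?thesis by (intro exI[of _ 1]) simp
    next
      case 3 then show ?thesis by (intro exI[of _ 2]) (simp add: numeral_2_eq_2)
    qed
  next
    assume "\<exists>j. t = (corner_next ^^ j) s"
    then show "fst s = fst t"
      using funpow_invariant[of corner_orbit corner_next fst s] s corner_next_props(1,2) by auto
  qed
next
  fix s t j assume "s \<in> corner_orbit" "t \<in> corner_orbit"
  then show "(corner_next ^^ j) t \<in> corner_orbit"
    using funpow_invariant[of corner_orbit corner_next fst t] corner_next_props(1,2) by auto
next
  fix s X assume "s \<in> corner_orbit"
  then show "rot X s \<in> corner_orbit" "rot X (corner_next s) = corner_next (rot X s)"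
    using corner_next_props by auto
qed simp_all

lemma corner_orbit_valid:
  assumes "cube_orbit n r corner_orbit corner_orbit corner_next fst lab 3"
    and h: "block_orbit.compat corner_orbit corner_orbit corner_next h"
      "block_orbit.osign corner_orbit fst h = 1"
      "[block_orbit.twist corner_orbit fst lab 3 h = 0] (mod 3)"
      "\<And>s. s \<notin> corner_orbit \<Longrightarrow> h s = s"
  shows "valid n h"
proof -
  interpret E: cube_orbit n r corner_orbit corner_orbit corner_next fst lab 3 by (rule assms)
  let ?a = "((r, - r, - r), (0, 0, - 1))" and ?b = "((- r, - r, - r), (- 1, 0, 0))"
  \<comment> \<open>Of the upper layer, the turn of the right face takes only the corner (r, r, - r)
    into the lower layer.\<close>
  have only: "u \<in> corner_orbit \<and> fst u = fst ((r, r, - r), (0, 1, 0))"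
    if "u \<in> facelets n" "dot (fst u) (normal Up) = r"
      "dot (fst (slice Right r u)) (normal Down) = r" for u
    using that(1)
    by (rule facelets_cases)
      (use that in \<open>auto simp: slice_def facelets_simps rot_simps corner_orbit_list split: if_splits\<close>)
  have start: "E.reach ?a ?b ((r, r, - r), (0, 0, - 1))"
    using E.reach_commutator[of "((r, r, - r), (0, 1, 0))" Up r Down r Right r, OF _ _ _ _ only]
    by (simp add: slice_def facelets_simps rot_simps corner_orbit_list)
  \<comment> \<open>All 18 facelets of the other six corners are reached, hence each corner in every
    orientation.\<close>
  have c0: "E.reach ?a ?b ((r, r, r), (1, 0, 0))"
    using E.reach_rot[OF start, of Up] r2 by (simp add: rot_simps)
  have c1: "E.reach ?a ?b ((- r, r, - r), (- 1, 0, 0))"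
    using E.reach_rot[OF start, of Down] r2 by (simp add: rot_simps)
  have c2: "E.reach ?a ?b ((- r, r, r), (0, 0, 1))"
    using E.reach_rot[OF c0, of Up] r2 by (simp add: rot_simps)
  have c3: "E.reach ?a ?b ((r, - r, r), (0, - 1, 0))"
    using E.reach_rot[OF c0, of Front] r2 by (simp add: rot_simps)
  have c4: "E.reach ?a ?b ((- r, r, r), (0, 1, 0))"
    using E.reach_rot[OF c0, of Back] r2 by (simp add: rot_simps)
  have c5: "E.reach ?a ?b ((r, r, r), (0, 0, 1))"
    using E.reach_rot[OF c2, of Front] r2 by (simp add: rot_simps)
  have c6: "E.reach ?a ?b ((- r, - r, r), (0, 0, 1))"
    using E.reach_rot[OF c2, of Back] r2 by (simp add: rot_simps)
  have c7: "E.reach ?a ?b ((- r, - r, r), (- 1, 0, 0))"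
    using E.reach_rot[OF c3, of Front] r2 by (simp add: rot_simps)
  have c8: "E.reach ?a ?b ((- r, r, - r), (0, 1, 0))"
    using E.reach_rot[OF c4, of Up] r2 by (simp add: rot_simps)
  have c9: "E.reach ?a ?b ((r, r, r), (0, 1, 0))"
    using E.reach_rot[OF c4, of Down] r2 by (simp add: rot_simps)
  have c10: "E.reach ?a ?b ((- r, r, r), (- 1, 0, 0))"
    using E.reach_rot[OF c5, of Up] r2 by (simp add: rot_simps)
  have c11: "E.reach ?a ?b ((r, - r, r), (0, 0, 1))"
    using E.reach_rot[OF c5, of Front] r2 by (simp add: rot_simps)
  have c12: "E.reach ?a ?b ((r, r, - r), (1, 0, 0))"
    using E.reach_rot[OF c5, of Down] r2 by (simp add: rot_simps)
  have c13: "E.reach ?a ?b ((r, r, - r), (0, 1, 0))"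
    using E.reach_rot[OF c8, of Up] r2 by (simp add: rot_simps)
  have c14: "E.reach ?a ?b ((r, - r, r), (1, 0, 0))"
    using E.reach_rot[OF c9, of Front] r2 by (simp add: rot_simps)
  have c15: "E.reach ?a ?b ((- r, r, - r), (0, 0, - 1))"
    using E.reach_rot[OF c10, of Up] r2 by (simp add: rot_simps)
  have c16: "E.reach ?a ?b ((- r, - r, r), (0, - 1, 0))"
    using E.reach_rot[OF c10, of Back] r2 by (simp add: rot_simps)
  show ?thesis
  proof (rule E.valid_if_reach[of ?a ?b])
    show "?a \<in> corner_orbit" "?b \<in> corner_orbit" by (simp_all add: corner_orbit_list)
    show "fst ?a \<noteq> fst ?b" by simp
    fix x assume x: "x \<in> corner_orbit" "fst x \<noteq> fst ?a" "fst x \<noteq> fst ?b"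
    note facts = start c0 c1 c2 c3 c4 c5 c6 c7 c8 c9 c10 c11 c12 c13 c14 c15 c16
    show "E.reach ?a ?b x"
      using x(1)[unfolded corner_orbit_list] x(2,3)
      by (elim insertE emptyE) (simp_all only: facts fst_conv simp_thms)
  next
    show "\<exists>xs. length xs = 5 \<and> set xs \<subseteq> corner_orbit \<and> distinct (map fst xs)"
      by (rule exI[of _ "[((r, r, r), (1, 0, 0)), ((r, r, - r), (1, 0, 0)), ((r, - r, r), (1, 0, 0)),
         ((r, - r, - r), (1, 0, 0)), ((- r, r, r), (- 1, 0, 0))]"]) (simp add: corner_orbit_list)
  qed (use h in simp_all)
qed

section \<open>Edges\<close>

definition unit_part :: "int \<Rightarrow> int" where
  "unit_part x = (if x = r then 1 else if x = - r then - 1 else 0)"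

text \<open>At an edge position the values of \<open>unit_part\<close> form the sum of its two
  outward normals; subtracting one normal leaves the other.\<close>

definition edge_flip :: "facelet \<Rightarrow> facelet" where
  "edge_flip s = (case s of ((a, b, c), (u, v, w)) \<Rightarrow>
     ((a, b, c), (unit_part a - u, unit_part b - v, unit_part c - w)))"

definition edge_orbit :: "int \<Rightarrow> facelet set" where
  "edge_orbit \<alpha> = {s \<in> facelets n. fst s \<in> {(a, b, c).
     \<bar>a\<bar> = r \<and> \<bar>b\<bar> = r \<and> \<bar>c\<bar> = \<alpha> \<or> \<bar>a\<bar> = r \<and> \<bar>b\<bar> = \<alpha> \<and> \<bar>c\<bar> = r \<or> \<bar>a\<bar> = \<alpha> \<and> \<bar>b\<bar> = r \<and> \<bar>c\<bar> = r}}"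

text \<open>The determinant that occurs in \<open>left_handed\<close>, with the neighbouring face
  found by \<open>edge_flip\<close>. Its value is \<alpha> or - \<alpha>: the sign is the
  handedness, and 0 means a single edge.\<close>

definition edge_hand :: "facelet \<Rightarrow> int" where
  "edge_hand s = dot (fst s) (cross (snd (edge_flip s)) (snd s))"

text \<open>For \<open>\<alpha> = 0\<close> these are all facelets of the single edges.\<close>

definition edge_left :: "int \<Rightarrow> facelet set" where
  "edge_left \<alpha> = {s \<in> edge_orbit \<alpha>. edge_hand s \<le> 0}"

lemma unit_part_simps [simp]: "unit_part r = 1" "unit_part (- x) = - unit_part x"
  by (auto simp: unit_part_def)

lemma unit_part_inner: "0 \<le> \<alpha> \<Longrightarrow> \<alpha> < r \<Longrightarrow> unit_part \<alpha> = 0"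
  by (auto simp: unit_part_def)

lemma edge_flip_rot: "rot X (edge_flip s) = edge_flip (rot X s)"
  by (cases s rule: facelet_exhaust; cases X) (auto simp: edge_flip_def rot_simps)

lemma edge_hand_rot: "edge_hand (rot X s) = edge_hand s"
  unfolding edge_hand_def edge_flip_rot[symmetric]
  by (cases s rule: facelet_exhaust; cases X) (auto simp: edge_flip_def rot_simps algebra_simps)

text \<open>The first 24 entries are the left-handed facelets if \<alpha> > 0, the others the
  right-handed ones. For \<alpha> = 0 both halves list the same facelets.\<close>

lemma edge_orbit_list:
  assumes "0 \<le> \<alpha>" "\<alpha> < r" "layer \<alpha>"
  shows "edge_orbit \<alpha> =
    {((r, - \<alpha>, r), (1, 0, 0)), ((r, r, \<alpha>), (1, 0, 0)), ((r, - r, - \<alpha>), (1, 0, 0)),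
     ((r, \<alpha>, - r), (1, 0, 0)), ((- r, \<alpha>, r), (- 1, 0, 0)), ((- r, r, - \<alpha>), (- 1, 0, 0)),
     ((- r, - r, \<alpha>), (- 1, 0, 0)), ((- r, - \<alpha>, - r), (- 1, 0, 0)),
     ((\<alpha>, r, r), (0, 1, 0)), ((- r, r, \<alpha>), (0, 1, 0)), ((r, r, - \<alpha>), (0, 1, 0)),
     ((- \<alpha>, r, - r), (0, 1, 0)), ((\<alpha>, - r, - r), (0, - 1, 0)),
     ((- \<alpha>, - r, r), (0, - 1, 0)), ((r, - r, \<alpha>), (0, - 1, 0)),
     ((- r, - r, - \<alpha>), (0, - 1, 0)), ((\<alpha>, - r, r), (0, 0, 1)),
     ((- r, - \<alpha>, r), (0, 0, 1)), ((r, \<alpha>, r), (0, 0, 1)), ((- \<alpha>, r, r), (0, 0, 1)),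
     ((\<alpha>, r, - r), (0, 0, - 1)), ((r, - \<alpha>, - r), (0, 0, - 1)),
     ((- r, \<alpha>, - r), (0, 0, - 1)), ((- \<alpha>, - r, - r), (0, 0, - 1)),
     ((r, \<alpha>, r), (1, 0, 0)), ((r, r, - \<alpha>), (1, 0, 0)), ((r, - r, \<alpha>), (1, 0, 0)),
     ((r, - \<alpha>, - r), (1, 0, 0)), ((- r, - \<alpha>, r), (- 1, 0, 0)),
     ((- r, r, \<alpha>), (- 1, 0, 0)), ((- r, - r, - \<alpha>), (- 1, 0, 0)),
     ((- r, \<alpha>, - r), (- 1, 0, 0)), ((- \<alpha>, r, r), (0, 1, 0)), ((- r, r, - \<alpha>), (0, 1, 0)),
     ((r, r, \<alpha>), (0, 1, 0)), ((\<alpha>, r, - r), (0, 1, 0)), ((- \<alpha>, - r, - r), (0, - 1, 0)),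
     ((\<alpha>, - r, r), (0, - 1, 0)), ((r, - r, - \<alpha>), (0, - 1, 0)),
     ((- r, - r, \<alpha>), (0, - 1, 0)), ((- \<alpha>, - r, r), (0, 0, 1)), ((- r, \<alpha>, r), (0, 0, 1)),
     ((r, - \<alpha>, r), (0, 0, 1)), ((\<alpha>, r, r), (0, 0, 1)), ((- \<alpha>, r, - r), (0, 0, - 1)),
     ((r, \<alpha>, - r), (0, 0, - 1)), ((- r, - \<alpha>, - r), (0, 0, - 1)),
     ((\<alpha>, - r, - r), (0, 0, - 1))}" (is "_ = ?L")
proof (intro equalityI subsetI)
  fix s assume "s \<in> edge_orbit \<alpha>"
  then have s: "s \<in> facelets n" "fst s \<in> {(a, b, c).
     \<bar>a\<bar> = r \<and> \<bar>b\<bar> = r \<and> \<bar>c\<bar> = \<alpha> \<or> \<bar>a\<bar> = r \<and> \<bar>b\<bar> = \<alpha> \<and> \<bar>c\<bar> = r \<or> \<bar>a\<bar> = \<alpha> \<and> \<bar>b\<bar> = r \<and> \<bar>c\<bar> = r}"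
    by (auto simp: edge_orbit_def)
  from s(1) show "s \<in> ?L"
    by (rule facelets_cases) (use s(2) assms in \<open>auto simp: abs_eq_iff'\<close>)
next
  fix s :: facelet assume "s \<in> ?L"
  then show "s \<in> edge_orbit \<alpha>"
    by (elim insertE emptyE; hypsubst)
      (simp_all add: edge_orbit_def facelets_simps abs_of_nonneg[OF assms(1)] assms(3))
qed

lemma fst_edge_flip: "fst (edge_flip s) = fst s"
  by (cases s rule: facelet_exhaust) (simp add: edge_flip_def)

lemma edge_flip_flip: "edge_flip (edge_flip s) = s"
  by (cases s rule: facelet_exhaust) (simp add: edge_flip_def)

lemma edge_flip_closed:
  assumes al: "0 \<le> \<alpha>" "\<alpha> < r" "layer \<alpha>" and s: "s \<in> edge_orbit \<alpha>"
  shows "edge_flip s \<in> edge_orbit \<alpha>"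
  using s unfolding edge_orbit_list[OF al]
  by (elim insertE emptyE; hypsubst) (simp_all add: edge_flip_def unit_part_inner[OF al(1,2)])

lemma edge_hand_cases:
  assumes al: "0 \<le> \<alpha>" "\<alpha> < r" "layer \<alpha>" and s: "s \<in> edge_orbit \<alpha>"
  shows "edge_hand s = \<alpha> \<or> edge_hand s = - \<alpha>"
  using s unfolding edge_orbit_list[OF al]
  by (elim insertE emptyE; hypsubst)
    (simp_all add: edge_hand_def edge_flip_def unit_part_inner[OF al(1,2)])

lemma edge_hand_flip: "edge_hand (edge_flip s) = - edge_hand s"
  unfolding edge_hand_def edge_flip_flip
  by (cases s rule: facelet_exhaust) (simp add: edge_flip_def algebra_simps)

lemma edge_orbit_rot: "s \<in> edge_orbit \<alpha> \<Longrightarrow> rot X s \<in> edge_orbit \<alpha>"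
  by (cases s rule: facelet_exhaust; cases X)
    (auto simp: edge_orbit_def rot_simps dest: rot_facelets[of _ X])

lemma edge_block:
  assumes al: "0 \<le> \<alpha>" "\<alpha> < r" "layer \<alpha>"
    and st: "s \<in> edge_orbit \<alpha>" "t \<in> edge_orbit \<alpha>" "fst s = fst t"
  shows "t = s \<or> t = edge_flip s"
proof -
  have ne: "\<alpha> \<noteq> r" "\<alpha> \<noteq> - r" "- \<alpha> \<noteq> r" "r \<noteq> \<alpha>" "r \<noteq> - \<alpha>" "- r \<noteq> \<alpha>" using al by auto
  have "(fst s, u) = s \<or> (fst s, u) = edge_flip s"
    if "(fst s, u) \<in> facelets n" for u
    using st(1) that unfolding edge_orbit_list[OF al]
    by (elim insertE emptyE; hypsubst;
        simp add: edge_flip_def facelets_iff unit_part_inner[OF al(1,2)] ne) auto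
  moreover have "(fst s, snd t) \<in> facelets n" using st by (simp add: edge_orbit_def)
  ultimately show ?thesis using st(3) by (metis prod.collapse)
qed

text \<open>An odd number of flips keeps a facelet in T only if its hand is 0, and this happens for
  all facelets of the orbit or for none.\<close>

lemma edge_left_homogeneous:
  assumes al: "0 \<le> \<alpha>" "\<alpha> < r" "layer \<alpha>"
    and st: "s \<in> edge_left \<alpha>" "t \<in> edge_left \<alpha>" "(edge_flip ^^ j) s \<in> edge_left \<alpha>"
  shows "(edge_flip ^^ j) t \<in> edge_left \<alpha>"
proof -
  have O: "s \<in> edge_orbit \<alpha>" "t \<in> edge_orbit \<alpha>" using st by (auto simp: edge_left_def)
  have pow: "(edge_flip ^^ j) u = (if even j then u else edge_flip u)" if "u \<in> edge_orbit \<alpha>" for u j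
    using that edge_flip_closed[OF al] edge_flip_flip by (induction j) auto
  show ?thesis
  proof (cases "even j")
    case False
    then have "edge_hand s = 0"
      using st pow[OF O(1)] edge_hand_flip[of s] by (auto simp: edge_left_def)
    then have "\<alpha> = 0" using edge_hand_cases[OF al O(1)] by auto
    then have "edge_hand (edge_flip t) = 0" using edge_hand_cases[OF al edge_flip_closed[OF al O(2)]] by auto
    then show ?thesis using False pow[OF O(2)] edge_flip_closed[OF al O(2)] by (simp add: edge_left_def)
  qed (use st pow[OF O(2)] in simp)
qed

text \<open>The label is left open: it comes from the reference facelets for single edges and from
  the left-handed facelets for coupled edges.\<close>

lemma edge_orbit_cube_orbit:
  assumes al: "0 \<le> \<alpha>" "\<alpha> < r" "layer \<alpha>"
    and lab: "\<And>s. s \<in> edge_orbit \<alpha> \<Longrightarrow> [lab (edge_flip s) = lab s + 1] (mod 2)"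
  shows "cube_orbit n r (edge_orbit \<alpha>) (edge_left \<alpha>) edge_flip fst lab 2"
proof unfold_locales
  show "finite (edge_orbit \<alpha>)" using finite_facelets by (simp add: edge_orbit_def)
  show "edge_orbit \<alpha> \<subseteq> facelets n" by (auto simp: edge_orbit_def)
  show "edge_left \<alpha> \<subseteq> edge_orbit \<alpha>" by (auto simp: edge_left_def)
  fix s assume s: "s \<in> edge_orbit \<alpha>"
  note p = edge_flip_closed[OF al s] fst_edge_flip[of s] edge_flip_flip[of s] edge_hand_flip[of s]
  show "edge_flip s \<in> edge_orbit \<alpha>" "fst (edge_flip s) = fst s" using p by auto
  show "(edge_flip ^^ 2) s = s" using p by (simp add: numeral_2_eq_2)
  show "[lab (edge_flip s) = lab s + 1] (mod int 2)" using lab s by simp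
  show "\<exists>t\<in>edge_left \<alpha>. fst t = fst s"
  proof (cases "edge_hand s \<le> 0")
    case False
    then have "edge_flip s \<in> edge_left \<alpha>" using p by (simp add: edge_left_def)
    then show ?thesis using p(2) by blast
  next
    case True
    then have "s \<in> edge_left \<alpha>" using s by (simp add: edge_left_def)
    then show ?thesis by blast
  qed
  fix t assume t: "t \<in> edge_orbit \<alpha>"
  show "fst s = fst t \<longleftrightarrow> (\<exists>j. t = (edge_flip ^^ j) s)"
  proof
    assume "fst s = fst t"
    then have "t = (edge_flip ^^ 0) s \<or> t = (edge_flip ^^ 1) s" using edge_block[OF al s t] by simp
    then show "\<exists>j. t = (edge_flip ^^ j) s" by blast
  next
    assume "\<exists>j. t = (edge_flip ^^ j) s"
    then show "fst s = fst t"
      using funpow_invariant[of "edge_orbit \<alpha>" edge_flip fst s] s edge_flip_closed[OF al] fst_edge_flip by auto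
  qed
next
  fix s t j assume "s \<in> edge_left \<alpha>" "t \<in> edge_left \<alpha>" "(edge_flip ^^ j) s \<in> edge_left \<alpha>"
  then show "(edge_flip ^^ j) t \<in> edge_left \<alpha>" using edge_left_homogeneous[OF al] by blast
next
  show "rot X s \<in> edge_orbit \<alpha>" if "s \<in> edge_orbit \<alpha>" for X s using that by (rule edge_orbit_rot)
  show "rot X s \<in> edge_left \<alpha>" if "s \<in> edge_left \<alpha>" for X s
    using that by (auto simp: edge_left_def edge_orbit_rot edge_hand_rot)
  show "rot X (edge_flip s) = edge_flip (rot X s)" for X s by (rule edge_flip_rot)
qed simp_all

lemma edge_left_list:
  assumes al: "0 \<le> \<alpha>" "\<alpha> < r" "layer \<alpha>"
  shows "edge_left \<alpha> =
    {((r, - \<alpha>, r), (1, 0, 0)), ((r, r, \<alpha>), (1, 0, 0)), ((r, - r, - \<alpha>), (1, 0, 0)),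
     ((r, \<alpha>, - r), (1, 0, 0)), ((- r, \<alpha>, r), (- 1, 0, 0)), ((- r, r, - \<alpha>), (- 1, 0, 0)),
     ((- r, - r, \<alpha>), (- 1, 0, 0)), ((- r, - \<alpha>, - r), (- 1, 0, 0)),
     ((\<alpha>, r, r), (0, 1, 0)), ((- r, r, \<alpha>), (0, 1, 0)), ((r, r, - \<alpha>), (0, 1, 0)),
     ((- \<alpha>, r, - r), (0, 1, 0)), ((\<alpha>, - r, - r), (0, - 1, 0)),
     ((- \<alpha>, - r, r), (0, - 1, 0)), ((r, - r, \<alpha>), (0, - 1, 0)),
     ((- r, - r, - \<alpha>), (0, - 1, 0)), ((\<alpha>, - r, r), (0, 0, 1)),
     ((- r, - \<alpha>, r), (0, 0, 1)), ((r, \<alpha>, r), (0, 0, 1)), ((- \<alpha>, r, r), (0, 0, 1)),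
     ((\<alpha>, r, - r), (0, 0, - 1)), ((r, - \<alpha>, - r), (0, 0, - 1)),
     ((- r, \<alpha>, - r), (0, 0, - 1)), ((- \<alpha>, - r, - r), (0, 0, - 1))}" (is "_ = ?L")
proof (intro equalityI subsetI)
  fix s assume "s \<in> edge_left \<alpha>"
  then have s: "s \<in> edge_orbit \<alpha>" "edge_hand s \<le> 0" by (auto simp: edge_left_def)
  from s(1)[unfolded edge_orbit_list[OF al]]
  show "s \<in> ?L"
    by (elim insertE emptyE)
      (use s(2) al in \<open>simp_all add: edge_hand_def edge_flip_def unit_part_inner[OF al(1,2)]\<close>)
next
  fix s :: facelet assume s: "s \<in> ?L"
  then have "edge_hand s \<le> 0"
    by (elim insertE emptyE; hypsubst)
      (simp_all add: edge_hand_def edge_flip_def unit_part_inner[OF al(1,2)] al(1))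
  moreover have "s \<in> edge_orbit \<alpha>" 
    using s by (elim insertE emptyE; hypsubst) (simp_all add: edge_orbit_list[OF al])
  ultimately show "s \<in> edge_left \<alpha>" by (simp add: edge_left_def)
qed

lemma edge_orbit_valid:
  assumes al: "0 \<le> \<alpha>" "\<alpha> < r" "layer \<alpha>"
    and co: "cube_orbit n r (edge_orbit \<alpha>) (edge_left \<alpha>) edge_flip fst lab 2"
    and h: "block_orbit.compat (edge_orbit \<alpha>) (edge_left \<alpha>) edge_flip h"
      "block_orbit.osign (edge_orbit \<alpha>) fst h = 1"
      "[block_orbit.twist (edge_orbit \<alpha>) fst lab 2 h = 0] (mod 2)"
      "\<And>s. s \<notin> edge_orbit \<alpha> \<Longrightarrow> h s = s"
  shows "valid n h"
proof -
  interpret E: cube_orbit n r "edge_orbit \<alpha>" "edge_left \<alpha>" edge_flip fst lab 2 by (rule co)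
  note L = edge_left_list[OF al]
  let ?a = "((\<alpha>, r, r), (0, 1, 0))" and ?b = "((\<alpha>, r, - r), (0, 0, - 1))"
  \<comment> \<open>The right layer, once its upper row has been turned to the front, meets the
    layer x = \<alpha> in one edge position only. For \<alpha> = 0 the latter is the middle
    slice.\<close>
  have only: "u \<in> edge_orbit \<alpha> \<and> fst u = fst ((r, r, - \<alpha>), (0, 1, 0))"
    if "u \<in> facelets n" "dot (fst u) (normal Right) = r"
      "dot (fst (slice Up r u)) (normal Right) = \<alpha>" for u
    using that(1)
    by (rule facelets_cases)
      (use that al in \<open>auto simp: slice_def facelets_simps rot_simps edge_orbit_list[OF al] split: if_splits\<close>)
  have start: "E.reach ?a ?b ((r, - \<alpha>, - r), (0, 0, - 1))"
    using E.reach_commutator[of "((r, r, - \<alpha>), (0, 1, 0))" Right r Right \<alpha> Up r, OF _ _ _ _ only] al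
    by (simp add: slice_def facelets_simps rot_simps L)
  have c0: "E.reach ?a ?b ((r, - \<alpha>, r), (1, 0, 0))"
    using E.reach_rot[OF start, of Up] al by (simp add: rot_simps)
  have c1: "E.reach ?a ?b ((r, - r, \<alpha>), (0, - 1, 0))"
    using E.reach_rot[OF start, of Right] al by (simp add: rot_simps)
  have c2: "E.reach ?a ?b ((- r, - \<alpha>, - r), (- 1, 0, 0))"
    using E.reach_rot[OF start, of Down] al by (simp add: rot_simps)
  have c3: "E.reach ?a ?b ((r, r, - \<alpha>), (0, 1, 0))"
    using E.reach_rot[OF start, of Left] al by (simp add: rot_simps)
  have c4: "E.reach ?a ?b ((- r, - \<alpha>, r), (0, 0, 1))"
    using E.reach_rot[OF c0, of Up] al by (simp add: rot_simps)
  have c5: "E.reach ?a ?b ((r, r, \<alpha>), (1, 0, 0))"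
    using E.reach_rot[OF c0, of Right] al by (simp add: rot_simps)
  have c6: "E.reach ?a ?b ((r, - r, - \<alpha>), (1, 0, 0))"
    using E.reach_rot[OF c0, of Left] al by (simp add: rot_simps)
  have c7: "E.reach ?a ?b ((- \<alpha>, - r, r), (0, - 1, 0))"
    using E.reach_rot[OF c1, of Up] al by (simp add: rot_simps)
  have c8: "E.reach ?a ?b ((r, \<alpha>, r), (0, 0, 1))"
    using E.reach_rot[OF c1, of Right] al by (simp add: rot_simps)
  have c9: "E.reach ?a ?b ((- r, - r, \<alpha>), (- 1, 0, 0))"
    using E.reach_rot[OF c1, of Front] al by (simp add: rot_simps)
  have c10: "E.reach ?a ?b ((\<alpha>, - r, - r), (0, - 1, 0))"
    using E.reach_rot[OF c1, of Down] al by (simp add: rot_simps)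
  have c11: "E.reach ?a ?b ((- r, r, - \<alpha>), (- 1, 0, 0))"
    using E.reach_rot[OF c2, of Left] al by (simp add: rot_simps)
  have c12: "E.reach ?a ?b ((- r, r, \<alpha>), (0, 1, 0))"
    using E.reach_rot[OF c4, of Right] al by (simp add: rot_simps)
  have c13: "E.reach ?a ?b ((- r, - r, - \<alpha>), (0, - 1, 0))"
    using E.reach_rot[OF c4, of Left] al by (simp add: rot_simps)
  have c14: "E.reach ?a ?b ((r, \<alpha>, - r), (1, 0, 0))"
    using E.reach_rot[OF c5, of Right] al by (simp add: rot_simps)
  have c15: "E.reach ?a ?b ((\<alpha>, - r, r), (0, 0, 1))"
    using E.reach_rot[OF c6, of Up] al by (simp add: rot_simps)
  have c16: "E.reach ?a ?b ((- \<alpha>, - r, - r), (0, 0, - 1))"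
    using E.reach_rot[OF c6, of Down] al by (simp add: rot_simps)
  have c17: "E.reach ?a ?b ((- r, \<alpha>, r), (- 1, 0, 0))"
    using E.reach_rot[OF c8, of Up] al by (simp add: rot_simps)
  have c18: "E.reach ?a ?b ((- r, \<alpha>, - r), (0, 0, - 1))"
    using E.reach_rot[OF c12, of Right] al by (simp add: rot_simps)
  show ?thesis
  proof (rule E.valid_if_reach[of ?a ?b])
    show "?a \<in> edge_left \<alpha>" "?b \<in> edge_left \<alpha>" by (simp_all add: L)
    show "fst ?a \<noteq> fst ?b" by simp
    fix x assume x: "x \<in> edge_left \<alpha>" "fst x \<noteq> fst ?a" "fst x \<noteq> fst ?b"
    note facts = start c0 c1 c2 c3 c4 c5 c6 c7 c8 c9 c10 c11 c12 c13 c14 c15 c16 c17 c18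
    show "E.reach ?a ?b x"
    \<comment> \<open>For \<alpha> = 0, T contains both facelets of every edge, and those treated as
      \<open>x0\<close> and \<open>x1\<close> below belong to the cubies of \<open>?a\<close> and
      \<open>?b\<close> and are excluded. For \<alpha> > 0 they have to be reached, by turns of the
      layer x = - \<alpha>, which is then different from the layer of \<open>?a\<close> and
      \<open>?b\<close>.\<close>
    proof (cases "\<alpha> = 0")
      case True
      note facts0 = facts[unfolded True minus_zero]
      show ?thesis
        using x(1)[unfolded L, unfolded True minus_zero] x(2,3) unfolding True minus_zero
        by (elim insertE emptyE) (simp_all only: facts0 fst_conv simp_thms)
    next
      case False
      then have pos: "\<alpha> > 0" using al by simp
    have x0: "E.reach ?a ?b ((- \<alpha>, r, r), (0, 0, 1))"
      using E.reach_rot[OF c7, of Right] al pos by (simp add: rot_simps)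
    have x1: "E.reach ?a ?b ((- \<alpha>, r, - r), (0, 1, 0))"
      using E.reach_rot[OF c16, of Left] al pos by (simp add: rot_simps)
      show ?thesis
        using x(1)[unfolded L] x(2,3) by (elim insertE emptyE) (simp_all only: facts x0 x1 fst_conv simp_thms)
    qed
  next
    show "\<exists>xs. length xs = 5 \<and> set xs \<subseteq> edge_left \<alpha> \<and> distinct (map fst xs)"
      by (rule exI[of _ "[((\<alpha>, r, r), (0, 1, 0)), ((\<alpha>, r, - r), (0, 0, - 1)), ((r, - \<alpha>, - r), (0, 0, - 1)), ((\<alpha>, - r, r), (0, 0, 1)),
         ((\<alpha>, - r, - r), (0, - 1, 0))]"]) (use al in \<open>simp add: L\<close>)
  qed (use h in simp_all)
qed


section \<open>Numbering of layers and positions\<close>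

definition height :: "nat \<Rightarrow> int" where
  "height k = - coord n k"

definition mid :: nat where
  "mid = (n + 1) div 2"

text \<open>The range of the second index of centre orbits. Its largest element is the middle layer,
  to which the single edges correspond.\<close>

abbreviation inner_layers :: "nat set" where
  "inner_layers \<equiv> {2..mid}"

lemma n_mid: "n + 1 = 2 * mid" "mid \<ge> 2" "(n - 1) div 2 = mid - 1" "int n = 2 * int mid - 1"
proof -
  obtain k where k: "n = 2 * k + 1" using odd_n by (rule oddE)
  show "n + 1 = 2 * mid" "mid \<ge> 2" "(n - 1) div 2 = mid - 1" "int n = 2 * int mid - 1"
    using k n3 unfolding mid_def by simp_all
qed

lemma pair_orbits_mid: "pair_orbits n = {2..<mid}"
  unfolding pair_orbits_def n_mid(3) using n_mid(2) by auto

text \<open>Slice k counted from the upper face lies at \<open>height k\<close>: the outer layer, k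
  = 1, at r, and the middle one at 0.\<close>

lemma height_eq: "height k = 2 * (int mid - int k)"
  unfolding height_def coord_def n_mid(4) by simp

lemma r_mid: "r = 2 * int mid - 2"
  unfolding r_def n_mid(4) by simp

lemma height_mid: "height mid = 0"
  by (simp add: height_eq)

lemma height_layer: "k \<in> inner_layers \<Longrightarrow> 0 \<le> height k \<and> height k < r \<and> layer (height k)"
  unfolding layer_def unfolding height_eq r_mid by auto

lemma height_pair: "k \<in> pair_orbits n \<Longrightarrow> k \<in> inner_layers \<and> 0 < height k"
  unfolding pair_orbits_mid height_eq by auto

lemma inner_le_n: "k \<in> inner_layers \<Longrightarrow> k \<le> n"
  using n_mid(1,2) by auto

lemma height_inj: "height k = height l \<longleftrightarrow> k = l"
  by (auto simp: height_def coord_def)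

lemma height_surj:
  assumes "layer x" "0 \<le> x" "x < r"
  shows "\<exists>k\<in>inner_layers. height k = x"
proof -
  obtain k where k: "k \<in> {1..n}" "- x = coord n k" using layer_neg_coord assms by blast
  then have "height k = x" by (simp add: height_def)
  moreover from this have "k \<in> inner_layers" using assms k unfolding height_eq r_mid by auto
  ultimately show ?thesis by blast
qed

lemma height_surj_pair:
  assumes "layer x" "0 < x" "x < r"
  shows "\<exists>k\<in>pair_orbits n. height k = x"
proof -
  obtain k where k: "k \<in> inner_layers" "height k = x" using height_surj assms by force
  moreover have "k \<noteq> mid" using k assms height_mid by auto
  ultimately show ?thesis by (auto simp: pair_orbits_mid)
qed

lemma coord_mid: "coord n ((n + 1) div 2) = 0"
  using height_mid by (simp add: height_def mid_def)

lemma single_edges_iff: "s \<in> facelets n \<Longrightarrow> fst s \<in> single_edges n \<longleftrightarrow> s \<in> edge_orbit 0"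
  by (cases s rule: facelet_exhaust)
    (simp add: single_edges_def edges_at_def edge_orbit_def coord_mid[simplified] r_def[symmetric]; blast)

lemma coupled_edges_iff:
  assumes "i \<in> pair_orbits n" "s \<in> facelets n"
  shows "fst s \<in> coupled_edges n i \<longleftrightarrow> s \<in> edge_orbit (height i)"
proof -
  have i: "i \<le> n" "0 < height i" using assms height_pair inner_le_n by auto
  have "\<bar>c\<bar> = height i \<longleftrightarrow> c = coord n i \<or> c = coord n (n + 1 - i)" for c
    using i unfolding coord_reflect[OF i(1)] height_def by auto
  then show ?thesis using assms(2)
    unfolding coupled_edges_def edges_at_def edge_orbit_def r_def[symmetric]
    by (cases s rule: facelet_exhaust) (simp del: One_nat_def add_Suc_right; blast)
qed

text \<open>On the upper face, row j and column n + 1 - i have the coordinates (height i, r, -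
  height j), the point that generates \<open>center_orbit\<close>.\<close>

lemma center_edges_eq:
  assumes "i \<le> n" "j \<le> n"
  shows "center_edges n i j = center_orbit (height i) (- height j)"
proof -
  have "center_edges n i j = (\<Union>X\<in>{Up, Down, Front, Back, Right, Left}.
      {facelet_at n X i j, facelet_at n X j (n + 1 - i),
       facelet_at n X (n + 1 - i) (n + 1 - j), facelet_at n X (n + 1 - j) i})"
  proof (intro equalityI subsetI)
    fix s assume "s \<in> center_edges n i j"
    then obtain X k l where s: "s = facelet_at n X k l"
      "(k, l) \<in> {(i, j), (j, n + 1 - i), (n + 1 - i, n + 1 - j), (n + 1 - j, i)}"
      unfolding center_edges_def by blast
    have X: "X \<in> {Up, Down, Front, Back, Right, Left}" by (cases X) simp_all
    show "s \<in> (\<Union>X\<in>{Up, Down, Front, Back, Right, Left}.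
      {facelet_at n X i j, facelet_at n X j (n + 1 - i),
       facelet_at n X (n + 1 - i) (n + 1 - j), facelet_at n X (n + 1 - j) i})"
      by (rule UN_I[OF X]) (use s in auto)
  next
    fix s assume "s \<in> (\<Union>X\<in>{Up, Down, Front, Back, Right, Left}.
      {facelet_at n X i j, facelet_at n X j (n + 1 - i),
       facelet_at n X (n + 1 - i) (n + 1 - j), facelet_at n X (n + 1 - j) i})"
    then obtain X where "s \<in> {facelet_at n X i j, facelet_at n X j (n + 1 - i),
       facelet_at n X (n + 1 - i) (n + 1 - j), facelet_at n X (n + 1 - j) i}" by blast
    then show "s \<in> center_edges n i j" unfolding center_edges_def by blast
  qed
  also have "\<dots> = center_orbit (height i) (- height j)"
    unfolding center_orbit_def UN_insert UN_empty
    by (intro equalityI subsetI; elim UnE insertE emptyE; hypsubst)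
      (simp_all only: facelet_at_def facelet_pos.simps normal.simps coord_reflect[OF assms(1)]
        coord_reflect[OF assms(2)] r_def[symmetric] height_def minus_minus insert_iff simp_thms Un_iff)
  finally show ?thesis .
qed

lemma center_corners_eq: "center_corners n i = center_edges n i i"
  unfolding center_corners_def center_edges_def by (rule Collect_cong) blast

text \<open>An edge position has only two facelets, so the neighbouring face in the definition of
  \<open>left_handed\<close> is the one given by \<open>edge_flip\<close>.\<close>

lemma left_handed_eq:
  assumes i: "i \<in> pair_orbits n"
  shows "left_handed n i = edge_left (height i)"
proof (rule set_eqI)
  fix s :: facelet
  have al: "0 \<le> height i" "height i < r" "layer (height i)" "0 < height i"
    using i height_pair height_layer by blast+
  obtain p d where pd: "s = (p, d)" by (cases s)
  show "s \<in> left_handed n i \<longleftrightarrow> s \<in> edge_left (height i)"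
  proof (cases "s \<in> edge_orbit (height i)")
    case True
    then have s: "s \<in> facelets n" by (simp add: edge_orbit_def)
    have c: "p \<in> coupled_edges n i" using coupled_edges_iff[OF i s] True pd by simp
    have fl: "edge_flip s = (p, snd (edge_flip s))" 
    proof (rule prod_eqI)
      show "fst (edge_flip s) = fst (p, snd (edge_flip s))" using fst_edge_flip[of s] pd by simp
    qed simp
    have flO: "edge_flip s \<in> edge_orbit (height i)" using edge_flip_closed[OF al(1-3) True] .
    have h: "edge_hand s \<noteq> 0" using edge_hand_cases[OF al(1-3) True] al(4) by auto
    have ne: "snd (edge_flip s) \<noteq> d"
    proof
      assume "snd (edge_flip s) = d"
      then have "edge_flip s = s" using fl pd by simp
      then show False using edge_hand_flip[of s] h by simp
    qed
    have "e = snd (edge_flip s)" if e: "e \<noteq> d" "(p, e) \<in> facelets n" for e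
    proof -
      have "(p, e) \<in> edge_orbit (height i)" using e c coupled_edges_iff[OF i e(2)] by simp
      then have "(p, e) = s \<or> (p, e) = edge_flip s" using edge_block[OF al(1-3) True, of "(p, e)"] pd by simp
      then show ?thesis
      proof
        assume "(p, e) = s"
        then show ?thesis using e(1) pd by simp
      next
        assume "(p, e) = edge_flip s"
        then have "snd (p, e) = snd (edge_flip s)" by (rule arg_cong)
        then show ?thesis by simp
      qed
    qed
    moreover have "(p, snd (edge_flip s)) \<in> facelets n" using flO fl by (simp add: edge_orbit_def)
    ultimately have "(\<exists>e. e \<noteq> d \<and> (p, e) \<in> facelets n \<and> dot p (cross e d) < 0) \<longleftrightarrow>
        dot p (cross (snd (edge_flip s)) d) < 0"
      using ne by blast
    then have "s \<in> left_handed n i \<longleftrightarrow> dot p (cross (snd (edge_flip s)) d) < 0"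
      unfolding left_handed_def pd mem_Collect_eq prod.case using s c pd by blast
    also have "\<dots> \<longleftrightarrow> edge_hand s < 0" using pd by (simp add: edge_hand_def)
    finally show ?thesis using h True by (auto simp: edge_left_def)
  next
    case False
    have "s \<notin> left_handed n i"
    proof
      assume "s \<in> left_handed n i"
      then have "s \<in> facelets n" "fst s \<in> coupled_edges n i" using pd by (auto simp: left_handed_def)
      then show False using coupled_edges_iff[OF i] False by blast
    qed
    then show ?thesis using False by (simp add: edge_left_def)
  qed
qed

lemma edge_left_zero: "edge_left 0 = edge_orbit 0"
  using edge_hand_cases[of 0] by (auto simp: edge_left_def)

text \<open>The relation is antisymmetric and a corner has three facelets; so zero steps and two
  steps are both excluded.\<close>

lemma cw_step_iff:
  assumes "s \<in> corner_orbit" "t \<in> corner_orbit"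
  shows "cw_step s t \<longleftrightarrow> t = corner_next s"
proof
  assume c: "cw_step s t"
  have anti: "\<not> cw_step t s" if "cw_step s t" for s t
    using that by (cases s rule: facelet_exhaust; cases t rule: facelet_exhaust)
      (auto simp: cw_step_def algebra_simps)
  have "fst s = fst t" using c by (simp add: cw_step_def)
  then consider "t = s" | "t = corner_next s" | "t = corner_next (corner_next s)"
    using corner_block assms by blast
  then show "t = corner_next s"
  proof cases
    case 1
    then show ?thesis using c anti by blast
  next
    case 3
    then have "cw_step t s"
      using cw_step_corner_next[OF assms(2)] corner_next_order[OF assms(1)] by simp
    then show ?thesis using c anti by blast
  qed
qed (use assms cw_step_corner_next in blast)

section \<open>Orientation labels\<close>

definition corner_lab :: "face \<Rightarrow> facelet \<Rightarrow> int" where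
  "corner_lab W s = (if s \<in> white_yellow n W then 0
     else if \<exists>t\<in>white_yellow n W. cw_step t s then 1 else 2)"

lemma white_yellow_iff:
  "s \<in> white_yellow n W \<longleftrightarrow> s \<in> corner_orbit \<and> snd s \<in> {normal W, normal (opposite W)}"
  unfolding white_yellow_def corner_orbit_def by blast

lemma corner_next_list:
  "corner_next ((r, r, r), (1, 0, 0)) = ((r, r, r), (0, 0, 1))"
  "corner_next ((r, r, r), (0, 1, 0)) = ((r, r, r), (1, 0, 0))"
  "corner_next ((r, r, r), (0, 0, 1)) = ((r, r, r), (0, 1, 0))"
  "corner_next ((r, r, - r), (1, 0, 0)) = ((r, r, - r), (0, 1, 0))"
  "corner_next ((r, r, - r), (0, 1, 0)) = ((r, r, - r), (0, 0, - 1))"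
  "corner_next ((r, r, - r), (0, 0, - 1)) = ((r, r, - r), (1, 0, 0))"
  "corner_next ((r, - r, r), (1, 0, 0)) = ((r, - r, r), (0, - 1, 0))"
  "corner_next ((r, - r, r), (0, - 1, 0)) = ((r, - r, r), (0, 0, 1))"
  "corner_next ((r, - r, r), (0, 0, 1)) = ((r, - r, r), (1, 0, 0))"
  "corner_next ((r, - r, - r), (1, 0, 0)) = ((r, - r, - r), (0, 0, - 1))"
  "corner_next ((r, - r, - r), (0, - 1, 0)) = ((r, - r, - r), (1, 0, 0))"
  "corner_next ((r, - r, - r), (0, 0, - 1)) = ((r, - r, - r), (0, - 1, 0))"
  "corner_next ((- r, r, r), (- 1, 0, 0)) = ((- r, r, r), (0, 1, 0))"
  "corner_next ((- r, r, r), (0, 1, 0)) = ((- r, r, r), (0, 0, 1))"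
  "corner_next ((- r, r, r), (0, 0, 1)) = ((- r, r, r), (- 1, 0, 0))"
  "corner_next ((- r, r, - r), (- 1, 0, 0)) = ((- r, r, - r), (0, 0, - 1))"
  "corner_next ((- r, r, - r), (0, 1, 0)) = ((- r, r, - r), (- 1, 0, 0))"
  "corner_next ((- r, r, - r), (0, 0, - 1)) = ((- r, r, - r), (0, 1, 0))"
  "corner_next ((- r, - r, r), (- 1, 0, 0)) = ((- r, - r, r), (0, 0, 1))"
  "corner_next ((- r, - r, r), (0, - 1, 0)) = ((- r, - r, r), (- 1, 0, 0))"
  "corner_next ((- r, - r, r), (0, 0, 1)) = ((- r, - r, r), (0, - 1, 0))"
  "corner_next ((- r, - r, - r), (- 1, 0, 0)) = ((- r, - r, - r), (0, - 1, 0))"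
  "corner_next ((- r, - r, - r), (0, - 1, 0)) = ((- r, - r, - r), (0, 0, - 1))"
  "corner_next ((- r, - r, - r), (0, 0, - 1)) = ((- r, - r, - r), (- 1, 0, 0))"
  by (simp_all add: corner_next_def)

text \<open>W and its opposite are the two faces of one axis, and the three facelets of a corner
  belong to the three axes.\<close>

lemma white_yellow_one:
  assumes "s \<in> corner_orbit"
  shows "s \<in> white_yellow n W \<and> corner_next s \<notin> white_yellow n W \<and> corner_next (corner_next s) \<notin> white_yellow n W \<or>
    s \<notin> white_yellow n W \<and> corner_next s \<in> white_yellow n W \<and> corner_next (corner_next s) \<notin> white_yellow n W \<or>
    s \<notin> white_yellow n W \<and> corner_next s \<notin> white_yellow n W \<and> corner_next (corner_next s) \<in> white_yellow n W"
proof -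
  let ?P = "\<lambda>s :: facelet. snd s \<in> {normal W, normal (opposite W)}"
  have "?P s \<and> \<not> ?P (corner_next s) \<and> \<not> ?P (corner_next (corner_next s)) \<or>
    \<not> ?P s \<and> ?P (corner_next s) \<and> \<not> ?P (corner_next (corner_next s)) \<or>
    \<not> ?P s \<and> \<not> ?P (corner_next s) \<and> ?P (corner_next (corner_next s))"
    using assms unfolding corner_orbit_list
    apply (elim insertE emptyE)
    apply (simp_all only: corner_next_list snd_conv)
    apply (cases W; simp)+
    done
  then show ?thesis
    by (simp only: white_yellow_iff assms corner_next_closed simp_thms)
qed

text \<open>The label counts clockwise steps from the only white or yellow facelet of the
  corner.\<close>

lemma corner_lab_next:
  assumes s: "s \<in> corner_orbit"
  shows "[corner_lab W (corner_next s) = corner_lab W s + 1] (mod 3)"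
proof -
  let ?WY = "white_yellow n W"
  have 1: "corner_next s \<in> corner_orbit" "corner_next (corner_next s) \<in> corner_orbit"
    using s corner_next_closed by auto
  have step: "(\<exists>t\<in>?WY. cw_step t (corner_next u)) \<longleftrightarrow> u \<in> ?WY" if u: "u \<in> corner_orbit" for u
  proof
    assume "\<exists>t\<in>?WY. cw_step t (corner_next u)"
    then obtain t where t: "t \<in> ?WY" "cw_step t (corner_next u)" by blast
    then have "t \<in> corner_orbit" by (simp add: white_yellow_iff)
    moreover from this have "corner_next t = corner_next u"
      using t cw_step_iff[of t "corner_next u"] corner_next_closed[OF u] by simp
    ultimately have "t = u" using corner_next_order u by metis
    then show "u \<in> ?WY" using t by simp
  qed (use u cw_step_corner_next in blast)
  have s3: "s = corner_next (corner_next (corner_next s))" using corner_next_order[OF s] by simp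
  have e: "corner_lab W (corner_next s) = (if corner_next s \<in> ?WY then 0 else if s \<in> ?WY then 1 else 2)"
    unfolding corner_lab_def step[OF s] ..
  have f: "corner_lab W s = (if s \<in> ?WY then 0 else if corner_next (corner_next s) \<in> ?WY then 1 else 2)"
    using step[OF 1(2)] s3 unfolding corner_lab_def by simp
  show ?thesis using white_yellow_one[OF s, of W] unfolding e f by (auto simp: cong_def)
qed

definition edge_lab :: "facelet set \<Rightarrow> facelet \<Rightarrow> int" where
  "edge_lab A s = (if s \<in> A then 0 else 1)"

lemma edge_lab_flip:
  assumes "s \<in> A \<longleftrightarrow> edge_flip s \<notin> A"
  shows "[edge_lab A (edge_flip s) = edge_lab A s + 1] (mod 2)"
  using assms by (auto simp: edge_lab_def cong_def)

lemma reference_flip: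
  assumes "reference_facelets n Ref" "s \<in> edge_orbit 0"
  shows "s \<in> Ref \<longleftrightarrow> edge_flip s \<notin> Ref"
proof -
  have al: "0 \<le> (0::int)" "0 < r" "layer 0" by auto
  have sf: "s \<in> facelets n" using assms by (simp add: edge_orbit_def)
  have "fst s \<in> single_edges n" using single_edges_iff[OF sf] assms by simp
  then have ex1: "\<exists>!t. t \<in> Ref \<and> fst t = fst s" using assms by (simp add: reference_facelets_def)
  then obtain t where t: "t \<in> Ref" "fst t = fst s" by blast
  have "t \<in> facelets n" "fst t \<in> single_edges n" using t assms by (auto simp: reference_facelets_def)
  then have "t \<in> edge_orbit 0" using single_edges_iff by blast
  then have ts: "t = s \<or> t = edge_flip s" using edge_block[OF al assms(2)] t by simp
  have "edge_flip s \<noteq> s"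
    using assms(2) unfolding edge_orbit_list[OF al]
    by (elim insertE emptyE; hypsubst) (simp_all add: edge_flip_def unit_part_def)
  then show ?thesis using ts t ex1 fst_edge_flip[of s] by metis
qed

end

section \<open>Signs of the slice turns\<close>

context odd_cube
begin

abbreviation "csign \<equiv> block_orbit.osign corner_orbit fst"
abbreviation "esign \<alpha> \<equiv> block_orbit.osign (edge_orbit \<alpha>) fst"
abbreviation "msign \<alpha> \<beta> \<equiv> block_orbit.osign (center_orbit \<alpha> \<beta>) id"
abbreviation "ccompat \<equiv> block_orbit.compat corner_orbit corner_orbit corner_next"
abbreviation "ecompat \<alpha> \<equiv> block_orbit.compat (edge_orbit \<alpha>) (edge_left \<alpha>) edge_flip"
abbreviation "mcompat \<alpha> \<beta> \<equiv> block_orbit.compat (center_orbit \<alpha> \<beta>) (center_orbit \<alpha> \<beta>) id"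

lemma corner_instance: "cube_orbit n r corner_orbit corner_orbit corner_next fst (corner_lab W) 3"
  by (rule corner_orbit_cube_orbit) (rule corner_lab_next)

lemma edge_instance:
  assumes "0 \<le> \<alpha>" "\<alpha> < r" "layer \<alpha>" "\<And>s. s \<in> edge_orbit \<alpha> \<Longrightarrow> s \<in> A \<longleftrightarrow> edge_flip s \<notin> A"
  shows "cube_orbit n r (edge_orbit \<alpha>) (edge_left \<alpha>) edge_flip fst (edge_lab A) 2"
  by (rule edge_orbit_cube_orbit) (use assms edge_lab_flip in blast)+

lemma edge_left_flip:
  assumes "0 < \<alpha>" "\<alpha> < r" "layer \<alpha>" "s \<in> edge_orbit \<alpha>"
  shows "s \<in> edge_left \<alpha> \<longleftrightarrow> edge_flip s \<notin> edge_left \<alpha>"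
proof -
  have al: "0 \<le> \<alpha>" "\<alpha> < r" "layer \<alpha>" using assms by auto
  have "edge_hand s \<noteq> 0" using edge_hand_cases[OF al assms(4)] assms(1) by auto
  then show ?thesis
    using edge_flip_closed[OF al assms(4)] assms(4) edge_hand_flip[of s] by (auto simp: edge_left_def)
qed

lemma coupled_instance:
  assumes "0 < \<alpha>" "\<alpha> < r" "layer \<alpha>"
  shows "cube_orbit n r (edge_orbit \<alpha>) (edge_left \<alpha>) edge_flip fst (edge_lab (edge_left \<alpha>)) 2"
  by (rule edge_instance) (use assms edge_left_flip in auto)

text \<open>A choice of reference facelets that turns of the upper slice preserve.\<close>

definition belt :: "facelet \<Rightarrow> bool" where
  "belt s \<longleftrightarrow> snd s \<in> {(0, 1, 0), (0, - 1, 0)} \<or>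
     fst (snd (fst s)) = 0 \<and> snd s \<in> {(0, 0, 1), (0, 0, - 1)}"

lemma belt_flip: "s \<in> edge_orbit 0 \<Longrightarrow> s \<in> {s. belt s} \<longleftrightarrow> edge_flip s \<notin> {s. belt s}"
  unfolding edge_orbit_list[of 0, simplified]
  by (elim insertE emptyE) (simp_all add: belt_def edge_flip_def unit_part_def)

lemma single_instance: "cube_orbit n r (edge_orbit 0) (edge_left 0) edge_flip fst (edge_lab {s. belt s}) 2"
  by (rule edge_instance) (use belt_flip in auto)

lemma edge_transversal:
  assumes al: "0 \<le> \<alpha>" "\<alpha> < r" "layer \<alpha>"
    and co: "cube_orbit n r (edge_orbit \<alpha>) (edge_left \<alpha>) edge_flip fst lab 2"
    and A: "\<And>s. s \<in> edge_orbit \<alpha> \<Longrightarrow> s \<in> A \<longleftrightarrow> edge_flip s \<notin> A" "A \<subseteq> edge_orbit \<alpha>"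
  shows "block_orbit.transversal (edge_orbit \<alpha>) fst A"
proof -
  interpret E: cube_orbit n r "edge_orbit \<alpha>" "edge_left \<alpha>" edge_flip fst lab 2 by (rule co)
  have "inj_on fst A"
  proof (rule inj_onI)
    fix s t assume st: "s \<in> A" "t \<in> A" "fst s = fst t"
    then have "t = s \<or> t = edge_flip s" using edge_block[OF al] A(2) by blast
    then show "s = t" using st A by blast
  qed
  moreover have "fst ` A = fst ` edge_orbit \<alpha>"
  proof (intro equalityI subsetI)
    fix p assume "p \<in> fst ` edge_orbit \<alpha>"
    then obtain s where s: "s \<in> edge_orbit \<alpha>" "p = fst s" by blast
    show "p \<in> fst ` A"
    proof (cases "s \<in> A")
      case True
      then show ?thesis using s by blast
    next
      case False
      then have "edge_flip s \<in> A" using A(1)[OF s(1)] by blast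
      then show ?thesis using s fst_edge_flip[of s] by (metis imageI)
    qed
  qed (use A(2) in blast)
  ultimately show ?thesis using A(2) by (simp add: E.transversal_def bij_betw_def)
qed

lemma slice_moved: "slice X c s \<noteq> s \<Longrightarrow> dot (fst s) (normal X) = c"
  by (auto simp: slice_def split: if_splits)

lemma slice_fixed: "dot (fst s) (normal X) \<noteq> c \<Longrightarrow> slice X c s = s"
  by (simp add: slice_def)

lemmas cube_simps = slice_def rot_simps facelets_simps

section \<open>Turns of layers parallel to the upper face\<close>

lemma csign_top: "csign (slice Up r) = - 1"
proof -
  interpret E: cube_orbit n r corner_orbit corner_orbit corner_next fst "corner_lab Up" 3
    by (rule corner_instance)
  show ?thesis
  proof (rule E.osign_cycle4[OF E.compat_slice, of "((r, r, r), (0, 1, 0))"])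
    fix t assume t: "t \<in> corner_orbit" "slice Up r t \<noteq> t"
    then have "dot (fst t) (normal Up) = r" by (intro slice_moved)
    with t(1) show "fst t \<in> set (E.cycle4 (slice Up r) ((r, r, r), 0, 1, 0))"
      unfolding corner_orbit_list by (elim insertE emptyE) (simp_all add: E.cycle4_def cube_simps)
  qed (simp_all add: corner_orbit_list slice_order, simp add: E.cycle4_def cube_simps)
qed

lemma corner_inner_fixed:
  assumes "- r < c" "c < r" "s \<in> corner_orbit"
  shows "slice Up c s = s"
proof (rule slice_fixed)
  show "dot (fst s) (normal Up) \<noteq> c"
    using assms(3) unfolding corner_orbit_list by (elim insertE emptyE) (use assms(1,2) in simp_all)
qed

lemma esign_zero_top: "esign 0 (slice Up r) = - 1"
proof -
  interpret E: cube_orbit n r "edge_orbit 0" "edge_left 0" edge_flip fst "edge_lab {s. belt s}" 2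
    by (rule single_instance)
  note L = edge_orbit_list[of 0, simplified]
  show ?thesis
  proof (rule E.osign_cycle4[OF E.compat_slice, of "((0, r, r), (0, 1, 0))"])
    fix t assume t: "t \<in> edge_orbit 0" "slice Up r t \<noteq> t"
    then have "dot (fst t) (normal Up) = r" by (intro slice_moved)
    with t(1) show "fst t \<in> set (E.cycle4 (slice Up r) ((0, r, r), 0, 1, 0))"
      unfolding L by (elim insertE emptyE) (simp_all add: E.cycle4_def cube_simps)
  qed (simp_all add: L slice_order, simp add: E.cycle4_def cube_simps)
qed

text \<open>Rotations keep the two halves of the edges apart, so the eight coupled edges of the
  upper layer form two four-cycles, through (\<alpha>, r, r) and (- \<alpha>, r, r).\<close>

lemma esign_top:
  assumes al: "0 < \<alpha>" "\<alpha> < r" "layer \<alpha>"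
  shows "esign \<alpha> (slice Up r) = 1"
proof -
  interpret E: cube_orbit n r "edge_orbit \<alpha>" "edge_left \<alpha>" edge_flip fst "edge_lab (edge_left \<alpha>)" 2
    by (rule coupled_instance[OF al])
  note L = edge_orbit_list[OF less_imp_le[OF al(1)] al(2,3)]
  have ne: "\<alpha> \<noteq> r" "- \<alpha> \<noteq> r" "r \<noteq> \<alpha>" "r \<noteq> - \<alpha>" "- r \<noteq> \<alpha>" "\<alpha> \<noteq> - r" "- \<alpha> \<noteq> \<alpha>" "\<alpha> \<noteq> - \<alpha>" "\<alpha> \<noteq> 0" using al by auto
  show ?thesis
  proof (rule E.osign_cycle4_cycle4[OF E.compat_slice, of "((\<alpha>, r, r), (0, 1, 0))" _ _ "((- \<alpha>, r, r), (0, 1, 0))"])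
    fix t assume t: "t \<in> edge_orbit \<alpha>" "slice Up r t \<noteq> t"
    then have "dot (fst t) (normal Up) = r" by (intro slice_moved)
    with t(1) show "fst t \<in> set (E.cycle4 (slice Up r) ((\<alpha>, r, r), 0, 1, 0) @ E.cycle4 (slice Up r) ((- \<alpha>, r, r), 0, 1, 0))"
      unfolding L by (elim insertE emptyE) (simp_all add: E.cycle4_def cube_simps al(3) ne)
  qed (simp_all add: L slice_order, simp add: E.cycle4_def cube_simps al(3) ne)
qed

text \<open>Only the four vertical edges of the cube have a cubie of this orbit in the
  layer.\<close>

lemma esign_same:
  assumes al: "0 < \<alpha>" "\<alpha> < r" "layer \<alpha>"
  shows "esign \<alpha> (slice Up \<alpha>) = - 1"
proof -
  interpret E: cube_orbit n r "edge_orbit \<alpha>" "edge_left \<alpha>" edge_flip fst "edge_lab (edge_left \<alpha>)" 2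
    by (rule coupled_instance[OF al])
  note L = edge_orbit_list[OF less_imp_le[OF al(1)] al(2,3)]
  have ne: "\<alpha> \<noteq> r" "- \<alpha> \<noteq> r" "r \<noteq> \<alpha>" "r \<noteq> - \<alpha>" "- r \<noteq> \<alpha>" "\<alpha> \<noteq> - r" "- \<alpha> \<noteq> \<alpha>" "\<alpha> \<noteq> - \<alpha>" "\<alpha> \<noteq> 0" using al by auto
  show ?thesis
  proof (rule E.osign_cycle4[OF E.compat_slice, of "((r, \<alpha>, r), (1, 0, 0))"])
    fix t assume t: "t \<in> edge_orbit \<alpha>" "slice Up \<alpha> t \<noteq> t"
    then have "dot (fst t) (normal Up) = \<alpha>" by (intro slice_moved)
    with t(1) show "fst t \<in> set (E.cycle4 (slice Up \<alpha>) ((r, \<alpha>, r), 1, 0, 0))"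
      unfolding L by (elim insertE emptyE) (simp_all add: E.cycle4_def cube_simps al(3) ne)
  qed (simp_all add: L slice_order, simp add: E.cycle4_def cube_simps al(3) ne)
qed

lemma edge_other_fixed:
  assumes al: "0 \<le> \<alpha>" "\<alpha> < r" "layer \<alpha>" and c: "0 < c" "c < r" "c \<noteq> \<alpha>" and s: "s \<in> edge_orbit \<alpha>"
  shows "slice Up c s = s"
proof (rule slice_fixed)
  have "- \<alpha> \<noteq> c" "- r \<noteq> c" "r \<noteq> c" using al c by auto
  then show "dot (fst s) (normal Up) \<noteq> c"
    using s c(3) unfolding edge_orbit_list[OF al] by (elim insertE emptyE) simp_all
qed

text \<open>A centre orbit has four facelets on the upper face; its facelets on other faces are
  outside the upper layer, where those faces have only edges and corners.\<close>

lemma msign_top: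
  assumes ab: "0 < \<alpha>" "\<alpha> < r" "\<beta> \<le> 0" "- r < \<beta>" and layer: "layer \<alpha>" "layer \<beta>"
  shows "msign \<alpha> \<beta> (slice Up r) = - 1"
proof -
  interpret E: cube_orbit n r "center_orbit \<alpha> \<beta>" "center_orbit \<alpha> \<beta>" id id "\<lambda>_. 0" 1
    using layer by (rule center_orbit_cube_orbit)
  have ne: "\<alpha> \<noteq> r" "- \<alpha> \<noteq> r" "\<beta> \<noteq> r" "- \<beta> \<noteq> r" "- \<alpha> \<noteq> \<alpha>" "\<alpha> \<noteq> - \<alpha>" "\<alpha> \<noteq> 0" "\<alpha> \<noteq> \<beta>" "\<beta> \<noteq> \<alpha>" "- \<beta> \<noteq> - \<alpha>"
    using ab by auto
  have ne2: "\<not> (\<alpha> = - \<beta> \<and> \<beta> = \<alpha>)" using ab by auto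
  show ?thesis
  proof (rule E.osign_cycle4[OF E.compat_slice, of "((\<alpha>, r, \<beta>), (0, 1, 0))"])
    fix t assume t: "t \<in> center_orbit \<alpha> \<beta>" "slice Up r t \<noteq> t"
    then have "dot (fst t) (normal Up) = r" by (intro slice_moved)
    with t(1) show "id t \<in> set (E.cycle4 (slice Up r) ((\<alpha>, r, \<beta>), 0, 1, 0))"
      unfolding center_orbit_def by (elim insertE emptyE) (simp_all add: E.cycle4_def cube_simps layer ne)
  next
    show "distinct (E.cycle4 (slice Up r) ((\<alpha>, r, \<beta>), 0, 1, 0))"
      using ab by (auto simp: E.cycle4_def cube_simps layer)
  qed (simp_all add: center_orbit_def slice_order)
qed

text \<open>On the four side faces the orbit has facelets at the heights \<alpha>, - \<alpha>,
  \<beta> and - \<beta>. Of these only \<alpha> and - \<beta> can equal the positive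
  \<open>c\<close>, and each contributes one four-cycle.\<close>

lemma msign_inner:
  assumes ab: "0 < \<alpha>" "\<alpha> < r" "\<beta> \<le> 0" "- r < \<beta>" and layer: "layer \<alpha>" "layer \<beta>"
    and c: "0 < c" "c < r"
  shows "msign \<alpha> \<beta> (slice Up c) = (if \<alpha> = c then - 1 else 1) * (if - \<beta> = c then - 1 else 1)"
proof -
  interpret E: cube_orbit n r "center_orbit \<alpha> \<beta>" "center_orbit \<alpha> \<beta>" id id "\<lambda>_. 0" 1
    using layer by (rule center_orbit_cube_orbit)
  have ne: "- \<alpha> \<noteq> c" "\<beta> \<noteq> c" "r \<noteq> c" "- r \<noteq> c" using ab c by auto
  show ?thesis
  proof (cases "\<alpha> = c")
    case a: True
    show ?thesis
    proof (cases "- \<beta> = c")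
      case True
      then have b: "\<beta> = - \<alpha>" "\<beta> = - c" "layer c" using a layer by auto
      have "msign \<alpha> \<beta> (slice Up c) = 1"
      proof (rule E.osign_cycle4_cycle4[OF E.compat_slice, of "((r, \<alpha>, - \<beta>), (1, 0, 0))" _ _ "((r, - \<beta>, - \<alpha>), (1, 0, 0))"])
        fix t assume t: "t \<in> center_orbit \<alpha> \<beta>" "slice Up c t \<noteq> t"
        then have "dot (fst t) (normal Up) = c" by (intro slice_moved)
        with t(1) show "id t \<in> set (E.cycle4 (slice Up c) ((r, \<alpha>, - \<beta>), 1, 0, 0) @ E.cycle4 (slice Up c) ((r, - \<beta>, - \<alpha>), 1, 0, 0))"
          unfolding center_orbit_def
          by (elim insertE emptyE) (use ne in \<open>simp_all add: E.cycle4_def cube_simps a b(2,3)\<close>)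
      next
        show "distinct (E.cycle4 (slice Up c) ((r, \<alpha>, - \<beta>), 1, 0, 0) @ E.cycle4 (slice Up c) ((r, - \<beta>, - \<alpha>), 1, 0, 0))"
          using ab(1) layer(1) unfolding b(1) a[symmetric] by (simp add: E.cycle4_def cube_simps)
      qed (simp_all add: center_orbit_def slice_order)
      then show ?thesis using a True by simp
    next
      case False
      have "msign \<alpha> \<beta> (slice Up c) = - 1"
      proof (rule E.osign_cycle4[OF E.compat_slice, of "((r, \<alpha>, - \<beta>), (1, 0, 0))"])
        fix t assume t: "t \<in> center_orbit \<alpha> \<beta>" "slice Up c t \<noteq> t"
        then have "dot (fst t) (normal Up) = c" by (intro slice_moved)
        with t(1) show "id t \<in> set (E.cycle4 (slice Up c) ((r, \<alpha>, - \<beta>), 1, 0, 0))"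
          unfolding center_orbit_def
          by (elim insertE emptyE) (use ne False layer[unfolded a] in \<open>simp_all add: E.cycle4_def cube_simps a\<close>)
      next
        show "distinct (E.cycle4 (slice Up c) ((r, \<alpha>, - \<beta>), 1, 0, 0))"
          using layer unfolding a[symmetric] by (simp add: E.cycle4_def cube_simps)
      qed (simp_all add: center_orbit_def slice_order)
      then show ?thesis using a False by simp
    qed
  next
    case a: False
    show ?thesis
    proof (cases "- \<beta> = c")
      case True
      have "msign \<alpha> \<beta> (slice Up c) = - 1"
      proof (rule E.osign_cycle4[OF E.compat_slice, of "((r, - \<beta>, - \<alpha>), (1, 0, 0))"])
        fix t assume t: "t \<in> center_orbit \<alpha> \<beta>" "slice Up c t \<noteq> t"
        then have "dot (fst t) (normal Up) = c" by (intro slice_moved)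
        with t(1) show "id t \<in> set (E.cycle4 (slice Up c) ((r, - \<beta>, - \<alpha>), 1, 0, 0))"
          unfolding center_orbit_def
          by (elim insertE emptyE) (use ne a layer in \<open>simp_all add: E.cycle4_def cube_simps True[symmetric]\<close>)
      next
        show "distinct (E.cycle4 (slice Up c) ((r, - \<beta>, - \<alpha>), 1, 0, 0))"
          using layer unfolding True[symmetric] by (simp add: E.cycle4_def cube_simps)
      qed (simp_all add: center_orbit_def slice_order)
      then show ?thesis using a True by simp
    next
      case False
      have "slice Up c s = s" if "s \<in> center_orbit \<alpha> \<beta>" for s
      proof (rule slice_fixed)
        show "dot (fst s) (normal Up) \<noteq> c"
          using that ne a False unfolding center_orbit_def by (elim insertE emptyE) simp_all
      qed
      then have "msign \<alpha> \<beta> (slice Up c) = 1" by (rule E.osign_fixed)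
      then show ?thesis using a False by simp
    qed
  qed
qed

text \<open>Connects the permutations of the tuple with \<open>bact\<close>. Compatibility makes it
  immaterial which facelet of a cubie \<open>cubie_dest\<close> looks at.\<close>

lemma perm_restrict_cubie_dest:
  assumes "cube_orbit n r \<Omega> T \<pi> fst lab d" and \<Omega>: "\<Omega> = {s \<in> facelets n. fst s \<in> P}"
    and P: "P \<subseteq> fst ` facelets n" and g: "block_orbit.compat \<Omega> T \<pi> g"
  shows "perm_restrict (cubie_dest n g) P = block_orbit.bact \<Omega> fst g"
proof -
  interpret E: cube_orbit n r \<Omega> T \<pi> fst lab d by (rule assms)
  have im: "fst ` \<Omega> = P" unfolding \<Omega> using P by blast
  show ?thesis
  proof
    fix p
    show "perm_restrict (cubie_dest n g) P p = E.bact g p"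
    proof (cases "p \<in> P")
      case True
      then obtain s where s: "s \<in> \<Omega>" "p = fst s" using im by blast
      have "cubie_dest n g p = fst (g s)"
        unfolding cubie_dest_def
      proof (rule the_equality)
        show "\<exists>s'\<in>facelets n. fst s' = p \<and> fst (g s') = fst (g s)" using s \<Omega> by blast
        fix q assume "\<exists>s'\<in>facelets n. fst s' = p \<and> fst (g s') = q"
        then obtain s' where s': "s' \<in> facelets n" "fst s' = p" "fst (g s') = q" by blast
        then have "s' \<in> \<Omega>" using True \<Omega> by simp
        then show "q = fst (g s)" using E.compat_blk_eq[OF g, of s' s] s s' by simp
      qed
      then show ?thesis using True E.bact_blk[OF g s(1)] s(2) by (simp add: perm_restrict_def)
    next
      case False
      then show ?thesis using im by (simp add: perm_restrict_def E.bact_def)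
    qed
  qed
qed

section \<open>Partition of the facelets into orbits and face midpoints\<close>

definition face_mid :: "face \<Rightarrow> facelet" where
  "face_mid X = facelet_at n X mid mid"

lemma coord_mid': "coord n mid = 0"
  using height_mid by (simp add: height_def)

lemma face_mid_simps:
  "face_mid Right = ((r, 0, 0), (1, 0, 0))" "face_mid Left = ((- r, 0, 0), (- 1, 0, 0))"
  "face_mid Up = ((0, r, 0), (0, 1, 0))" "face_mid Down = ((0, - r, 0), (0, - 1, 0))"
  "face_mid Front = ((0, 0, r), (0, 0, 1))" "face_mid Back = ((0, 0, - r), (0, 0, - 1))"
  by (simp_all add: face_mid_def facelet_at_def coord_mid' r_def)

lemma slice_face_mid: "0 < c \<Longrightarrow> slice Up c (face_mid X) = face_mid X"
  by (cases X) (auto simp: face_mid_simps slice_def rot_simps)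

lemma slice_permutes: "slice X c permutes facelets n"
proof -
  have "\<forall>y. \<exists>!x. slice X c x = y" using bij_slice[of X c] unfolding bij_iff by blast
  moreover have "\<forall>x. x \<notin> facelets n \<longrightarrow> slice X c x = x" by (simp add: slice_def)
  ultimately show ?thesis unfolding permutes_def by blast
qed

text \<open>Two points of the quadrant \<alpha> > 0 \<ge> \<beta> that agree up to quarter turns are
  equal.\<close>

lemma center_orbit_unique:
  assumes "0 < \<alpha>" "\<beta> \<le> 0" "0 < \<alpha>'" "\<beta>' \<le> 0"
    and "s \<in> center_orbit \<alpha> \<beta>" "s \<in> center_orbit \<alpha>' \<beta>'"
  shows "\<alpha> = \<alpha>' \<and> \<beta> = \<beta>'"
proof -
  \<comment> \<open>In a suitable frame of its face the facelet has plane coordinates (x, y), which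
    are one of the four quarter turns of (\<alpha>, \<beta>).\<close>
  have key: "\<exists>x y. ((x, y) = (\<alpha>, \<beta>) \<or> (x, y) = (- \<beta>, \<alpha>) \<or> (x, y) = (\<beta>, - \<alpha>) \<or> (x, y) = (- \<alpha>, - \<beta>)) \<and>
      (case s of ((p, q, t), (u, v, w)) \<Rightarrow>
        if u \<noteq> 0 then (x, y) = (- u * q, t) else if v \<noteq> 0 then (x, y) = (p, v * t) else (x, y) = (p, - w * q))"
    if "s \<in> center_orbit \<alpha> \<beta>" for \<alpha> \<beta>
    using that unfolding center_orbit_def by (elim insertE emptyE; hypsubst) simp_all
  obtain p q t u v w where s: "s = ((p, q, t), (u, v, w))" by (rule facelet_exhaust)
  obtain x y x' y' where
    "(x, y) = (\<alpha>, \<beta>) \<or> (x, y) = (- \<beta>, \<alpha>) \<or> (x, y) = (\<beta>, - \<alpha>) \<or> (x, y) = (- \<alpha>, - \<beta>)"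
    "(x', y') = (\<alpha>', \<beta>') \<or> (x', y') = (- \<beta>', \<alpha>') \<or> (x', y') = (\<beta>', - \<alpha>') \<or> (x', y') = (- \<alpha>', - \<beta>')"
    "(x, y) = (x', y')"
    using key[OF assms(5)] key[OF assms(6)] unfolding s prod.case by (auto split: if_splits)
  then show ?thesis using assms(1-4) by auto
qed

lemma edge_orbit_unique:
  assumes "\<alpha> < r" "\<alpha>' < r" "s \<in> edge_orbit \<alpha>" "s \<in> edge_orbit \<alpha>'"
  shows "\<alpha> = \<alpha>'"
  using assms by (cases s rule: facelet_exhaust) (auto simp: edge_orbit_def)

lemma corner_edge_disjoint:
  assumes "\<alpha> < r" "s \<in> edge_orbit \<alpha>"
  shows "s \<notin> corner_orbit"
proof -
  obtain a b c where s: "fst s = (a, b, c)" by (metis surj_pair)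
  have "\<bar>a\<bar> = \<alpha> \<or> \<bar>b\<bar> = \<alpha> \<or> \<bar>c\<bar> = \<alpha>" using assms(2) s unfolding edge_orbit_def by force
  moreover have "\<bar>a\<bar> = r \<and> \<bar>b\<bar> = r \<and> \<bar>c\<bar> = r" if "s \<in> corner_orbit"
    using that s unfolding corner_orbit_def corners_def r_def by force
  ultimately show ?thesis using assms(1) by auto
qed

lemma corner_center_disjoint:
  assumes "0 < \<alpha>" "\<alpha> < r" "\<beta> \<le> 0" "- r < \<beta>"
  shows "s \<in> center_orbit \<alpha> \<beta> \<Longrightarrow> s \<notin> corner_orbit"
  unfolding center_orbit_def
  by (elim insertE emptyE; hypsubst) (use assms in \<open>simp_all add: corner_orbit_def corners_def r_def[symmetric]\<close>)

lemma edge_center_disjoint: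
  assumes "0 < \<alpha>" "\<alpha> < r" "\<beta> \<le> 0" "- r < \<beta>"
  shows "s \<in> center_orbit \<alpha> \<beta> \<Longrightarrow> s \<notin> edge_orbit \<gamma>"
  unfolding center_orbit_def
  by (elim insertE emptyE; hypsubst) (use assms in \<open>simp_all add: edge_orbit_def\<close>)

text \<open>The four quarter turns of the quadrant cover the plane without the origin, and the
  origin is the face midpoint.\<close>

lemma center_orbit_cover:
  assumes "\<bar>x\<bar> < r" "\<bar>y\<bar> < r" "layer x" "layer y" "(x, y) \<noteq> (0, 0)"
  shows "\<exists>\<alpha> \<beta>. 0 < \<alpha> \<and> \<alpha> < r \<and> \<beta> \<le> 0 \<and> - r < \<beta> \<and> layer \<alpha> \<and> layer \<beta> \<and>
    (x, y) \<in> {(\<alpha>, \<beta>), (- \<beta>, \<alpha>), (\<beta>, - \<alpha>), (- \<alpha>, - \<beta>)}"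
proof -
  consider "x > 0" "y \<le> 0" | "x \<ge> 0" "y > 0" | "x \<le> 0" "y < 0" | "x < 0" "y \<ge> 0"
    using assms(5) by fastforce
  then show ?thesis
  proof cases
    case 1 then show ?thesis using assms by (intro exI[of _ x] exI[of _ y]) auto
  next
    case 2 then show ?thesis using assms by (intro exI[of _ y] exI[of _ "- x"]) auto
  next
    case 3 then show ?thesis using assms by (intro exI[of _ "- y"] exI[of _ x]) auto
  next
    case 4 then show ?thesis using assms by (intro exI[of _ "- x"] exI[of _ "- y"]) auto
  qed
qed

lemma edge_orbitI:
  assumes "s \<in> facelets n" "fst s = (a, b, c)" "\<bar>a\<bar> = r \<and> \<bar>b\<bar> = r \<or> \<bar>a\<bar> = r \<and> \<bar>c\<bar> = r \<or> \<bar>b\<bar> = r \<and> \<bar>c\<bar> = r"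
    "\<not> (\<bar>a\<bar> = r \<and> \<bar>b\<bar> = r \<and> \<bar>c\<bar> = r)"
  shows "\<exists>\<gamma>. 0 \<le> \<gamma> \<and> \<gamma> < r \<and> layer \<gamma> \<and> s \<in> edge_orbit \<gamma>"
proof -
  have l: "layer a" "layer b" "layer c" using assms(1,2) facelets_iff[of a b c "snd s"] by (metis prod.collapse)+
  have abs: "layer \<bar>x\<bar> \<longleftrightarrow> layer x" for x by (simp add: layer_def)
  have lt: "\<bar>x\<bar> < r" if "layer x" "\<bar>x\<bar> \<noteq> r" for x using that by (auto simp: layer_def)
  consider "\<bar>a\<bar> = r" "\<bar>b\<bar> = r" "\<bar>c\<bar> \<noteq> r" | "\<bar>a\<bar> = r" "\<bar>c\<bar> = r" "\<bar>b\<bar> \<noteq> r" | "\<bar>b\<bar> = r" "\<bar>c\<bar> = r" "\<bar>a\<bar> \<noteq> r"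
    using assms(3,4) by blast
  then show ?thesis
  proof cases
    case 1
    then have "s \<in> edge_orbit \<bar>c\<bar>" using assms(1,2) by (simp add: edge_orbit_def)
    then show ?thesis using l lt 1 abs by (metis abs_ge_zero)
  next
    case 2
    then have "s \<in> edge_orbit \<bar>b\<bar>" using assms(1,2) by (simp add: edge_orbit_def)
    then show ?thesis using l lt 2 abs by (metis abs_ge_zero)
  next
    case 3
    then have "s \<in> edge_orbit \<bar>a\<bar>" using assms(1,2) by (simp add: edge_orbit_def)
    then show ?thesis using l lt 3 abs by (metis abs_ge_zero)
  qed
qed

text \<open>Three coordinates are outermost at corners, two at edges and one on centres. In each
  face a frame is chosen in which \<open>center_orbit_cover\<close> applies.\<close>

lemma facelets_cover:
  assumes s: "s \<in> facelets n"
  shows "s \<in> corner_orbit \<or> (\<exists>\<gamma>. 0 \<le> \<gamma> \<and> \<gamma> < r \<and> layer \<gamma> \<and> s \<in> edge_orbit \<gamma>) \<or>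
    (\<exists>\<alpha> \<beta>. 0 < \<alpha> \<and> \<alpha> < r \<and> \<beta> \<le> 0 \<and> - r < \<beta> \<and> layer \<alpha> \<and> layer \<beta> \<and> s \<in> center_orbit \<alpha> \<beta>) \<or>
    (\<exists>X. s = face_mid X)"
proof -
  obtain a b c u v w where abc: "s = ((a, b, c), (u, v, w))" by (rule facelet_exhaust)
  have l: "layer a" "layer b" "layer c" using s by (auto simp: abc facelets_iff)
  have lt: "\<bar>x\<bar> < r" if "layer x" "\<bar>x\<bar> \<noteq> r" for x using that by (auto simp: layer_def)
  consider (corner) "\<bar>a\<bar> = r" "\<bar>b\<bar> = r" "\<bar>c\<bar> = r"
    | (edge) "\<bar>a\<bar> = r \<and> \<bar>b\<bar> = r \<or> \<bar>a\<bar> = r \<and> \<bar>c\<bar> = r \<or> \<bar>b\<bar> = r \<and> \<bar>c\<bar> = r" "\<not> (\<bar>a\<bar> = r \<and> \<bar>b\<bar> = r \<and> \<bar>c\<bar> = r)"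
    | (center) "\<not> (\<bar>a\<bar> = r \<and> \<bar>b\<bar> = r)" "\<not> (\<bar>a\<bar> = r \<and> \<bar>c\<bar> = r)" "\<not> (\<bar>b\<bar> = r \<and> \<bar>c\<bar> = r)" by blast
  then show ?thesis
  proof cases
    case corner
    then have "s \<in> corner_orbit" using s by (simp add: corner_orbit_def corners_def abc r_def)
    then show ?thesis by blast
  next
    case edge
    then show ?thesis using edge_orbitI[OF s, of a b c] abc by simp
  next
    case center
    from s show ?thesis
    proof (cases rule: facelets_cases)
      case (1 b' c')
      have "\<bar>b'\<bar> < r" "\<bar>c'\<bar> < r" using 1 center lt abc by auto
      then show ?thesis
      proof (cases "(- b', c') = (0, 0)")
        case True
        then have "s = face_mid Right" using 1 by (simp add: face_mid_simps)
        then show ?thesis by blast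
      next
        case False
        have "\<exists>\<alpha> \<beta>. 0 < \<alpha> \<and> \<alpha> < r \<and> \<beta> \<le> 0 \<and> - r < \<beta> \<and> layer \<alpha> \<and> layer \<beta> \<and>
          (- b', c') \<in> {(\<alpha>, \<beta>), (- \<beta>, \<alpha>), (\<beta>, - \<alpha>), (- \<alpha>, - \<beta>)}"
          using \<open>\<bar>b'\<bar> < r\<close> \<open>\<bar>c'\<bar> < r\<close> 1 False by (intro center_orbit_cover) auto
        then obtain \<alpha> \<beta> where ab: "0 < \<alpha>" "\<alpha> < r" "\<beta> \<le> 0" "- r < \<beta>" "layer \<alpha>" "layer \<beta>"
          "(- b', c') \<in> {(\<alpha>, \<beta>), (- \<beta>, \<alpha>), (\<beta>, - \<alpha>), (- \<alpha>, - \<beta>)}" by blast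
        then have "s \<in> center_orbit \<alpha> \<beta>" using 1(1) by (auto simp: center_orbit_def)
        then show ?thesis using ab by blast
      qed
    next
      case (2 b' c')
      have "\<bar>b'\<bar> < r" "\<bar>c'\<bar> < r" using 2 center lt abc by auto
      then show ?thesis
      proof (cases "(b', c') = (0, 0)")
        case True
        then have "s = face_mid Left" using 2 by (simp add: face_mid_simps)
        then show ?thesis by blast
      next
        case False
        have "\<exists>\<alpha> \<beta>. 0 < \<alpha> \<and> \<alpha> < r \<and> \<beta> \<le> 0 \<and> - r < \<beta> \<and> layer \<alpha> \<and> layer \<beta> \<and>
          (b', c') \<in> {(\<alpha>, \<beta>), (- \<beta>, \<alpha>), (\<beta>, - \<alpha>), (- \<alpha>, - \<beta>)}"
          using \<open>\<bar>b'\<bar> < r\<close> \<open>\<bar>c'\<bar> < r\<close> 2 False by (intro center_orbit_cover) auto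
        then obtain \<alpha> \<beta> where ab: "0 < \<alpha>" "\<alpha> < r" "\<beta> \<le> 0" "- r < \<beta>" "layer \<alpha>" "layer \<beta>"
          "(b', c') \<in> {(\<alpha>, \<beta>), (- \<beta>, \<alpha>), (\<beta>, - \<alpha>), (- \<alpha>, - \<beta>)}" by blast
        then have "s \<in> center_orbit \<alpha> \<beta>" using 2(1) by (auto simp: center_orbit_def)
        then show ?thesis using ab by blast
      qed
    next
      case (3 a' c')
      have "\<bar>a'\<bar> < r" "\<bar>c'\<bar> < r" using 3 center lt abc by auto
      then show ?thesis
      proof (cases "(a', c') = (0, 0)")
        case True
        then have "s = face_mid Up" using 3 by (simp add: face_mid_simps)
        then show ?thesis by blast
      next
        case False
        have "\<exists>\<alpha> \<beta>. 0 < \<alpha> \<and> \<alpha> < r \<and> \<beta> \<le> 0 \<and> - r < \<beta> \<and> layer \<alpha> \<and> layer \<beta> \<and>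
          (a', c') \<in> {(\<alpha>, \<beta>), (- \<beta>, \<alpha>), (\<beta>, - \<alpha>), (- \<alpha>, - \<beta>)}"
          using \<open>\<bar>a'\<bar> < r\<close> \<open>\<bar>c'\<bar> < r\<close> 3 False by (intro center_orbit_cover) auto
        then obtain \<alpha> \<beta> where ab: "0 < \<alpha>" "\<alpha> < r" "\<beta> \<le> 0" "- r < \<beta>" "layer \<alpha>" "layer \<beta>"
          "(a', c') \<in> {(\<alpha>, \<beta>), (- \<beta>, \<alpha>), (\<beta>, - \<alpha>), (- \<alpha>, - \<beta>)}" by blast
        then have "s \<in> center_orbit \<alpha> \<beta>" using 3(1) by (auto simp: center_orbit_def)
        then show ?thesis using ab by blast
      qed
    next
      case (4 a' c')
      have "\<bar>a'\<bar> < r" "\<bar>c'\<bar> < r" using 4 center lt abc by auto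
      then show ?thesis
      proof (cases "(- a', c') = (0, 0)")
        case True
        then have "s = face_mid Down" using 4 by (simp add: face_mid_simps)
        then show ?thesis by blast
      next
        case False
        have "\<exists>\<alpha> \<beta>. 0 < \<alpha> \<and> \<alpha> < r \<and> \<beta> \<le> 0 \<and> - r < \<beta> \<and> layer \<alpha> \<and> layer \<beta> \<and>
          (- a', c') \<in> {(\<alpha>, \<beta>), (- \<beta>, \<alpha>), (\<beta>, - \<alpha>), (- \<alpha>, - \<beta>)}"
          using \<open>\<bar>a'\<bar> < r\<close> \<open>\<bar>c'\<bar> < r\<close> 4 False by (intro center_orbit_cover) auto
        then obtain \<alpha> \<beta> where ab: "0 < \<alpha>" "\<alpha> < r" "\<beta> \<le> 0" "- r < \<beta>" "layer \<alpha>" "layer \<beta>"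
          "(- a', c') \<in> {(\<alpha>, \<beta>), (- \<beta>, \<alpha>), (\<beta>, - \<alpha>), (- \<alpha>, - \<beta>)}" by blast
        then have "s \<in> center_orbit \<alpha> \<beta>" using 4(1) by (auto simp: center_orbit_def)
        then show ?thesis using ab by blast
      qed
    next
      case (5 a' b')
      have "\<bar>a'\<bar> < r" "\<bar>b'\<bar> < r" using 5 center lt abc by auto
      then show ?thesis
      proof (cases "(- a', b') = (0, 0)")
        case True
        then have "s = face_mid Front" using 5 by (simp add: face_mid_simps)
        then show ?thesis by blast
      next
        case False
        have "\<exists>\<alpha> \<beta>. 0 < \<alpha> \<and> \<alpha> < r \<and> \<beta> \<le> 0 \<and> - r < \<beta> \<and> layer \<alpha> \<and> layer \<beta> \<and>
          (- a', b') \<in> {(\<alpha>, \<beta>), (- \<beta>, \<alpha>), (\<beta>, - \<alpha>), (- \<alpha>, - \<beta>)}"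
          using \<open>\<bar>a'\<bar> < r\<close> \<open>\<bar>b'\<bar> < r\<close> 5 False by (intro center_orbit_cover) auto
        then obtain \<alpha> \<beta> where ab: "0 < \<alpha>" "\<alpha> < r" "\<beta> \<le> 0" "- r < \<beta>" "layer \<alpha>" "layer \<beta>"
          "(- a', b') \<in> {(\<alpha>, \<beta>), (- \<beta>, \<alpha>), (\<beta>, - \<alpha>), (- \<alpha>, - \<beta>)}" by blast
        then have "s \<in> center_orbit \<alpha> \<beta>" using 5(1) by (auto simp: center_orbit_def)
        then show ?thesis using ab by blast
      qed
    next
      case (6 a' b')
      have "\<bar>a'\<bar> < r" "\<bar>b'\<bar> < r" using 6 center lt abc by auto
      then show ?thesis
      proof (cases "(a', b') = (0, 0)")
        case True
        then have "s = face_mid Back" using 6 by (simp add: face_mid_simps)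
        then show ?thesis by blast
      next
        case False
        have "\<exists>\<alpha> \<beta>. 0 < \<alpha> \<and> \<alpha> < r \<and> \<beta> \<le> 0 \<and> - r < \<beta> \<and> layer \<alpha> \<and> layer \<beta> \<and>
          (a', b') \<in> {(\<alpha>, \<beta>), (- \<beta>, \<alpha>), (\<beta>, - \<alpha>), (- \<alpha>, - \<beta>)}"
          using \<open>\<bar>a'\<bar> < r\<close> \<open>\<bar>b'\<bar> < r\<close> 6 False by (intro center_orbit_cover) auto
        then obtain \<alpha> \<beta> where ab: "0 < \<alpha>" "\<alpha> < r" "\<beta> \<le> 0" "- r < \<beta>" "layer \<alpha>" "layer \<beta>"
          "(a', b') \<in> {(\<alpha>, \<beta>), (- \<beta>, \<alpha>), (\<beta>, - \<alpha>), (- \<alpha>, - \<beta>)}" by blast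
        then have "s \<in> center_orbit \<alpha> \<beta>" using 6(1) by (auto simp: center_orbit_def)
        then show ?thesis using ab by blast
      qed
    qed
  qed
qed

end

section \<open>Reduction to even arrangements\<close>

lemma perm_restrict_union:
  assumes "A \<inter> U = {}" "g ` U \<subseteq> U"
  shows "perm_restrict g (A \<union> U) = perm_restrict g A \<circ> perm_restrict g U"
proof
  fix s
  show "perm_restrict g (A \<union> U) s = (perm_restrict g A \<circ> perm_restrict g U) s"
  proof (cases "s \<in> U")
    case True
    then have "g s \<notin> A" using assms by blast
    then show ?thesis using True by (simp add: perm_restrict_def)
  qed (simp add: perm_restrict_def)
qed

context odd_cube
begin

text \<open>On disjoint invariant sets the arrangement is the product of its restrictions.\<close>

lemma valid_decompose:
  assumes "finite F" "\<And>A. A \<in> F \<Longrightarrow> g ` A \<subseteq> A" "\<And>A B. A \<in> F \<Longrightarrow> B \<in> F \<Longrightarrow> A \<noteq> B \<Longrightarrow> A \<inter> B = {}"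
    "\<And>A. A \<in> F \<Longrightarrow> valid n (perm_restrict g A)"
  shows "valid n (perm_restrict g (\<Union> F))"
  using assms
proof (induction F rule: finite_induct)
  case empty
  have "perm_restrict g (\<Union> {}) = id" by (rule ext) (simp add: perm_restrict_def)
  then show ?case by (metis valid.solved)
next
  case (insert A F)
  have "A \<inter> \<Union> F = {}" using insert.prems(2) insert.hyps(2) by blast
  moreover have "g ` \<Union> F \<subseteq> \<Union> F" using insert.prems(1) by blast
  ultimately have "perm_restrict g (\<Union> (insert A F)) = perm_restrict g A \<circ> perm_restrict g (\<Union> F)"
    unfolding Union_insert by (rule perm_restrict_union)
  moreover have "valid n (perm_restrict g A)" using insert.prems(3) by blast
  moreover have "valid n (perm_restrict g (\<Union> F))"
    by (rule insert.IH) (use insert.prems in simp_all)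
  ultimately show ?case using valid_comp by metis
qed


lemma layer_outer: "\<bar>a\<bar> = r \<Longrightarrow> layer a"
  using even_r by (auto simp: layer_def)

lemma outer_position:
  assumes "layer a" "layer b" "layer c" "\<bar>a\<bar> = r \<or> \<bar>b\<bar> = r \<or> \<bar>c\<bar> = r"
  shows "(a, b, c) \<in> fst ` facelets n"
proof -
  have "a = r \<or> a = - r \<or> b = r \<or> b = - r \<or> c = r \<or> c = - r" using assms(4) by linarith
  then have "\<exists>u. ((a, b, c), u) \<in> facelets n" unfolding facelets_iff using assms(1-3) by blast
  then show ?thesis by force
qed

lemma corner_positions: "corners n \<subseteq> fst ` facelets n"
proof
  fix p assume p: "p \<in> corners n"
  obtain a b c where abc: "p = (a, b, c)" by (rule prod_cases3)
  then have "\<bar>a\<bar> = r" "\<bar>b\<bar> = r" "\<bar>c\<bar> = r" using p unfolding corners_def r_def by simp_all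
  then show "p \<in> fst ` facelets n" unfolding abc using layer_outer by (intro outer_position) auto
qed

lemma edges_at_positions:
  assumes "k \<in> {1..n}"
  shows "edges_at n k \<subseteq> fst ` facelets n"
proof
  fix p assume p: "p \<in> edges_at n k"
  obtain a b c where abc: "p = (a, b, c)" by (rule prod_cases3)
  have "layer (coord n k)" using layer_coord assms by blast
  moreover have "\<bar>a\<bar> = r \<and> \<bar>b\<bar> = r \<and> c = coord n k \<or> \<bar>a\<bar> = r \<and> b = coord n k \<and> \<bar>c\<bar> = r \<or>
      a = coord n k \<and> \<bar>b\<bar> = r \<and> \<bar>c\<bar> = r"
    using p unfolding edges_at_def abc r_def by simp
  ultimately show "p \<in> fst ` facelets n" unfolding abc using layer_outer by (intro outer_position) auto
qed

lemma single_positions: "single_edges n = fst ` edge_orbit 0"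
proof (intro equalityI subsetI)
  fix p assume p: "p \<in> single_edges n"
  have "mid \<in> {1..n}" using n_mid(1,2) by auto
  then have "p \<in> fst ` facelets n"
    using p edges_at_positions unfolding single_edges_def mid_def by blast
  then obtain s where s: "s \<in> facelets n" "p = fst s" by blast
  then show "p \<in> fst ` edge_orbit 0" using p single_edges_iff by blast
next
  fix p assume "p \<in> fst ` edge_orbit 0"
  then obtain s where s: "s \<in> edge_orbit 0" "p = fst s" by blast
  then have "s \<in> facelets n" unfolding edge_orbit_def by blast
  then show "p \<in> single_edges n" using s single_edges_iff by blast
qed

lemma coupled_positions:
  assumes "i \<in> pair_orbits n"
  shows "coupled_edges n i \<subseteq> fst ` facelets n"
proof -
  have "2 \<le> i" "i \<le> n" using height_pair[OF assms] inner_le_n by auto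
  then have "i \<in> {1..n}" "n + 1 - i \<in> {1..n}" by auto
  then show ?thesis using edges_at_positions unfolding coupled_edges_def by blast
qed

end

section \<open>Arrangements that satisfy the sign and twist conditions\<close>

locale conf_cube = odd_cube +
  fixes W :: face and Ref :: "facelet set"
  assumes ref: "reference_facelets n Ref"
begin

sublocale C: cube_orbit n r corner_orbit corner_orbit corner_next fst "corner_lab W" 3
  by (rule corner_instance)

lemma zero_height: "0 \<le> (0 :: int)" "0 < r" "layer 0"
  by auto

sublocale S: cube_orbit n r "edge_orbit 0" "edge_left 0" edge_flip fst "edge_lab Ref" 2
  by (rule edge_instance[OF zero_height]) (rule reference_flip[OF ref])

lemma pair_height:
  assumes "i \<in> pair_orbits n"
  shows "0 < height i" "height i < r" "layer (height i)" "0 \<le> height i"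
  using height_pair[OF assms] height_layer by auto

lemma neg_height:
  assumes "j \<in> inner_layers"
  shows "- height j \<le> 0" "- r < - height j" "layer (- height j)"
  using height_layer[OF assms] by auto

abbreviation "center_at i j \<equiv> center_orbit (height i) (- height j)"
abbreviation "center_sign i j \<equiv> msign (height i) (- height j)"
abbreviation "center_compat i j \<equiv> mcompat (height i) (- height j)"

lemma pair_instance: "i \<in> pair_orbits n \<Longrightarrow>
    cube_orbit n r (edge_orbit (height i)) (edge_left (height i)) edge_flip fst (edge_lab (edge_left (height i))) 2"
  by (rule coupled_instance) (rule pair_height, assumption)+

lemma center_instance: "i \<in> pair_orbits n \<Longrightarrow> j \<in> inner_layers \<Longrightarrow>
    cube_orbit n r (center_at i j) (center_at i j) id id (\<lambda>_. 0) 1"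
  by (rule center_orbit_cube_orbit) (simp_all add: pair_height neg_height[simplified])

text \<open>The value 1 at \<open>mid\<close> is the convention in the sign condition for centre
  edges in the middle layers.\<close>

definition coupled_sign :: "nat \<Rightarrow> (facelet \<Rightarrow> facelet) \<Rightarrow> int" where
  "coupled_sign i g = (if i = mid then 1 else esign (height i) g)"

text \<open>The structural conditions. For coupled edges, \<open>ecompat\<close> demands that
  left-handed facelets stay left-handed; this accounts for their orientations, and
  \<open>lawful\<close> lists twists only for corners and single edges.\<close>

definition good :: "(facelet \<Rightarrow> facelet) \<Rightarrow> bool" where
  "good g \<longleftrightarrow> g permutes facelets n \<and> (\<forall>X. g (face_mid X) = face_mid X) \<and>
     C.compat g \<and> S.compat g \<and> (\<forall>i\<in>pair_orbits n. ecompat (height i) g) \<and>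
     (\<forall>i\<in>pair_orbits n. \<forall>j\<in>inner_layers. center_compat i j g)"

text \<open>For i = j the two coupled signs cancel, and the equation becomes the condition on centre
  corners.\<close>

definition lawful :: "(facelet \<Rightarrow> facelet) \<Rightarrow> bool" where
  "lawful g \<longleftrightarrow> good g \<and> S.osign g = C.osign g \<and>
     (\<forall>i\<in>pair_orbits n. \<forall>j\<in>inner_layers.
        center_sign i j g = C.osign g * coupled_sign i g * coupled_sign j g) \<and>
     [C.twist g = 0] (mod int 3) \<and> [S.twist g = 0] (mod int 2)"

lemma pair_not_mid: "i \<in> pair_orbits n \<Longrightarrow> i \<noteq> mid"
  by (simp add: pair_orbits_mid)

lemma inner_cases: "j \<in> inner_layers \<Longrightarrow> j = mid \<or> j \<in> pair_orbits n"
  by (auto simp: pair_orbits_mid)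

lemma good_slice:
  assumes "0 < c"
  shows "good (slice Up c)"
  unfolding good_def
proof (intro conjI ballI allI)
  show "slice Up c permutes facelets n" by (rule slice_permutes)
  show "slice Up c (face_mid X) = face_mid X" for X using slice_face_mid assms by blast
  show "C.compat (slice Up c)" by (rule C.compat_slice)
  show "S.compat (slice Up c)" by (rule S.compat_slice)
  show "ecompat (height i) (slice Up c)" if "i \<in> pair_orbits n" for i
    using cube_orbit.compat_slice[OF pair_instance[OF that]] .
  show "center_compat i j (slice Up c)" if "i \<in> pair_orbits n" "j \<in> inner_layers" for i j
    using cube_orbit.compat_slice[OF center_instance[OF that]] .
qed

lemma good_comp:
  assumes "good f" "good g"
  shows "good (f \<circ> g)"
  unfolding good_def
proof (intro conjI ballI allI)
  show "f \<circ> g permutes facelets n" using assms permutes_compose unfolding good_def by blast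
  show "(f \<circ> g) (face_mid X) = face_mid X" for X using assms by (simp add: good_def)
  show "C.compat (f \<circ> g)" using assms C.compat_comp by (simp add: good_def)
  show "S.compat (f \<circ> g)" using assms S.compat_comp by (simp add: good_def)
  show "ecompat (height i) (f \<circ> g)" if i: "i \<in> pair_orbits n" for i
  proof -
    interpret E: cube_orbit n r "edge_orbit (height i)" "edge_left (height i)" edge_flip fst "edge_lab (edge_left (height i))" 2
      by (rule pair_instance[OF i])
    show ?thesis using assms E.compat_comp i by (simp add: good_def)
  qed
  show "center_compat i j (f \<circ> g)" if ij: "i \<in> pair_orbits n" "j \<in> inner_layers" for i j
  proof -
    interpret E: cube_orbit n r "center_at i j" "center_at i j" id id "\<lambda>_. 0" 1
      by (rule center_instance[OF ij])
    show ?thesis using assms E.compat_comp ij by (simp add: good_def)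
  qed
qed

lemma sign_comp:
  assumes "good f" "good g"
  shows "C.osign (f \<circ> g) = C.osign f * C.osign g" "S.osign (f \<circ> g) = S.osign f * S.osign g"
    "j \<in> inner_layers \<Longrightarrow> coupled_sign j (f \<circ> g) = coupled_sign j f * coupled_sign j g"
    "i \<in> pair_orbits n \<Longrightarrow> j \<in> inner_layers \<Longrightarrow>
      center_sign i j (f \<circ> g) = center_sign i j f * center_sign i j g"
    "[C.twist (f \<circ> g) = C.twist f + C.twist g] (mod int 3)"
    "[S.twist (f \<circ> g) = S.twist f + S.twist g] (mod int 2)"
proof -
  show "C.osign (f \<circ> g) = C.osign f * C.osign g" "[C.twist (f \<circ> g) = C.twist f + C.twist g] (mod int 3)"
    using assms C.osign_comp C.twist_comp by (simp_all only: good_def)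
  show "S.osign (f \<circ> g) = S.osign f * S.osign g" "[S.twist (f \<circ> g) = S.twist f + S.twist g] (mod int 2)"
    using assms S.osign_comp S.twist_comp by (simp_all only: good_def)
  show "coupled_sign j (f \<circ> g) = coupled_sign j f * coupled_sign j g" if "j \<in> inner_layers"
  proof (cases "j = mid")
    case False
    then have j: "j \<in> pair_orbits n" using inner_cases that by blast
    interpret E: cube_orbit n r "edge_orbit (height j)" "edge_left (height j)" edge_flip fst "edge_lab (edge_left (height j))" 2
      by (rule pair_instance[OF j])
    show ?thesis using assms E.osign_comp j False by (simp add: good_def coupled_sign_def)
  qed (simp add: coupled_sign_def)
  assume ij: "i \<in> pair_orbits n" "j \<in> inner_layers"
  interpret E: cube_orbit n r "center_at i j" "center_at i j" id id "\<lambda>_. 0" 1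
    by (rule center_instance[OF ij])
  show "center_sign i j (f \<circ> g) = center_sign i j f * center_sign i j g"
    using assms E.osign_comp ij by (simp add: good_def)
qed

text \<open>Signs and twists are homomorphisms, and every condition is an equation between
  them.\<close>

lemma lawful_comp:
  assumes "lawful f" "lawful g"
  shows "lawful (f \<circ> g)"
proof -
  have g: "good f" "good g" using assms by (simp_all add: lawful_def)
  note sc = sign_comp[OF g]
  have "[C.twist (f \<circ> g) = 0] (mod int 3)"
    using cong_trans[OF sc(5)] cong_add[of "C.twist f" 0 "int 3" "C.twist g" 0] assms
    by (simp add: lawful_def)
  moreover have "[S.twist (f \<circ> g) = 0] (mod int 2)"
    using cong_trans[OF sc(6)] cong_add[of "S.twist f" 0 "int 2" "S.twist g" 0] assms
    by (simp add: lawful_def)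
  moreover have "center_sign i j (f \<circ> g) =
      C.osign (f \<circ> g) * coupled_sign i (f \<circ> g) * coupled_sign j (f \<circ> g)"
    if ij: "i \<in> pair_orbits n" "j \<in> inner_layers" for i j
  proof -
    have i: "i \<in> inner_layers" using ij height_pair by blast
    have "center_sign i j f = C.osign f * coupled_sign i f * coupled_sign j f"
      "center_sign i j g = C.osign g * coupled_sign i g * coupled_sign j g"
      using assms ij by (simp_all add: lawful_def)
    then show ?thesis unfolding sc(1) sc(3)[OF i] sc(3)[OF ij(2)] sc(4)[OF ij] by simp
  qed
  moreover have "S.osign (f \<circ> g) = C.osign (f \<circ> g)" using assms sc(1,2) by (simp add: lawful_def)
  ultimately show ?thesis using good_comp[OF g] by (simp add: lawful_def)
qed

lemma white_yellow_transversal: "C.transversal (white_yellow n V)"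
proof -
  have "inj_on fst (white_yellow n V)"
  proof (rule inj_onI)
    fix s t assume st: "s \<in> white_yellow n V" "t \<in> white_yellow n V" "fst s = fst t"
    then have O: "s \<in> corner_orbit" "t \<in> corner_orbit" by (simp_all add: white_yellow_iff)
    then have "t = s \<or> t = corner_next s \<or> t = corner_next (corner_next s)" using corner_block st by blast
    then show "s = t" using white_yellow_one[OF O(1), of V] st by blast
  qed
  moreover have "fst ` white_yellow n V = fst ` corner_orbit"
  proof (intro equalityI subsetI)
    fix p assume "p \<in> fst ` corner_orbit"
    then obtain s where s: "s \<in> corner_orbit" "p = fst s" by blast
    then consider "s \<in> white_yellow n V" | "corner_next s \<in> white_yellow n V"
      | "corner_next (corner_next s) \<in> white_yellow n V"
      using white_yellow_one by blast
    then show "p \<in> fst ` white_yellow n V"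
      using s fst_corner_next by cases (metis imageI)+
  next
    fix p assume "p \<in> fst ` white_yellow n V"
    then obtain s where "s \<in> white_yellow n V" "p = fst s" by blast
    then show "p \<in> fst ` corner_orbit" unfolding white_yellow_iff by blast
  qed
  moreover have "white_yellow n V \<subseteq> corner_orbit" unfolding subset_iff white_yellow_iff by blast
  ultimately show ?thesis unfolding C.transversal_def bij_betw_def by blast
qed

lemma top_signs: "C.osign (slice Up r) = - 1" "lawful (slice Up r)"
proof -
  show c: "C.osign (slice Up r) = - 1" by (rule csign_top)
  have cs: "coupled_sign j (slice Up r) = 1" if "j \<in> inner_layers" for j
    using inner_cases[OF that] esign_top pair_height by (auto simp: coupled_sign_def)
  \<comment> \<open>The labels refer to W, but zero twist can be tested on the facelets that face up
    or down, which the turn permutes.\<close>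
  have tc: "[C.twist (slice Up r) = 0] (mod int 3)"
  proof (rule C.twist_invariant_transversal[OF C.compat_slice])
    show "C.transversal (white_yellow n Up)" by (rule white_yellow_transversal)
    show "slice Up r ` white_yellow n Up \<subseteq> white_yellow n Up"
    proof
      fix u assume "u \<in> slice Up r ` white_yellow n Up"
      then obtain s where s: "s \<in> white_yellow n Up" "u = slice Up r s" by blast
      then have "s \<in> corner_orbit" "snd s \<in> {(0, 1, 0), (0, - 1, 0)}" by (simp_all add: white_yellow_iff)
      moreover from this have "snd u \<in> {(0, 1, 0), (0, - 1, 0)}"
        unfolding s(2) slice_def by (cases s rule: facelet_exhaust) (auto simp: rot_simps)
      moreover have "u \<in> corner_orbit" using C.compatD(1)[OF C.compat_slice] s calculation(1) by simp
      ultimately show "u \<in> white_yellow n Up" by (simp add: white_yellow_iff)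
    qed
  qed
  \<comment> \<open>Likewise, \<open>belt\<close> is an invariant choice that replaces the given
    reference facelets.\<close>
  have ts: "[S.twist (slice Up r) = 0] (mod int 2)"
  proof (rule S.twist_invariant_transversal[OF S.compat_slice])
    show "S.transversal {s \<in> edge_orbit 0. belt s}"
    proof (rule edge_transversal[OF zero_height S.cube_orbit_axioms])
      show "s \<in> {s \<in> edge_orbit 0. belt s} \<longleftrightarrow> edge_flip s \<notin> {s \<in> edge_orbit 0. belt s}"
        if "s \<in> edge_orbit 0" for s
        using that belt_flip[OF that] edge_flip_closed[OF zero_height that] by simp
    qed blast
    show "slice Up r ` {s \<in> edge_orbit 0. belt s} \<subseteq> {s \<in> edge_orbit 0. belt s}"
    proof
      fix u assume "u \<in> slice Up r ` {s \<in> edge_orbit 0. belt s}"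
      then obtain s where s: "s \<in> edge_orbit 0" "belt s" "u = slice Up r s" by blast
      have "belt u"
        using s(2) unfolding s(3) slice_def
        by (cases s rule: facelet_exhaust) (auto simp: rot_simps belt_def)
      moreover have "u \<in> edge_orbit 0" using S.compatD(1)[OF S.compat_slice] s by simp
      ultimately show "u \<in> {s \<in> edge_orbit 0. belt s}" by simp
    qed
  qed
  have "center_sign i j (slice Up r) = - 1" if "i \<in> pair_orbits n" "j \<in> inner_layers" for i j
    using msign_top pair_height[OF that(1)] neg_height[OF that(2)] by blast
  moreover have "i \<in> inner_layers" if "i \<in> pair_orbits n" for i using that height_pair by blast
  ultimately show "lawful (slice Up r)"
    unfolding lawful_def using good_slice[of r] c cs tc ts esign_zero_top by simp
qed

text \<open>Corners and single edges avoid this layer, and among the coupled orbits it meets only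
  orbit k.\<close>

lemma inner_signs:
  assumes k: "k \<in> pair_orbits n"
  shows "C.osign (slice Up (height k)) = 1"
    "j \<in> inner_layers \<Longrightarrow> coupled_sign j (slice Up (height k)) = (if j = k then - 1 else 1)"
    "lawful (slice Up (height k))"
proof -
  note hk = pair_height[OF k]
  have fixC: "slice Up (height k) s = s" if "s \<in> corner_orbit" for s
    using corner_inner_fixed[OF _ _ that] hk by simp
  have fixS: "slice Up (height k) s = s" if "s \<in> edge_orbit 0" for s
    using edge_other_fixed[OF zero_height _ _ _ that] hk by simp
  show c: "C.osign (slice Up (height k)) = 1" using C.osign_fixed fixC by blast
  have s: "S.osign (slice Up (height k)) = 1" using S.osign_fixed fixS by blast
  have cs: "coupled_sign j (slice Up (height k)) = (if j = k then - 1 else 1)" if "j \<in> inner_layers" for j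
  proof (cases "j = mid")
    case True
    then show ?thesis using pair_not_mid[OF k] by (simp add: coupled_sign_def)
  next
    case False
    then have j: "j \<in> pair_orbits n" using inner_cases that by blast
    note hj = pair_height[OF j]
    show ?thesis
    proof (cases "j = k")
      case True
      then show ?thesis using esign_same[OF hj(1-3)] False by (simp add: coupled_sign_def)
    next
      case jk: False
      interpret E: cube_orbit n r "edge_orbit (height j)" "edge_left (height j)" edge_flip fst "edge_lab (edge_left (height j))" 2
        by (rule pair_instance[OF j])
      have ne: "height k \<noteq> height j" using jk by (auto simp: height_inj)
      have "E.osign (slice Up (height k)) = 1"
        by (rule E.osign_fixed) (rule edge_other_fixed[OF hj(4,2,3) hk(1,2) ne])
      then show ?thesis using False jk by (simp add: coupled_sign_def)
    qed
  qed
  then show "j \<in> inner_layers \<Longrightarrow> coupled_sign j (slice Up (height k)) = (if j = k then - 1 else 1)" .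
  have "center_sign i j (slice Up (height k)) = (if i = k then - 1 else 1) * (if j = k then - 1 else 1)"
    if "i \<in> pair_orbits n" "j \<in> inner_layers" for i j
    using msign_inner[OF pair_height(1,2)[OF that(1)] neg_height(1,2)[OF that(2)] pair_height(3)[OF that(1)]
        neg_height(3)[OF that(2)] hk(1,2)] by (simp add: height_inj)
  moreover have "i \<in> inner_layers" if "i \<in> pair_orbits n" for i using that height_pair by blast
  moreover have "C.twist (slice Up (height k)) = 0" using C.twist_fixed fixC by blast
  moreover have "S.twist (slice Up (height k)) = 0" using S.twist_fixed fixS by blast
  ultimately show "lawful (slice Up (height k))"
    unfolding lawful_def using good_slice[OF hk(1)] c s cs by simp
qed

lemma osign_cases: "C.osign g = 1 \<or> C.osign g = - 1"
  "j \<in> inner_layers \<Longrightarrow> coupled_sign j g = 1 \<or> coupled_sign j g = - 1"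
proof -
  show "C.osign g = 1 \<or> C.osign g = - 1" using C.osign_square[of g] by (simp add: square_eq_1_iff)
  have "block_orbit.osign (edge_orbit (height j)) fst g = 1 \<or> block_orbit.osign (edge_orbit (height j)) fst g = - 1"
    if "j \<in> pair_orbits n"
  proof -
    interpret E: cube_orbit n r "edge_orbit (height j)" "edge_left (height j)" edge_flip fst "edge_lab (edge_left (height j))" 2
      by (rule pair_instance[OF that])
    show ?thesis using E.osign_square[of g] by (simp add: square_eq_1_iff)
  qed
  then show "j \<in> inner_layers \<Longrightarrow> coupled_sign j g = 1 \<or> coupled_sign j g = - 1"
    using inner_cases[of j] by (auto simp: coupled_sign_def)
qed

lemma fix_corner_sign:
  assumes "lawful g"
  shows "\<exists>v. valid n v \<and> lawful (v \<circ> g) \<and> C.osign (v \<circ> g) = 1"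
proof (cases "C.osign g = 1")
  case True
  then show ?thesis using assms valid.solved by (metis id_comp)
next
  case False
  then have "C.osign g = - 1" using osign_cases by blast
  then have "C.osign (slice Up r \<circ> g) = 1"
    using sign_comp(1)[of "slice Up r" g] top_signs assms by (simp add: lawful_def)
  then show ?thesis using lawful_comp[OF top_signs(2) assms] valid_slice[of r] by auto
qed

text \<open>Turning the layer at \<open>height k\<close> changes the coupled sign of k and no other,
  and keeps the corner sign; so the signs can be corrected one by one.\<close>

lemma fix_coupled_signs:
  assumes "lawful g" "C.osign g = 1" "K \<subseteq> pair_orbits n"
  shows "\<exists>v. valid n v \<and> lawful (v \<circ> g) \<and> C.osign (v \<circ> g) = 1 \<and> (\<forall>k\<in>K. coupled_sign k (v \<circ> g) = 1)"
proof -
  have "finite K" using assms(3) by (rule finite_subset) (simp add: pair_orbits_def)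
  then show ?thesis using assms(3)
  proof (induction K rule: finite_induct)
    case empty
    show ?case using assms(1,2) valid.solved by (metis empty_iff id_comp)
  next
    case (insert k K)
    have "K \<subseteq> pair_orbits n" using insert.prems by blast
    then obtain v where v: "valid n v" "lawful (v \<circ> g)" "C.osign (v \<circ> g) = 1"
      "\<forall>k\<in>K. coupled_sign k (v \<circ> g) = 1" using insert.IH by blast
    show ?case
    proof (cases "coupled_sign k (v \<circ> g) = 1")
      case True
      then show ?thesis using v by blast
    next
      case False
      have k: "k \<in> pair_orbits n" using insert.prems by blast
      let ?f = "slice Up (height k)"
      have gd: "good ?f" "good (v \<circ> g)" using inner_signs(3)[OF k] v(2) by (simp_all add: lawful_def)
      have law: "lawful (?f \<circ> (v \<circ> g))" using lawful_comp inner_signs(3)[OF k] v(2) by blast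
      have cs: "C.osign (?f \<circ> (v \<circ> g)) = 1" using sign_comp(1)[OF gd] inner_signs(1)[OF k] v(3) by simp
      have "coupled_sign l (?f \<circ> (v \<circ> g)) = 1" if l: "l \<in> insert k K" for l
      proof -
        have li: "l \<in> inner_layers" using l insert.prems height_pair by blast
        have "coupled_sign k (v \<circ> g) = - 1" using osign_cases(2) False k height_pair by blast
        then show ?thesis
          using sign_comp(3)[OF gd li] inner_signs(2)[OF k li] v(4) l by auto
      qed
      moreover have "?f \<circ> (v \<circ> g) = (?f \<circ> v) \<circ> g" by (rule comp_assoc[symmetric])
      moreover have "valid n (?f \<circ> v)" using valid_comp valid_slice pair_height(1)[OF k] v(1) by simp
      ultimately show ?thesis using law cs by metis
    qed
  qed
qed

text \<open>With corner and coupled signs equal to 1, \<open>lawful\<close> makes the signs on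
  single edges and centres 1 as well, and each orbit can be solved separately.\<close>

lemma lawful_even_valid:
  assumes law: "lawful g" and c: "C.osign g = 1" and e: "\<And>i. i \<in> pair_orbits n \<Longrightarrow> coupled_sign i g = 1"
  shows "valid n g"
proof -
  have gd: "good g" using law by (simp add: lawful_def)
  define F where "F = {corner_orbit, edge_orbit 0} \<union> (\<lambda>i. edge_orbit (height i)) ` pair_orbits n \<union>
    (\<lambda>(i, j). center_at i j) ` (pair_orbits n \<times> inner_layers)"
  have FE: "A = corner_orbit \<or> (\<exists>k\<in>inner_layers. A = edge_orbit (height k)) \<or>
      (\<exists>i\<in>pair_orbits n. \<exists>j\<in>inner_layers. A = center_at i j)" if "A \<in> F" for A
  proof -
    have "\<exists>k\<in>inner_layers. edge_orbit 0 = edge_orbit (height k)"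
      using height_mid n_mid(2) by (intro bexI[of _ mid]) auto
    then show ?thesis using that height_pair unfolding F_def by auto
  qed
  have FI: "corner_orbit \<in> F" "k \<in> inner_layers \<Longrightarrow> edge_orbit (height k) \<in> F"
    "i \<in> pair_orbits n \<Longrightarrow> k \<in> inner_layers \<Longrightarrow> center_at i k \<in> F" for i k
    using inner_cases[of k] height_mid unfolding F_def by auto
  have restrict: "perm_restrict g A s = g s" if "s \<in> A" for A s using that by (simp add: perm_restrict_def)
  have out: "perm_restrict g A s = s" if "s \<notin> A" for A s using that by (simp add: perm_restrict_def)
  have sub_valid: "g ` A \<subseteq> A \<and> valid n (perm_restrict g A)" if "A \<in> F" for A
  proof -
    have corner: "g ` corner_orbit \<subseteq> corner_orbit \<and> valid n (perm_restrict g corner_orbit)"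
    proof
      show "g ` corner_orbit \<subseteq> corner_orbit" using gd C.compat_image by (auto simp: good_def)
      show "valid n (perm_restrict g corner_orbit)"
        by (rule corner_orbit_valid[OF C.cube_orbit_axioms])
          (use C.compat_cong[OF restrict] C.osign_cong[OF restrict] C.twist_cong[OF restrict] law gd c out
            in \<open>simp_all add: lawful_def good_def\<close>)
    qed
    have single: "g ` edge_orbit 0 \<subseteq> edge_orbit 0 \<and> valid n (perm_restrict g (edge_orbit 0))"
    proof
      show "g ` edge_orbit 0 \<subseteq> edge_orbit 0" using gd S.compat_image by (auto simp: good_def)
      show "valid n (perm_restrict g (edge_orbit 0))"
        by (rule edge_orbit_valid[OF zero_height S.cube_orbit_axioms])
          (use S.compat_cong[OF restrict] S.osign_cong[OF restrict] S.twist_cong[OF restrict] law gd c out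
            in \<open>simp_all add: lawful_def good_def\<close>)
    qed
    have coupled: "g ` edge_orbit (height i) \<subseteq> edge_orbit (height i) \<and> valid n (perm_restrict g (edge_orbit (height i)))"
      if i: "i \<in> pair_orbits n" for i
    proof
      interpret E: cube_orbit n r "edge_orbit (height i)" "edge_left (height i)" edge_flip fst "edge_lab (edge_left (height i))" 2
        by (rule pair_instance[OF i])
      have cg: "E.compat g" using gd i by (simp add: good_def)
      have sg: "E.osign g = 1" using e[OF i] pair_not_mid[OF i] by (simp add: coupled_sign_def)
      \<comment> \<open>The left-handed facelets, one on each cubie, are preserved, so a coupled
        orbit has no twist.\<close>
      have tr: "E.transversal (edge_left (height i))"
        by (rule edge_transversal[OF pair_height(4,2,3)[OF i] E.cube_orbit_axioms])
          (use edge_left_flip[OF pair_height(1-3)[OF i]] E.T_subset in blast)+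
      have tg: "[E.twist g = 0] (mod int 2)"
        by (rule E.twist_invariant_transversal[OF cg tr]) (use E.compat_T[OF cg] in blast)
      show "g ` edge_orbit (height i) \<subseteq> edge_orbit (height i)" using cg E.compat_image by auto
      show "valid n (perm_restrict g (edge_orbit (height i)))"
        by (rule edge_orbit_valid[OF pair_height(4,2,3)[OF i] E.cube_orbit_axioms])
          (use E.compat_cong[OF restrict] E.osign_cong[OF restrict] E.twist_cong[OF restrict] cg sg tg out
            in simp_all)
    qed
    have center: "g ` center_at i j \<subseteq> center_at i j \<and>
        valid n (perm_restrict g (center_at i j))"
      if ij: "i \<in> pair_orbits n" "j \<in> inner_layers" for i j
    proof
      let ?O = "center_at i j"
      interpret E: cube_orbit n r ?O ?O id id "\<lambda>_. 0" 1 by (rule center_instance[OF ij])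
      have cg: "E.compat g" using gd ij by (simp add: good_def)
      show "g ` ?O \<subseteq> ?O" using cg E.compat_image by auto
      have "E.bact g = perm_restrict g ?O"
      proof
        fix s
        show "E.bact g s = perm_restrict g ?O s"
          using E.bact_blk[OF cg, of s] by (cases "s \<in> ?O") (simp_all add: perm_restrict_def E.bact_def)
      qed
      moreover have "coupled_sign j g = 1" 
        using inner_cases[OF ij(2)] e[of j] coupled_sign_def[of mid g] by auto
      then have "E.osign g = 1" using law ij c e[OF ij(1)] by (simp add: lawful_def)
      ultimately have "perm_restrict g ?O permutes ?O" "sign (perm_restrict g ?O) = 1"
        using E.bact_permutes[OF cg] by (simp_all add: E.osign_def)
      then show "valid n (perm_restrict g ?O)"
        by (intro center_orbit_valid[OF pair_height(1,2)[OF ij(1)] neg_height(1,2)[OF ij(2)]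
            pair_height(3)[OF ij(1)] neg_height(3)[OF ij(2)]])
    qed
    show ?thesis
      using FE[OF that] corner single coupled center inner_cases height_mid by metis
  qed
  have disj: "A \<inter> B = {}" if AB: "A \<in> F" "B \<in> F" "A \<noteq> B" for A B
  proof (rule ccontr)
    assume "A \<inter> B \<noteq> {}"
    then obtain s where s: "s \<in> A" "s \<in> B" by blast
    have ce: "s \<notin> corner_orbit" if "s \<in> edge_orbit (height k)" "k \<in> inner_layers" for k
      using corner_edge_disjoint that height_layer by blast
    have cc: "s \<notin> corner_orbit" "s \<notin> edge_orbit \<gamma>"
      if "s \<in> center_at i j" "i \<in> pair_orbits n" "j \<in> inner_layers" for i j \<gamma>
      using corner_center_disjoint[OF pair_height(1,2)[OF that(2)] neg_height(1,2)[OF that(3)] that(1)]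
        edge_center_disjoint[OF pair_height(1,2)[OF that(2)] neg_height(1,2)[OF that(3)] that(1)] by blast+
    have ee: "edge_orbit (height k) = edge_orbit (height l)"
      if "s \<in> edge_orbit (height k)" "s \<in> edge_orbit (height l)" "k \<in> inner_layers" "l \<in> inner_layers" for k l
      using edge_orbit_unique[of "height k" "height l" s] height_layer that by auto
    have mm: "center_at i j = center_at i' j'"
      if "s \<in> center_at i j" "s \<in> center_at i' j'"
        "i \<in> pair_orbits n" "j \<in> inner_layers" "i' \<in> pair_orbits n" "j' \<in> inner_layers" for i j i' j'
      using center_orbit_unique[OF pair_height(1)[OF that(3)] neg_height(1)[OF that(4)]
          pair_height(1)[OF that(5)] neg_height(1)[OF that(6)] that(1,2)] by simp
    from FE[OF AB(1)] FE[OF AB(2)] show False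
      using s AB(3) ce cc ee mm by (elim disjE bexE) metis+
  qed
  have "finite F" unfolding F_def pair_orbits_def by simp
  then have "valid n (perm_restrict g (\<Union> F))"
    using valid_decompose[of F g] sub_valid disj by blast
  moreover have "perm_restrict g (\<Union> F) = g"
  proof
    fix s
    show "perm_restrict g (\<Union> F) s = g s"
    proof (cases "s \<in> \<Union> F")
      case False
      \<comment> \<open>A point outside all orbits is a face midpoint or lies off the cube; both are
        fixed.\<close>
      have "g s = s"
      proof (cases "s \<in> facelets n")
        case True
        have "s \<notin> corner_orbit" using False FI(1) by blast
        moreover have "s \<notin> edge_orbit \<gamma>" if "0 \<le> \<gamma>" "\<gamma> < r" "layer \<gamma>" for \<gamma>
          using height_surj[OF that(3,1,2)] False FI(2) by blast
        moreover have "s \<notin> center_orbit \<alpha> \<beta>"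
          if ab: "0 < \<alpha>" "\<alpha> < r" "\<beta> \<le> 0" "- r < \<beta>" "layer \<alpha>" "layer \<beta>" for \<alpha> \<beta>
        proof -
          obtain i where i: "i \<in> pair_orbits n" "height i = \<alpha>" using height_surj_pair ab by blast
          obtain j where j: "j \<in> inner_layers" "height j = - \<beta>"
            using height_surj[of "- \<beta>"] ab by auto
          have "center_orbit \<alpha> \<beta> \<in> F" using FI(3)[OF i(1) j(1)] i(2) j(2) by simp
          then show ?thesis using False by blast
        qed
        ultimately obtain X where "s = face_mid X" using facelets_cover[OF True] by blast
        then show ?thesis using gd by (simp add: good_def)
      next
        case False
        then show ?thesis using gd permutes_not_in by (metis good_def)
      qed
      then show ?thesis using out[OF False] by simp
    qed (rule restrict)
  qed
  ultimately show ?thesis by simp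
qed

lemma lawful_valid:
  assumes "lawful g"
  shows "valid n g"
proof -
  obtain v where v: "valid n v" "lawful (v \<circ> g)" "C.osign (v \<circ> g) = 1"
    using fix_corner_sign[OF assms] by blast
  obtain w where w: "valid n w" "lawful (w \<circ> (v \<circ> g))" "C.osign (w \<circ> (v \<circ> g)) = 1"
    "\<forall>k\<in>pair_orbits n. coupled_sign k (w \<circ> (v \<circ> g)) = 1"
    using fix_coupled_signs[OF v(2,3) subset_refl] by blast
  have wv: "valid n (w \<circ> v)" using valid_comp v w by blast
  have "valid n (w \<circ> (v \<circ> g))" using lawful_even_valid w by blast
  then have "valid n (inv (w \<circ> v) \<circ> ((w \<circ> v) \<circ> g))"
    using valid_comp[OF valid_inv[OF wv]] by (simp add: comp_assoc)
  moreover have "inv (w \<circ> v) \<circ> ((w \<circ> v) \<circ> g) = g"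
    using inv_o_cancel[OF bij_is_inj[OF valid_bij[OF wv]]] by (simp add: comp_assoc[symmetric])
  ultimately show ?thesis by metis
qed

text \<open>On the transversal of white and yellow facelets the initial labels are 0, so each label
  difference is the label at the place of arrival, which is the orientation. All labels are below 3,
  hence the sums agree as integers.\<close>

lemma corner_orient_twist:
  assumes g: "C.compat g"
  shows "int (\<Sum>p\<in>corners n. corner_orient n W g p) = C.twist g"
proof -
  let ?A = "white_yellow n W"
  have tr: "C.transversal ?A" by (rule white_yellow_transversal)
  have tg: "C.transversal (g ` ?A)" using C.transversal_image[OF g tr] .
  have sub: "?A \<subseteq> corner_orbit" using tr by (simp add: C.transversal_def)
  have "corners n = fst ` corner_orbit"
    using corner_positions unfolding corner_orbit_def by blast
  then have "int (\<Sum>p\<in>corners n. corner_orient n W g p) = (\<Sum>s\<in>?A. int (corner_orient n W g (fst (g s))))"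
    using C.sum_blk_transversal[OF g tr, of "\<lambda>p. int (corner_orient n W g p)"] by simp
  also have "\<dots> = (\<Sum>s\<in>?A. (corner_lab W (g s) - corner_lab W s) mod int 3)"
  proof (rule sum.cong[OF refl])
    fix s assume s: "s \<in> ?A"
    have uniq: "s' = s" if "s' \<in> ?A" "fst (g s') = fst (g s)" for s'
    proof -
      have "g s' = g s" using tg that s unfolding C.transversal_def bij_betw_def by (metis imageI inj_onD)
      then show ?thesis using C.compat_inj[OF g] sub that s by blast
    qed
    have "(\<exists>s'\<in>?A. fst (g s') = fst (g s) \<and> g s' \<in> ?A) \<longleftrightarrow> g s \<in> ?A"
      using uniq s by metis
    moreover have "(\<exists>s'\<in>?A. \<exists>t\<in>?A. fst (g s') = fst (g s) \<and> cw_step t (g s')) \<longleftrightarrow> (\<exists>t\<in>?A. cw_step t (g s))"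
      using uniq s by metis
    ultimately have "int (corner_orient n W g (fst (g s))) = corner_lab W (g s)"
      unfolding corner_orient_def corner_lab_def by simp
    moreover have "corner_lab W s = 0" using s by (simp add: corner_lab_def)
    moreover have "corner_lab W (g s) mod 3 = corner_lab W (g s)" by (simp add: corner_lab_def)
    ultimately show "int (corner_orient n W g (fst (g s))) = (corner_lab W (g s) - corner_lab W s) mod int 3"
      by simp
  qed
  also have "\<dots> = C.twist g" using C.twist_transversal[OF g tr] by simp
  finally show ?thesis .
qed

text \<open>As for corners, with the reference facelets as transversal and label 0.\<close>

lemma edge_orient_twist:
  assumes g: "S.compat g"
  shows "int (\<Sum>p\<in>single_edges n. edge_orient Ref g p) = S.twist g"
proof -
  have sub: "Ref \<subseteq> edge_orbit 0" using ref single_edges_iff unfolding reference_facelets_def by blast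
  have tr: "S.transversal Ref"
    by (rule edge_transversal[OF zero_height S.cube_orbit_axioms reference_flip[OF ref] sub])
  have tg: "S.transversal (g ` Ref)" using S.transversal_image[OF g tr] .
  have "single_edges n = fst ` edge_orbit 0" by (rule single_positions)
  then have "int (\<Sum>p\<in>single_edges n. edge_orient Ref g p) = (\<Sum>s\<in>Ref. int (edge_orient Ref g (fst (g s))))"
    using S.sum_blk_transversal[OF g tr, of "\<lambda>p. int (edge_orient Ref g p)"] by simp
  also have "\<dots> = (\<Sum>s\<in>Ref. (edge_lab Ref (g s) - edge_lab Ref s) mod int 2)"
  proof (rule sum.cong[OF refl])
    fix s assume s: "s \<in> Ref"
    have "s' = s" if "s' \<in> Ref" "fst (g s') = fst (g s)" for s'
    proof -
      have "g s' = g s" using tg that s unfolding S.transversal_def bij_betw_def by (metis imageI inj_onD)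
      then show ?thesis using S.compat_inj[OF g] sub that s by blast
    qed
    then have "(\<exists>s'\<in>Ref. fst (g s') = fst (g s) \<and> g s' \<in> Ref) \<longleftrightarrow> g s \<in> Ref" using s by metis
    then have "int (edge_orient Ref g (fst (g s))) = edge_lab Ref (g s)"
      unfolding edge_orient_def edge_lab_def by simp
    moreover have "edge_lab Ref s = 0" using s by (simp add: edge_lab_def)
    moreover have "edge_lab Ref (g s) mod 2 = edge_lab Ref (g s)" by (simp add: edge_lab_def)
    ultimately show "int (edge_orient Ref g (fst (g s))) = (edge_lab Ref (g s) - edge_lab Ref s) mod int 2"
      by simp
  qed
  also have "\<dots> = S.twist g" using S.twist_transversal[OF g tr] by simp
  finally show ?thesis .
qed

text \<open>An edge has just two facelets. Since \<open>g\<close> keeps them together and is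
  injective, it carries the other facelet of a cubie to the other facelet of the image.\<close>

lemma ecompatI:
  assumes al: "0 \<le> \<alpha>" "\<alpha> < r" "layer \<alpha>"
    and co: "cube_orbit n r (edge_orbit \<alpha>) (edge_left \<alpha>) edge_flip fst lab 2"
    and g: "g permutes facelets n" "g ` edge_orbit \<alpha> \<subseteq> edge_orbit \<alpha>"
      "\<forall>s\<in>facelets n. \<forall>t\<in>facelets n. fst s = fst t \<longrightarrow> fst (g s) = fst (g t)"
  shows "g ` edge_left \<alpha> \<subseteq> edge_left \<alpha> \<Longrightarrow> ecompat \<alpha> g"
    "s \<in> edge_orbit \<alpha> \<Longrightarrow> g (edge_flip s) = edge_flip (g s)"
proof -
  interpret E: cube_orbit n r "edge_orbit \<alpha>" "edge_left \<alpha>" edge_flip fst lab 2 by (rule co)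
  have fl: "g (edge_flip s) = edge_flip (g s)" if s: "s \<in> edge_orbit \<alpha>" for s
  proof -
    have s': "edge_flip s \<in> edge_orbit \<alpha>" using edge_flip_closed[OF al s] .
    have "[lab (edge_flip s) = lab s + 1] (mod int 2)" using E.lab_pi[OF s] .
    then have "edge_flip s \<noteq> s" by (auto simp: cong_def; presburger)
    then have ne: "g (edge_flip s) \<noteq> g s" using permutes_inj[OF g(1)] by (metis injD)
    have f: "s \<in> facelets n" "edge_flip s \<in> facelets n" using s s' E.Omega_facelets by blast+
    have "fst (g s) = fst (g (edge_flip s))" by (rule g(3)[rule_format, OF f fst_edge_flip[symmetric]])
    moreover have m: "g s \<in> edge_orbit \<alpha>" "g (edge_flip s) \<in> edge_orbit \<alpha>" using g(2) s s' by blast+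
    ultimately show ?thesis using edge_block[OF al m] ne by blast
  qed
  show "g (edge_flip s) = edge_flip (g s)" if "s \<in> edge_orbit \<alpha>" using fl that .
  show "ecompat \<alpha> g" if "g ` edge_left \<alpha> \<subseteq> edge_left \<alpha>"
    unfolding E.compat_def
    using fl g(2) that inj_on_subset[OF permutes_inj[OF g(1)] subset_UNIV] by simp
qed

text \<open>Rotating corners without reflection means commuting with \<open>corner_next\<close>. The
  condition on coupled orientations makes \<open>g\<close> preserve the left-handed
  facelets.\<close>

lemma S_conf_good:
  assumes g: "g \<in> S_conf n" and y: "\<And>i p. i \<in> pair_orbits n \<Longrightarrow> p \<in> coupled_edges n i \<Longrightarrow> edge_orient (left_handed n i) g p = 0"
  shows "good g"
proof -
  have perm: "g permutes facelets n"
    and together: "\<forall>s\<in>facelets n. \<forall>t\<in>facelets n. fst s = fst t \<longrightarrow> fst (g s) = fst (g t)"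
    and corner: "\<And>s. s \<in> facelets n \<Longrightarrow> fst s \<in> corners n \<Longrightarrow> fst (g s) \<in> corners n"
    and cw: "\<And>s t. s \<in> facelets n \<Longrightarrow> t \<in> facelets n \<Longrightarrow> fst s \<in> corners n \<Longrightarrow> cw_step s t \<Longrightarrow> cw_step (g s) (g t)"
    and single: "\<And>s. s \<in> facelets n \<Longrightarrow> fst s \<in> single_edges n \<Longrightarrow> fst (g s) \<in> single_edges n"
    and coupled: "\<And>i s. i \<in> pair_orbits n \<Longrightarrow> s \<in> facelets n \<Longrightarrow> fst s \<in> coupled_edges n i \<Longrightarrow> fst (g s) \<in> coupled_edges n i"
    and cc: "\<And>i s. i \<in> pair_orbits n \<Longrightarrow> s \<in> center_corners n i \<Longrightarrow> g s \<in> center_corners n i"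
    and ce: "\<And>i j s. (i, j) \<in> center_edge_orbits n \<Longrightarrow> s \<in> center_edges n i j \<Longrightarrow> g s \<in> center_edges n i j"
    and mids: "\<And>X. g (facelet_at n X ((n + 1) div 2) ((n + 1) div 2)) = facelet_at n X ((n + 1) div 2) ((n + 1) div 2)"
    using g unfolding S_conf_def mem_Collect_eq by blast+
  have in_f: "g s \<in> facelets n" if "s \<in> facelets n" for s using permutes_in_image[OF perm] that by blast
  have inj: "inj_on g A" for A using permutes_inj[OF perm] inj_on_subset by blast
  have cO: "g s \<in> corner_orbit" if "s \<in> corner_orbit" for s
    using that in_f corner unfolding corner_orbit_def by blast
  show ?thesis
    unfolding good_def
  proof (intro conjI ballI allI)
    show "g permutes facelets n" by (rule perm)
    show "g (face_mid X) = face_mid X" for X using mids[of X] by (simp only: face_mid_def mid_def)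
    show "C.compat g"
      unfolding C.compat_def
    proof (intro conjI ballI)
      show "g ` corner_orbit \<subseteq> corner_orbit" "g ` corner_orbit \<subseteq> corner_orbit" using cO by blast+
      show "inj_on g corner_orbit" by (rule inj)
      fix s assume s: "s \<in> corner_orbit"
      have s': "corner_next s \<in> corner_orbit" using corner_next_closed[OF s] .
      have "cw_step (g s) (g (corner_next s))"
        using cw cw_step_corner_next[OF s] s s' unfolding corner_orbit_def by blast
      then show "g (corner_next s) = corner_next (g s)" using cw_step_iff[OF cO[OF s] cO[OF s']] by blast
    qed
    have S: "g s \<in> edge_orbit 0" if s: "s \<in> edge_orbit 0" for s
    proof -
      have f: "s \<in> facelets n" using s S.Omega_facelets by blast
      show ?thesis using single[OF f] single_edges_iff[OF f] single_edges_iff[OF in_f[OF f]] s by blast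
    qed
    then have S': "g ` edge_orbit 0 \<subseteq> edge_orbit 0" by blast
    show "S.compat g"
      by (rule ecompatI(1)[OF zero_height S.cube_orbit_axioms perm S' together])
        (simp only: edge_left_zero S')
  next
    fix i assume i: "i \<in> pair_orbits n"
    note hi = pair_height[OF i]
    have S: "g s \<in> edge_orbit (height i)" if s: "s \<in> edge_orbit (height i)" for s
    proof -
      have f: "s \<in> facelets n" using s unfolding edge_orbit_def by blast
      show ?thesis
        using coupled[OF i f] coupled_edges_iff[OF i f] coupled_edges_iff[OF i in_f[OF f]] s by blast
    qed
    then have S': "g ` edge_orbit (height i) \<subseteq> edge_orbit (height i)" by blast
    note flip = ecompatI(2)[OF hi(4,2,3) pair_instance[OF i] perm S' together]
    show "ecompat (height i) g"
    proof (rule ecompatI(1)[OF hi(4,2,3) pair_instance[OF i] perm S' together])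
      show "g ` edge_left (height i) \<subseteq> edge_left (height i)"
      proof
        fix u assume "u \<in> g ` edge_left (height i)"
        then obtain s where s: "s \<in> edge_left (height i)" "u = g s" by blast
        then have sO: "s \<in> edge_orbit (height i)" by (simp add: edge_left_def)
        have f: "g s \<in> facelets n" using S[OF sO] unfolding edge_orbit_def by blast
        have "fst (g s) \<in> coupled_edges n i" using coupled_edges_iff[OF i f] S[OF sO] by blast
        \<comment> \<open>Orientation 0 at the position of \<open>g s\<close> yields a left-handed
          facelet of the same cubie that stays left-handed. The other facelet of that cubie is
          right-handed, so the one found is \<open>s\<close>.\<close>
        then have "edge_orient (edge_left (height i)) g (fst (g s)) = 0"
          using y[OF i] left_handed_eq[OF i] by simp
        then obtain s' where s': "s' \<in> edge_left (height i)" "fst (g s') = fst (g s)" "g s' \<in> edge_left (height i)"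
          unfolding edge_orient_def by (auto split: if_splits)
        have s'O: "s' \<in> edge_orbit (height i)" using s' by (simp add: edge_left_def)
        have "g s' = g s \<or> g s' = edge_flip (g s)"
          using edge_block[OF hi(4,2,3) S[OF sO] S[OF s'O]] s'(2) by simp
        then have "g s' = g s \<or> g s' = g (edge_flip s)" using flip[OF sO] by simp
        then have "s' = s \<or> s' = edge_flip s" using permutes_inj[OF perm] by (metis injD)
        moreover have "edge_flip s \<notin> edge_left (height i)" using edge_left_flip[OF hi(1-3) sO] s(1) by blast
        ultimately have "s' = s" using s'(1) by blast
        then show "u \<in> edge_left (height i)" using s' s by blast
      qed
    qed
    fix j assume j: "j \<in> inner_layers"
    interpret E: cube_orbit n r "center_at i j" "center_at i j" id id "\<lambda>_. 0" 1
      by (rule center_instance[OF i j])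
    have ij: "i \<le> n" "j \<le> n" using i j height_pair inner_le_n by blast+
    have "g s \<in> center_edges n i j" if s: "s \<in> center_edges n i j" for s
    proof (cases "i = j")
      case True
      then show ?thesis using cc[OF i] s center_corners_eq by blast
    next
      case False
      have "(i, j) \<in> center_edge_orbits n"
        using i j False unfolding center_edge_orbits_def pair_orbits_def mid_def by auto
      then show ?thesis using ce s by blast
    qed
    then have "g ` center_at i j \<subseteq> center_at i j"
      unfolding center_edges_eq[OF ij] by blast
    then show "center_compat i j g" unfolding E.compat_def using inj by simp
  qed
qed

end

section \<open>From the tuple of an arrangement to its validity\<close>

theorem theorem17:
  fixes n :: nat and W :: face and Ref :: "facelet set" and g :: "facelet \<Rightarrow> facelet"
    and \<sigma> \<tau>\<^sub>s :: "vec \<Rightarrow> vec" and \<tau>\<^sub>c :: "nat \<Rightarrow> vec \<Rightarrow> vec"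
    and \<rho>\<^sub>c :: "nat \<Rightarrow> facelet \<Rightarrow> facelet" and \<rho>\<^sub>e :: "nat \<Rightarrow> nat \<Rightarrow> facelet \<Rightarrow> facelet"
    and x :: "vec \<Rightarrow> nat" and y :: "nat \<Rightarrow> vec \<Rightarrow> nat" and z :: "vec \<Rightarrow> nat"
  assumes "n \<ge> 3" and "odd n"
    and "reference_facelets n Ref"
    and "g \<in> S_conf n"
    and "conf_tuple n W Ref g = (\<sigma>, \<tau>\<^sub>s, \<tau>\<^sub>c, \<rho>\<^sub>c, \<rho>\<^sub>e, x, y, z)"
    and "sign \<sigma> = sign \<tau>\<^sub>s"
    and "\<forall>i\<in>pair_orbits n. sign (\<rho>\<^sub>c i) = sign \<sigma>"
    and "\<forall>(i, j)\<in>center_edge_orbits n.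
           sign (\<rho>\<^sub>e i j) =
             sign \<sigma> * sign (\<tau>\<^sub>c i) * (if j = (n + 1) div 2 then 1 else sign (\<tau>\<^sub>c j))"
    and "[(\<Sum>p\<in>corners n. x p) = 0] (mod 3)"
    and "[(\<Sum>p\<in>single_edges n. z p) = 0] (mod 2)"
    and "\<forall>i\<in>pair_orbits n. \<forall>p\<in>coupled_edges n i. y i p = 0"
  shows "valid n g"
proof -
  interpret conf_cube n "int n - 1" W Ref
    by unfold_locales (use assms in auto)
  have tuple: "\<sigma> = perm_restrict (cubie_dest n g) (corners n)"
    "\<tau>\<^sub>s = perm_restrict (cubie_dest n g) (single_edges n)"
    "\<tau>\<^sub>c = (\<lambda>i. perm_restrict (cubie_dest n g) (coupled_edges n i))"
    "\<rho>\<^sub>c = (\<lambda>i. perm_restrict g (center_corners n i))"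
    "\<rho>\<^sub>e = (\<lambda>i j. perm_restrict g (center_edges n i j))"
    "x = corner_orient n W g" "y = (\<lambda>i. edge_orient (left_handed n i) g)" "z = edge_orient Ref g"
    using assms(5) unfolding conf_tuple_def prod.inject by simp_all
  have gd: "good g"
    using S_conf_good[OF assms(4)] assms(11) unfolding tuple by blast
  have \<sigma>: "sign \<sigma> = C.osign g"
  proof -
    have "\<sigma> = C.bact g"
      unfolding tuple
      by (rule perm_restrict_cubie_dest[OF C.cube_orbit_axioms])
        (use corner_positions gd in \<open>auto simp: corner_orbit_def good_def\<close>)
    then show ?thesis by (simp add: C.osign_def)
  qed
  have \<tau>s: "sign \<tau>\<^sub>s = S.osign g"
  proof -
    have "\<tau>\<^sub>s = S.bact g"
      unfolding tuple
    proof (rule perm_restrict_cubie_dest[OF S.cube_orbit_axioms])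
      show "edge_orbit 0 = {s \<in> facelets n. fst s \<in> single_edges n}"
        using single_edges_iff S.Omega_facelets by blast
      show "single_edges n \<subseteq> fst ` facelets n" using single_positions S.Omega_facelets by auto
      show "S.compat g" using gd by (simp add: good_def)
    qed
    then show ?thesis by (simp add: S.osign_def)
  qed
  have \<tau>c: "sign (\<tau>\<^sub>c i) = coupled_sign i g" if i: "i \<in> pair_orbits n" for i
  proof -
    interpret E: cube_orbit n "int n - 1" "edge_orbit (height i)" "edge_left (height i)" edge_flip fst "edge_lab (edge_left (height i))" 2
      by (rule pair_instance[OF i])
    have "\<tau>\<^sub>c i = E.bact g"
      unfolding tuple
    proof (rule perm_restrict_cubie_dest[OF E.cube_orbit_axioms])
      show "edge_orbit (height i) = {s \<in> facelets n. fst s \<in> coupled_edges n i}"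
        using coupled_edges_iff[OF i] E.Omega_facelets by blast
      show "coupled_edges n i \<subseteq> fst ` facelets n" using coupled_positions[OF i] E.Omega_facelets by auto
      show "E.compat g" using gd i by (simp add: good_def)
    qed
    then show ?thesis using pair_not_mid[OF i] by (simp add: E.osign_def coupled_sign_def)
  qed
  have \<rho>: "sign (perm_restrict g (center_edges n i j)) = center_sign i j g"
    if ij: "i \<in> pair_orbits n" "j \<in> inner_layers" for i j
  proof -
    let ?O = "center_at i j"
    interpret E: cube_orbit n "int n - 1" ?O ?O id id "\<lambda>_. 0" 1 by (rule center_instance[OF ij])
    have le: "i \<le> n" "j \<le> n" using ij height_pair inner_le_n by blast+
    have cg: "E.compat g" using gd ij by (simp add: good_def)
    have "perm_restrict g ?O = E.bact g"
    proof
      fix s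
      show "perm_restrict g ?O s = E.bact g s"
        using E.bact_blk[OF cg, of s] by (cases "s \<in> ?O") (simp_all add: perm_restrict_def E.bact_def)
    qed
    then show ?thesis by (simp add: center_edges_eq[OF le] E.osign_def)
  qed
  have "center_sign i j g = C.osign g * coupled_sign i g * coupled_sign j g"
    if ij: "i \<in> pair_orbits n" "j \<in> inner_layers" for i j
  proof (cases "i = j")
    case True
    \<comment> \<open>The diagonal case is the condition on centre corners, because the square of a
      sign is 1.\<close>
    have "coupled_sign i g * coupled_sign i g = 1"
      using osign_cases(2)[of i g] height_pair[OF ij(1)] by auto
    moreover have "center_sign i j g = C.osign g"
      using \<rho>[OF ij] assms(7) ij(1) \<sigma> True center_corners_eq unfolding tuple by simp
    ultimately show ?thesis using True by simp
  next
    case False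
    then have "(i, j) \<in> center_edge_orbits n"
      using ij unfolding center_edge_orbits_def pair_orbits_def mid_def by auto
    then have "sign (\<rho>\<^sub>e i j) = sign \<sigma> * sign (\<tau>\<^sub>c i) * (if j = mid then 1 else sign (\<tau>\<^sub>c j))"
      using assms(8) unfolding mid_def by blast
    moreover have "(if j = mid then 1 else sign (\<tau>\<^sub>c j)) = coupled_sign j g"
      using \<tau>c inner_cases[OF ij(2)] by (auto simp: coupled_sign_def)
    moreover have "sign (\<rho>\<^sub>e i j) = center_sign i j g" using \<rho>[OF ij] tuple(5) by simp
    ultimately show ?thesis using \<sigma> \<tau>c[OF ij(1)] by simp
  qed
  moreover have "[C.twist g = 0] (mod int 3)"
    using corner_orient_twist[of g] gd assms(9) cong_int_iff[of "\<Sum>p\<in>corners n. x p" 0 3] unfolding tuple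
    by (simp add: good_def)
  moreover have "[S.twist g = 0] (mod int 2)"
    using edge_orient_twist[of g] gd assms(10) cong_int_iff[of "\<Sum>p\<in>single_edges n. z p" 0 2] unfolding tuple
    by (simp add: good_def)
  ultimately have "lawful g"
    unfolding lawful_def using gd assms(6) \<sigma> \<tau>s by simp
  then show ?thesis by (rule lawful_valid)
qed

end
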